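(* Let $n\ge 2$. Let $\mathcal{K}_n$ be the Kauffman monoid and let $[\mathcal{D}_n]$ be the monoid of equivalence classes of $n$-diagrams, with unit $[I]$ and multiplication $[D_1][D_2]=[D_1\circ D_2]$. The assignment $$\delta'(h^i)=[H^i]\ (1\le i\le n-1),\qquad \delta'(c)=[C],\qquad \delta'(\mathbf 1)=[I],\qquad \delta'(tu)=\delta'(t)\delta'(u)$$ defines an isomorphism of monoids $\delta':\mathcal{K}_n\to[\mathcal{D}_n]$.
   Context: Kauffman monoid. Let $n\ge 2$. Terms are built inductively from the generators $h^1,\dots,h^{n-1}$ (diapsides) and $c$ (the circle) and the constant $\mathbf 1$ by the binary operation $(t,u)\mapsto (tu)$ (superscripts on $h$ are indices, not powers). The Kauffman monoid $\mathcal{K}_n$ is the monoid with unit $\mathbf 1$ presented by these generators and the relations (h1) $h^ih^j=h^jh^i$ for $|i-j|\ge 2$; (h2) $h^ih^{i\pm1}h^i=h^i$ (whenever the indices lie in $\{1,\dots,n-1\}$); (hc1) $h^ic=ch^i$; (hc2) $h^ih^i=ch^i$. That is, two terms are equal in $\mathcal{K}_n$ iff their equality follows from these relations and the monoid axioms. $n$-diagrams. For real $a>0$ let $R_{n,a}=[0,n+1]\times[0,a]$, with top $[0,n+1]\times\{a\}$ and bottom $[0,n+1]\times\{0\}$. An $n$-diagram $D$ in $R_{n,a}$ (for some real $a>0$) is a compact one-manifold with boundary, with finitely many connected components, embedded in $R_{n,a}$, such that its intersection with the top is $t(D)=\{(i,a): i=1,\dots,n\}$, its intersection with the bottom is $b(D)=\{(i,0):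 i=1,\dots,n\}$, and $t(D)\cup b(D)$ is its set of boundary points. Its components homeomorphic to $[0,1]$ are called threads; its components homeomorphic to the circle $S^1$ are called circular components. A thread is transversal if it has one end point in $t(D)$ and one in $b(D)$; otherwise it is a cup if both end points are in $t(D)$, and a cap if both are in $b(D)$. Equivalence. $n$-diagrams $D_1$ in $R_{n,a}$ and $D_2$ in $R_{n,b}$ are equivalent, $D_1\simeq D_2$, iff there is a homeomorphism $g:D_1\to D_2$ with $g(i,0)=(i,0)$ and $g(i,a)=(i,b)$ for $i=1,\dots,n$. $[D]$ denotes the equivalence class of $D$, and $[\mathcal{D}_n]$ the set of equivalence classes of $n$-diagrams. Composition. For $D_1$ in $R_{n,a}$ and $D_2$ in $R_{n,b}$, $D_2\circ D_1=\{(x,y+b):(x,y)\in D_1\}\cup D_2$, an $n$-diagram in $R_{n,a+b}$ ($D_1$ is placed above $D_2$). This respects equivalence. Particular diagrams. The unit $n$-diagram is $I=\{(i,y): i\in\{1,\dots,n\},\ y\in[0,1]\}$ in $R_{n,1}$. The circular $n$-diagram $C$ is $I$ together with one circular component, the circle of radius $1/4$ with centre $(1/2,1/2)$. With $a(n)=\max\{5,(n-1)(n-2)/2\}$, the diapsidal $n$-diagram $H^i$ ($1\le i\le n-1$) in $R_{n,a(n)}$ has no circular components, has a single cup, a semicircle with end points $(i,a(n))$ and $(i+1,a(n))$, a single cap, a semicircle with end points $(i,0)$ and $(i+1,0)$, and all its other threads are vertical straight line segments $\{j\}\times[0,a(n)]$ for $j\in\{1,\dots,n\}\setminus\{i,i+1\}$.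 *)

theory Defs
  imports "HOL-Analysis.Analysis" "HOL-Algebra.Group"
begin

section \<open>The Kauffman monoid\<close>

datatype kterm = Diap nat | Circ | One | Comp kterm kterm

primrec kterm_over :: "nat \<Rightarrow> kterm \<Rightarrow> bool" where
  "kterm_over n (Diap i) \<longleftrightarrow> i \<in> {1..n - 1}"
| "kterm_over n Circ \<longleftrightarrow> True"
| "kterm_over n One \<longleftrightarrow> True"
| "kterm_over n (Comp t u) \<longleftrightarrow> kterm_over n t \<and> kterm_over n u"

definition kterms :: "nat \<Rightarrow> kterm set" where
  "kterms n = {t. kterm_over n t}"

text \<open>All terms related by the following congruence lie in \<open>kterms n\<close>.\<close>

inductive kauffman_eq :: "nat \<Rightarrow> kterm \<Rightarrow> kterm \<Rightarrow> bool" for n where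
  refl: "t \<in> kterms n \<Longrightarrow> kauffman_eq n t t"
| sym: "kauffman_eq n t u \<Longrightarrow> kauffman_eq n u t"
| trans: "kauffman_eq n t u \<Longrightarrow> kauffman_eq n u v \<Longrightarrow> kauffman_eq n t v"
| cong: "kauffman_eq n t t' \<Longrightarrow> kauffman_eq n u u' \<Longrightarrow>
    kauffman_eq n (Comp t u) (Comp t' u')"
| assoc: "t \<in> kterms n \<Longrightarrow> u \<in> kterms n \<Longrightarrow> v \<in> kterms n \<Longrightarrow>
    kauffman_eq n (Comp (Comp t u) v) (Comp t (Comp u v))"
| left_unit: "t \<in> kterms n \<Longrightarrow> kauffman_eq n (Comp One t) t"
| right_unit: "t \<in> kterms n \<Longrightarrow> kauffman_eq n (Comp t One) t"
| h1: "i \<in> {1..n - 1} \<Longrightarrow> j \<in> {1..n - 1} \<Longrightarrow> \<bar>int i - int j\<bar> \<ge> 2 \<Longrightarrow>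
    kauffman_eq n (Comp (Diap i) (Diap j)) (Comp (Diap j) (Diap i))"
| h2: "i \<in> {1..n - 1} \<Longrightarrow> j \<in> {1..n - 1} \<Longrightarrow> j = i + 1 \<or> i = j + 1 \<Longrightarrow>
    kauffman_eq n (Comp (Comp (Diap i) (Diap j)) (Diap i)) (Diap i)"
| hc1: "i \<in> {1..n - 1} \<Longrightarrow>
    kauffman_eq n (Comp (Diap i) Circ) (Comp Circ (Diap i))"
| hc2: "i \<in> {1..n - 1} \<Longrightarrow>
    kauffman_eq n (Comp (Diap i) (Diap i)) (Comp Circ (Diap i))"

definition kauffman_rel :: "nat \<Rightarrow> (kterm \<times> kterm) set" where
  "kauffman_rel n = {(t, u). kauffman_eq n t u}"

definition kclass :: "nat \<Rightarrow> kterm \<Rightarrow> kterm set" where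
  "kclass n t = kauffman_rel n `` {t}"

definition kauffman_monoid :: "nat \<Rightarrow> kterm set monoid" where
  "kauffman_monoid n =
    \<lparr> carrier = kterms n // kauffman_rel n,
      mult = (\<lambda>X Y. \<Union>t\<in>X. \<Union>u\<in>Y. kclass n (Comp t u)),
      one = kclass n One \<rparr>"


section \<open>One-manifolds with boundary\<close>

text \<open>
  A chart maps an open part \<open>U\<close> of \<open>M\<close> homeomorphically onto an open subset of the half-line
  \<open>[0, \<infinity>)\<close>. The Hausdorff and countability conditions on manifolds are automatic
  for the subspaces of the plane considered below.
\<close>

definition half_line_chart :: "'a::topological_space set \<Rightarrow> 'a set \<Rightarrow> ('a \<Rightarrow> real) \<Rightarrow> bool" where
  "half_line_chart M U f \<longleftrightarrow>
    openin (top_of_set M) U \<and>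
    (\<exists>V g. openin (top_of_set {0..}) V \<and> homeomorphism U V f g)"

definition one_manifold_with_boundary :: "'a::topological_space set \<Rightarrow> bool" where
  "one_manifold_with_boundary M \<longleftrightarrow> (\<forall>p\<in>M. \<exists>U f. p \<in> U \<and> half_line_chart M U f)"

definition boundary_points :: "'a::topological_space set \<Rightarrow> 'a set" where
  "boundary_points M = {p \<in> M. \<exists>U f. p \<in> U \<and> half_line_chart M U f \<and> f p = 0}"


section \<open>Diagrams\<close>

text \<open>A diagram \<open>D\<close> in \<open>R n a\<close> is represented by the pair \<open>(a, D)\<close>.\<close>

type_synonym diagram = "real \<times> (real \<times> real) set"

definition R :: "nat \<Rightarrow> real \<Rightarrow> (real \<times> real) set" where
  "R n a = {0..real n + 1} \<times> {0..a}"

definition R_top :: "nat \<Rightarrow> real \<Rightarrow> (real \<times> real) set" where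
  "R_top n a = {0..real n + 1} \<times> {a}"

definition R_bottom :: "nat \<Rightarrow> (real \<times> real) set" where
  "R_bottom n = {0..real n + 1} \<times> {0}"

definition top_points :: "nat \<Rightarrow> real \<Rightarrow> (real \<times> real) set" where
  "top_points n a = (\<lambda>i. (real i, a)) ` {1..n}"

definition bottom_points :: "nat \<Rightarrow> (real \<times> real) set" where
  "bottom_points n = (\<lambda>i. (real i, 0)) ` {1..n}"

definition diagrams :: "nat \<Rightarrow> diagram set" where
  "diagrams n = {(a, D). a > 0 \<and> D \<subseteq> R n a \<and>
    compact D \<and> one_manifold_with_boundary D \<and> finite (components D) \<and>
    D \<inter> R_top n a = top_points n a \<and> D \<inter> R_bottom n = bottom_points n \<and>
    boundary_points D = top_points n a \<union> bottom_points n}"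

definition diagram_rel :: "nat \<Rightarrow> (diagram \<times> diagram) set" where
  "diagram_rel n = {((a, D), (b, E)). (a, D) \<in> diagrams n \<and> (b, E) \<in> diagrams n \<and>
    (\<exists>g g'. homeomorphism D E g g' \<and>
      (\<forall>i\<in>{1..n}. g (real i, 0) = (real i, 0) \<and> g (real i, a) = (real i, b)))}"

definition dclass :: "nat \<Rightarrow> diagram \<Rightarrow> diagram set" where
  "dclass n D = diagram_rel n `` {D}"

text \<open>In \<open>dcomp X Y\<close>, i.e. \<open>X \<circ> Y\<close>, the second argument is placed above the first.\<close>

fun dcomp :: "diagram \<Rightarrow> diagram \<Rightarrow> diagram" where
  "dcomp (b, D2) (a, D1) = (a + b, (\<lambda>(x, y). (x, y + b)) ` D1 \<union> D2)"

definition unit_diagram :: "nat \<Rightarrow> diagram" where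
  "unit_diagram n = (1, (real ` {1..n}) \<times> {0..1})"

definition circular_diagram :: "nat \<Rightarrow> diagram" where
  "circular_diagram n = (1, (real ` {1..n}) \<times> {0..1} \<union> sphere (1/2, 1/2) (1/4))"

definition diapsidal_height :: "nat \<Rightarrow> real" where
  "diapsidal_height n = max 5 ((real n - 1) * (real n - 2) / 2)"

definition diapsidal_diagram :: "nat \<Rightarrow> nat \<Rightarrow> diagram" where
  "diapsidal_diagram n i = (let a = diapsidal_height n in
    (a, {p \<in> sphere (real i + 1/2, a) (1/2). snd p \<le> a} \<union>
        {p \<in> sphere (real i + 1/2, 0) (1/2). snd p \<ge> 0} \<union>
        (real ` ({1..n} - {i, i + 1})) \<times> {0..a}))"

definition diagram_monoid :: "nat \<Rightarrow> diagram set monoid" where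
  "diagram_monoid n =
    \<lparr> carrier = diagrams n // diagram_rel n,
      mult = (\<lambda>X Y. \<Union>D\<in>X. \<Union>E\<in>Y. dclass n (dcomp D E)),
      one = dclass n (unit_diagram n) \<rparr>"


section \<open>The assignment on terms\<close>

primrec delta :: "nat \<Rightarrow> kterm \<Rightarrow> diagram set" where
  "delta n (Diap i) = dclass n (diapsidal_diagram n i)"
| "delta n Circ = dclass n (circular_diagram n)"
| "delta n One = dclass n (unit_diagram n)"
| "delta n (Comp t u) = delta n t \<otimes>\<^bsub>diagram_monoid n\<^esub> delta n u"

end

theory Submission
  imports Defs
begin

text \<open>The idea of the proof is that both monoids are described by the same combinatorial data: a
noncrossing perfect matching of the $2n$ marked points together with a number of circles.

\<^bold>\<open>Diagrams.\<close> The marked points of a diagram are numbered \<open>1, \<dots>, n\<close> along the top from left to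
right and \<open>n + 1, \<dots>, 2n\<close> along the bottom from right to left, so that the numbers follow the
boundary of the rectangle. A compact connected one-manifold is an arc or a simple closed curve
(\<open>arc_component\<close>, \<open>not_one_boundary_point\<close>, \<open>closed_manifold_is_circle\<close>), so the components
of a diagram are arcs, which match the marked points in pairs, and circles. Since homeomorphisms can be
chosen on each component separately, two diagrams are equivalent iff they have the same matching
and the same number of circles (\<open>diagram_rel_iff\<close>). By the Fashoda theorem the matching has no
crossings (\<open>matching_of_noncrossing\<close>).

\<^bold>\<open>Composition.\<close> Putting $H^i$ on top of a diagram joins the points \<open>i\<close>, \<open>i + 1\<close> to each other and
their former partners to each other; if \<open>i\<close> and \<open>i + 1\<close> were partners, a new circle appears
instead (\<open>dcomp_act\<close>). To find the matching of a composite it is enough to exhibit connections,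
because every thread has only two ends. The defining relations of the Kauffman monoid thus reduce
to identities between operations on matchings (\<open>kauffman_eq_sound\<close>).

\<^bold>\<open>Normal forms.\<close> Every noncrossing matching arises from the empty one by inserting pairs of neighbours.
Undoing the insertions, always at the first pair of neighbours, yields a word
\<open>normal_form m f\<close> for the matching \<open>f\<close>. It evaluates to \<open>f\<close> without producing circles
(\<open>eval_nf\<close>), which gives surjectivity. Multiplying a normal form by a generator gives a normal form again, up to
a circle, by the relations alone (\<open>nf_act\<close>). Hence every term is equal in the Kauffman monoid to a power
of the circle times the normal form of its matching (\<open>word_nf\<close>), and terms with equivalent
diagrams are equal: this is injectivity (\<open>kauffman_eq_complete\<close>).\<close>

section \<open>Matchings of the marked points\<close>

text \<open>A matching of \<open>2n\<close> points is coded as an involution of the natural numbers that fixes exactly the numbers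
outside \<open>{1..2n}\<close>. Equality of matchings is then equality of functions. Inserting a pair of neighbours at
\<open>j\<close>, \<open>j + 1\<close> relabels the old points by \<open>skip j\<close>, which leaves room for the new pair; \<open>unskip j\<close> is
a left inverse of it.\<close>

definition skip :: "nat \<Rightarrow> nat \<Rightarrow> nat" where
  "skip j q = (if q < j then q else q + 2)"

definition unskip :: "nat \<Rightarrow> nat \<Rightarrow> nat" where
  "unskip j p = (if p < j then p else p - 2)"

definition insert_pair :: "nat \<Rightarrow> (nat \<Rightarrow> nat) \<Rightarrow> nat \<Rightarrow> nat" where
  "insert_pair j g p = (if p = j then j + 1 else if p = j + 1 then j else skip j (g (unskip j p)))"

text \<open>The effect on the matching when $H^i$ is put on top of a diagram. The order of the updates
makes the formula also correct when \<open>i\<close> and \<open>i + 1\<close> are already partners: it then returns \<open>f\<close>.\<close>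

definition act :: "nat \<Rightarrow> (nat \<Rightarrow> nat) \<Rightarrow> nat \<Rightarrow> nat" where
  "act i f = f(i := i + 1, i + 1 := i, f i := f (i + 1), f (i + 1) := f i)"

text \<open>The matching of the unit diagram: the bottom point below the top point \<open>p\<close> has number \<open>2n + 1 - p\<close>.\<close>

definition id_matching :: "nat \<Rightarrow> nat \<Rightarrow> nat" where
  "id_matching n p = (if p \<in> {1..2*n} then 2*n + 1 - p else p)"

definition matching :: "nat \<Rightarrow> (nat \<Rightarrow> nat) \<Rightarrow> bool" where
  "matching n f \<longleftrightarrow> (\<forall>p. f (f p) = p) \<and> (\<forall>p\<in>{1..2*n}. f p \<noteq> p) \<and> (\<forall>p. p \<notin> {1..2*n} \<longrightarrow> f p = p)"

text \<open>Pairs are inserted in the first half or in the middle only. Every noncrossing matching is obtained in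
this way (\<open>noncrossingI\<close>), and for such \<open>j\<close> the insertion is realised by
multiplication with generators (see \<open>normal_form\<close>).\<close>

inductive noncrossing :: "nat \<Rightarrow> (nat \<Rightarrow> nat) \<Rightarrow> bool" where
  noncrossing_0: "noncrossing 0 (\<lambda>p. p)"
| noncrossing_insert: "noncrossing m g \<Longrightarrow> 1 \<le> j \<Longrightarrow> j \<le> m + 1 \<Longrightarrow> noncrossing (Suc m) (insert_pair j g)"

lemma skip_cases: obtains "p = j" | "p = j + 1" | q where "p = skip j q"
proof -
  have "p = j \<or> p = j + 1 \<or> p = skip j (if p < j then p else p - 2)"
    by (auto simp: skip_def)
  then show thesis using that by blast
qed

lemma skip_simps [simp]: "skip j q \<noteq> j" "skip j q \<noteq> Suc j" "j \<noteq> skip j q" "Suc j \<noteq> skip j q"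
  "unskip j (skip j q) = q" "skip j q = skip j r \<longleftrightarrow> q = r"
  by (auto simp: skip_def unskip_def)

lemma insert_simps [simp]: "insert_pair j g j = Suc j" "insert_pair j g (Suc j) = j" "insert_pair j g (skip j q) = skip j (g q)"
  by (auto simp: insert_pair_def)

lemma insert_eqI:
  assumes "f j = Suc j" "f (Suc j) = j" "\<And>q. f (skip j q) = skip j (g q)"
  shows "f = insert_pair j g"
proof
  fix p show "f p = insert_pair j g p"
    by (rule skip_cases[of p j]) (use assms in auto)
qed

lemma matching_range: "matching n f \<Longrightarrow> p \<in> {1..2*n} \<Longrightarrow> f p \<in> {1..2*n}"
  unfolding matching_def by metis

lemma matching_insert_pair:
  assumes "matching m g" "1 \<le> j" "j \<le> 2*m + 1"
  shows "matching (Suc m) (insert_pair j g)"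
  unfolding matching_def
proof (intro conjI allI ballI impI)
  fix p
  show "insert_pair j g (insert_pair j g p) = p"
    by (rule skip_cases[of p j]) (use assms in \<open>auto simp: matching_def\<close>)
next
  fix p assume "p \<in> {1..2*Suc m}"
  then show "insert_pair j g p \<noteq> p"
  proof (cases rule: skip_cases[of p j])
    case (3 q)
    then have "q \<in> {1..2*m}"
      using \<open>p \<in> _\<close> assms by (auto simp: skip_def split: if_splits)
    then show ?thesis using 3 assms by (auto simp: matching_def)
  qed auto
next
  fix p assume "p \<notin> {1..2*Suc m}"
  then show "insert_pair j g p = p"
  proof (cases rule: skip_cases[of p j])
    case (3 q)
    then have "q \<notin> {1..2*m}"
      using \<open>p \<notin> _\<close> assms by (auto simp: skip_def split: if_splits)
    then have "g q = q" using assms by (auto simp: matching_def)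
    then show ?thesis using 3 by simp
  qed (use assms \<open>p \<notin> _\<close> in auto)
qed

lemma noncrossing_matching: "noncrossing m f \<Longrightarrow> matching m f"
proof (induction rule: noncrossing.induct)
  case noncrossing_0 show ?case by (simp add: matching_def)
next
  case (noncrossing_insert m g j) then show ?case by (intro matching_insert_pair) auto
qed

text \<open>If the insertion does not separate the points \<open>i\<close> and \<open>i + 1\<close>, the generator that acts on them has the
index \<open>skip j i\<close> afterwards.\<close>

lemma act_insert_shift:
  assumes "\<And>p. g (g p) = p" "skip j (Suc i) = Suc (skip j i)"
  shows "act (skip j i) (insert_pair j g) = insert_pair j (act i g)"
proof (rule insert_eqI)
  show "act (skip j i) (insert_pair j g) j = Suc j"
    using assms by (auto simp: act_def simp flip: assms(2))
  show "act (skip j i) (insert_pair j g) (Suc j) = j"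
    using assms by (auto simp: act_def simp flip: assms(2))
  fix q show "act (skip j i) (insert_pair j g) (skip j q) = skip j (act i g q)"
    using assms by (auto simp: act_def simp flip: assms(2))
qed

lemma act_insert_same: "act j (insert_pair j g) = insert_pair j g"
  by (auto simp: act_def)

text \<open>A generator that touches an inserted pair in only one point pushes the pair one place
to the right, or, in the next lemma, to the left.\<close>

lemma act_insert_Suc:
  assumes "matching m g" "1 \<le> j" "j \<le> 2*m"
  shows "act (Suc j) (insert_pair j g) = insert_pair (Suc j) g"
proof
  fix p
  have g: "g (g q) = q" "g j \<noteq> j" for q
    using assms by (auto simp: matching_def)
  have c: "insert_pair j g (Suc j) = j" "insert_pair j g (Suc (Suc j)) = skip j (g j)"
    by (auto simp: insert_pair_def unskip_def)
  consider "p = j" | "p = Suc j" | "p = Suc (Suc j)" | "p < j" "p = g j" | "p < j" "p \<noteq> g j"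
    | "p > Suc (Suc j)" "p = g j + 2" | "p > Suc (Suc j)" "p \<noteq> g j + 2" by linarith
  then show "act (Suc j) (insert_pair j g) p = insert_pair (Suc j) g p"
  proof cases
    case 5
    then have "g p \<noteq> j" using g by metis
    then show ?thesis using 5 g c by (auto simp: act_def insert_pair_def skip_def unskip_def)
  next
    case 7
    then have "g (p - 2) \<noteq> j" using g(1)[of "p - 2"] by auto
    then show ?thesis using 7 g c by (auto simp: act_def insert_pair_def skip_def unskip_def)
  qed (use g c in \<open>auto simp: act_def insert_pair_def skip_def unskip_def\<close>)
qed

lemma act_insert_pred:
  assumes "matching m g" "1 \<le> j" "j \<le> 2*m"
  shows "act j (insert_pair (Suc j) g) = insert_pair j g"
proof
  fix p
  have g: "g (g q) = q" "g j \<noteq> j" for q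
    using assms by (auto simp: matching_def)
  have c: "insert_pair (Suc j) g (Suc j) = Suc (Suc j)" "insert_pair (Suc j) g j = skip (Suc j) (g j)"
    by (auto simp: insert_pair_def unskip_def)
  consider "p = j" | "p = Suc j" | "p = Suc (Suc j)" | "p < j" "p = g j" | "p < j" "p \<noteq> g j"
    | "p > Suc (Suc j)" "p = g j + 2" | "p > Suc (Suc j)" "p \<noteq> g j + 2" by linarith
  then show "act j (insert_pair (Suc j) g) p = insert_pair j g p"
  proof cases
    case 5
    then have "g p \<noteq> j" using g by metis
    then show ?thesis using 5 g c by (auto simp: act_def insert_pair_def skip_def unskip_def)
  next
    case 7
    then have "g (p - 2) \<noteq> j" using g(1)[of "p - 2"] by auto
    then show ?thesis using 7 g c by (auto simp: act_def insert_pair_def skip_def unskip_def)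
  qed (use g c in \<open>auto simp: act_def insert_pair_def skip_def unskip_def\<close>)
qed

lemma insert_exchange:
  assumes "i \<le> j"
  shows "insert_pair (j + 2) (insert_pair i g) = insert_pair i (insert_pair j g)"
proof
  fix p
  consider "p < i" | "p = i" | "p = Suc i" | "p \<ge> i + 2" "p < j + 2" | "p = j + 2" | "p = j + 3" | "p \<ge> j + 4"
    by linarith
  then show "insert_pair (j + 2) (insert_pair i g) p = insert_pair i (insert_pair j g) p"
    by cases (use assms in \<open>auto simp: insert_pair_def skip_def unskip_def\<close>)
qed

definition first_pair :: "(nat \<Rightarrow> nat) \<Rightarrow> nat" where
  "first_pair f = (LEAST p. 1 \<le> p \<and> f p = Suc p)"

definition remove_pair :: "nat \<Rightarrow> (nat \<Rightarrow> nat) \<Rightarrow> nat \<Rightarrow> nat" where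
  "remove_pair j f q = unskip j (f (skip j q))"

lemma remove_insert [simp]: "remove_pair j (insert_pair j g) = g"
  by (simp add: remove_pair_def fun_eq_iff)

lemma first_pair_insert:
  assumes "1 \<le> j" "\<And>p. 1 \<le> p \<Longrightarrow> p + 1 < j \<Longrightarrow> g p \<noteq> Suc p"
  shows "first_pair (insert_pair j g) = j"
  unfolding first_pair_def
proof (rule Least_equality)
  show "1 \<le> j \<and> insert_pair j g j = Suc j" using assms by simp
  fix p assume p: "1 \<le> p \<and> insert_pair j g p = Suc p"
  show "j \<le> p"
  proof (rule ccontr)
    assume "\<not> j \<le> p"
    then have "p < j" by simp
    then have "skip j (g p) = Suc p" using p by (auto simp: insert_pair_def unskip_def)
    then have "g p = Suc p" "p + 1 < j" using \<open>p < j\<close> by (auto simp: skip_def split: if_splits)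
    then show False using assms p by auto
  qed
qed

lemma first_pair_least: "1 \<le> p \<Longrightarrow> p < first_pair f \<Longrightarrow> f p \<noteq> Suc p"
  unfolding first_pair_def using not_less_Least by blast

text \<open>By \<open>insert_exchange\<close> the insertions that build a matching can be reordered so that the pair at
the first place is inserted last. This singles out one history of insertions.\<close>

lemma noncrossing_remove_first_pair:
  assumes "noncrossing (Suc m) f"
  shows "1 \<le> first_pair f \<and> first_pair f \<le> m + 1 \<and> noncrossing m (remove_pair (first_pair f) f) \<and> f = insert_pair (first_pair f) (remove_pair (first_pair f) f)"
  using assms
proof (induction m arbitrary: f)
  case 0
  from 0 obtain g j where f: "f = insert_pair j g" "noncrossing 0 g" "1 \<le> j" "j \<le> 1"
    by (cases rule: noncrossing.cases) auto
  have "first_pair f = j" unfolding f by (rule first_pair_insert) (use f in auto)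
  then show ?case using f by auto
next
  case (Suc m)
  from Suc.prems obtain g j where f: "f = insert_pair j g" "noncrossing (Suc m) g" "1 \<le> j" "j \<le> m + 2"
    by (cases rule: noncrossing.cases) auto
  show ?case
  proof (cases "j \<le> first_pair g + 1")
    case True
    have "first_pair f = j" unfolding f by (rule first_pair_insert) (use f True first_pair_least in auto)
    then show ?thesis using f by auto
  next
    case False
    define i where "i = first_pair g"
    define h where "h = remove_pair i g"
    have g: "1 \<le> i" "i \<le> m + 1" "noncrossing m h" "g = insert_pair i h"
      using Suc.IH[OF f(2)] by (auto simp: i_def h_def)
    define k where "k = j - 2"
    have k: "j = k + 2" "i \<le> k" using False by (auto simp: k_def i_def)
    have fe: "f = insert_pair i (insert_pair k h)" unfolding f(1) g(4) k(1) using insert_exchange[OF k(2)] by simp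
    have "first_pair f = i" unfolding fe
    proof (rule first_pair_insert[OF g(1)])
      fix p assume p: "1 \<le> p" "p + 1 < i"
      then have "g p \<noteq> Suc p" using first_pair_least[of p g] i_def by auto
      then have "h p \<noteq> Suc p" using p unfolding g(4) by (auto simp: insert_pair_def skip_def unskip_def)
      then show "insert_pair k h p \<noteq> Suc p" using p k by (auto simp: insert_pair_def skip_def unskip_def)
    qed
    moreover have "noncrossing (Suc m) (insert_pair k h)"
      using g k f by (intro noncrossing_insert) auto
    moreover have "remove_pair i f = insert_pair k h" using fe by simp
    ultimately show ?thesis using g fe by auto
  qed
qed

lemma noncrossing_id_matching: "noncrossing n (id_matching n)"
proof (induction n)
  case 0
  have "id_matching 0 = (\<lambda>p. p)" by (auto simp: id_matching_def)
  then show ?case using noncrossing_0 by simp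
next
  case (Suc n)
  have "id_matching (Suc n) = insert_pair (n + 1) (id_matching n)"
    by (rule ext) (auto simp: id_matching_def insert_pair_def skip_def unskip_def)
  then show ?case using noncrossing_insert[OF Suc, of "n + 1"] by simp
qed

lemma id_matching_Suc: "id_matching (Suc n) = insert_pair (Suc n) (id_matching n)"
  by (rule ext) (auto simp: id_matching_def insert_pair_def skip_def unskip_def)

text \<open>Let \<open>r\<close> be the first point whose partner precedes it. A partner other than \<open>r - 1\<close> would enclose
\<open>r - 1\<close>, whose own partner lies to the right, so the two threads would cross. Hence \<open>r - 1\<close> and \<open>r\<close> form a pair of neighbours.
The partners of the \<open>r - 1\<close> points before \<open>r\<close> are among the points from \<open>r\<close> on, so \<open>r - 1\<close> is at most half the
number of points.\<close>

lemma noncrossingI: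
  assumes "matching n f"
    "\<And>p q. 1 \<le> p \<Longrightarrow> p < q \<Longrightarrow> q < f p \<Longrightarrow> f q < f p \<and> p < f q"
  shows "noncrossing n f"
  using assms
proof (induction n arbitrary: f)
  case 0
  then have "f = (\<lambda>p. p)" by (auto simp: matching_def)
  then show ?case using noncrossing_0 by simp
next
  case (Suc n)
  note M = Suc.prems(1) and X = Suc.prems(2)
  have ff: "f (f p) = p" for p using M by (simp add: matching_def)
  have fne: "f p \<noteq> p" if "p \<in> {1..2*Suc n}" for p using M that by (simp add: matching_def)
  have fr: "f p \<in> {1..2*Suc n}" if "p \<in> {1..2*Suc n}" for p using matching_range[OF M that] .
  \<comment> \<open>The points at which a thread ends when the numbers are read in increasing order.\<close>
  define P where "P q \<longleftrightarrow> 1 \<le> q \<and> f q < q" for q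
  have "P (f 1) \<or> P 1" unfolding P_def using ff[of 1] fne[of 1] fr[of 1] by auto
  then have ex: "\<exists>q. P q" by blast
  define r where "r = (LEAST q. P q)"
  have r: "1 \<le> r" "f r < r" using LeastI_ex[OF ex] by (auto simp: r_def P_def)
  have rin: "r \<in> {1..2*Suc n}"
  proof (rule ccontr)
    assume "r \<notin> {1..2*Suc n}"
    then have "f r = r" using M unfolding matching_def by blast
    then show False using r by simp
  qed
  have least: "f q > q" if "1 \<le> q" "q < r" for q
  proof -
    have "\<not> P q" using that not_less_Least r_def by blast
    moreover have "q \<in> {1..2*Suc n}"
      using rin that by auto
    ultimately show ?thesis using fne[of q] that by (auto simp: P_def)
  qed
  define j where "j = r - 1"
  have fr1: "1 \<le> f r" using fr[OF rin] by simp
  then have j: "1 \<le> j" "r = Suc j" using r by (auto simp: j_def)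
  have "f r = j"
  proof (rule ccontr)
    assume "f r \<noteq> j"
    then have "f r < j" using r j by auto
    moreover have "j < f (f r)" using ff j by simp
    ultimately have "f j < f (f r)" using X[of "f r" j] fr1 by auto
    then have "f j < r" using ff by simp
    moreover have "f j > j" using least[of j] j by simp
    ultimately show False using j by simp
  qed
  then have fj: "f (Suc j) = j" "f j = Suc j" using j ff[of r] by auto
  have jn: "j \<le> n + 1"
  proof -
    have "f q \<in> {j<..2*Suc n}" if "q \<in> {1..j}" for q
    proof -
      have q: "q \<in> {1..2*Suc n}" using that rin j by auto
      have "f q \<ge> r"
      proof (rule ccontr)
        assume "\<not> f q \<ge> r"
        then have "f (f q) > f q" using least[of "f q"] fr[OF q] by auto
        then show False using least[of q] that j ff by auto
      qed
      then show ?thesis using j fr[OF q] by auto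
    qed
    then have "f ` {1..j} \<subseteq> {j<..2*Suc n}" by auto
    then have "card (f ` {1..j}) \<le> 2*Suc n - j" by (metis card_greaterThanAtMost card_mono finite_greaterThanAtMost)
    moreover have "inj_on f {1..j}" by (metis inj_onI ff)
    ultimately have "j \<le> 2*Suc n - j" by (simp add: card_image)
    then show ?thesis by simp
  qed
  define g where "g = remove_pair j f"
  have nej: "f (skip j q) \<noteq> j" "f (skip j q) \<noteq> Suc j" for q
    using fj ff skip_simps by metis+
  have fg: "f (skip j q) = skip j (g q)" for q
    by (rule skip_cases[of "f (skip j q)" j]) (use nej in \<open>auto simp: g_def remove_pair_def\<close>)
  have f: "f = insert_pair j g" by (rule insert_eqI) (use fj fg in auto)
  have mono: "skip j p < skip j q \<longleftrightarrow> p < q" for p q by (auto simp: skip_def)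
  have "noncrossing n g"
  proof (rule Suc.IH)
    show "matching n g" unfolding matching_def
    proof (intro conjI allI ballI impI)
      fix p show "g (g p) = p" using ff[of "skip j p"] fg by simp
    next
      fix p assume "p \<in> {1..2*n}"
      then have "skip j p \<in> {1..2*Suc n}" by (auto simp: skip_def)
      then show "g p \<noteq> p" using fne fg by metis
    next
      fix p assume "p \<notin> {1..2*n}"
      then have "skip j p \<notin> {1..2*Suc n}" using j jn by (auto simp: skip_def)
      then have "f (skip j p) = skip j p" using M unfolding matching_def by blast
      then show "g p = p" using fg by simp
    qed
    fix p q assume "1 \<le> p" "p < q" "q < g p"
    then show "g q < g p \<and> p < g q"
      using X[of "skip j p" "skip j q"] fg mono by (auto simp: skip_def)
  qed
  then show ?case unfolding f using j jn by (intro noncrossing_insert) auto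
qed


lemma index_cases:
  fixes i j :: nat
  obtains "i + 2 \<le> j" | "Suc i = j" | "i = j" | "i = Suc j" | k where "i = k + 2" "j \<le> k"
proof -
  have "i + 2 \<le> j \<or> Suc i = j \<or> i = j \<or> i = Suc j \<or> (i = (i - 2) + 2 \<and> j \<le> i - 2)"
    by linarith
  then show thesis using that by blast
qed

lemma noncrossing_act: "noncrossing m f \<Longrightarrow> 1 \<le> i \<Longrightarrow> i < m \<Longrightarrow> noncrossing m (act i f)"
proof (induction arbitrary: i rule: noncrossing.induct)
  case (noncrossing_insert m g j)
  have M: "matching m g" "\<And>p. g (g p) = p" using noncrossing_matching[OF noncrossing_insert(1)] by (auto simp: matching_def)
  consider "i + 2 \<le> j" | "Suc i = j" | "i = j" | "i = Suc j" | k where "i = k + 2" "j \<le> k"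
    by (rule index_cases)
  then show ?case
  proof cases
    case 1
    then have "act i (insert_pair j g) = insert_pair j (act i g)"
      using act_insert_shift[OF M(2), of j i] by (simp add: skip_def)
    then show ?thesis using 1 noncrossing_insert by (auto intro!: noncrossing.noncrossing_insert)
  next
    case 2
    then have "act i (insert_pair j g) = insert_pair i g" using act_insert_pred[OF M(1), of i] noncrossing_insert by simp
    then show ?thesis using noncrossing_insert 2 by (auto intro!: noncrossing.noncrossing_insert)
  next
    case 3
    then show ?thesis using noncrossing_insert by (auto intro!: noncrossing.noncrossing_insert simp: act_insert_same)
  next
    case 4
    then have "act i (insert_pair j g) = insert_pair i g" using act_insert_Suc[OF M(1), of j] noncrossing_insert by simp
    then show ?thesis using noncrossing_insert 4 by (auto intro!: noncrossing.noncrossing_insert)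
  next
    case (5 k)
    then have "act i (insert_pair j g) = insert_pair j (act k g)"
      using act_insert_shift[OF M(2), of j k] by (simp add: skip_def)
    then show ?thesis using 5 noncrossing_insert by (auto intro!: noncrossing.noncrossing_insert)
  qed
qed simp


section \<open>Normal forms in the Kauffman monoid\<close>

text \<open>Terms are compared through lists of generators: the Kauffman relations then become rewrite rules for
sublists, and brackets disappear.\<close>

definition product :: "kterm list \<Rightarrow> kterm" where
  "product gs = foldl Comp One gs"

definition word :: "nat \<Rightarrow> nat list \<Rightarrow> kterm list" where
  "word k w = replicate k Circ @ map Diap w"

definition list_eq :: "nat \<Rightarrow> kterm list \<Rightarrow> kterm list \<Rightarrow> bool" where
  "list_eq n xs ys \<longleftrightarrow> kauffman_eq n (product xs) (product ys)"

definition gens :: "nat \<Rightarrow> kterm set" where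
  "gens n = insert Circ (Diap ` {1..n-1})"

declare kauffman_eq.trans [trans]

lemma gens_kterms: "g \<in> gens n \<Longrightarrow> g \<in> kterms n"
  by (auto simp: gens_def kterms_def)

lemma kterms_simps [simp]:
  "Comp t u \<in> kterms n \<longleftrightarrow> t \<in> kterms n \<and> u \<in> kterms n" "One \<in> kterms n" "Circ \<in> kterms n"
  "Diap i \<in> kterms n \<longleftrightarrow> i \<in> {1..n-1}"
  by (auto simp: kterms_def)

lemma kauffman_eq_kterms: "kauffman_eq n t u \<Longrightarrow> t \<in> kterms n \<and> u \<in> kterms n"
  by (induction rule: kauffman_eq.induct) auto

lemma product_simps [simp]: "product [] = One" "product (xs @ [x]) = Comp (product xs) x"
  by (auto simp: product_def)

lemma product_kterms: "set xs \<subseteq> gens n \<Longrightarrow> product xs \<in> kterms n"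
  by (induction xs rule: rev_induct) (auto simp: gens_kterms)

lemma product_append:
  assumes "set xs \<subseteq> gens n" "set ys \<subseteq> gens n"
  shows "kauffman_eq n (product (xs @ ys)) (Comp (product xs) (product ys))"
  using assms(2)
proof (induction ys rule: rev_induct)
  case Nil
  show ?case using kauffman_eq.right_unit kauffman_eq.sym product_kterms assms by simp
next
  case (snoc y ys)
  have k: "product xs \<in> kterms n" "product ys \<in> kterms n" "y \<in> kterms n"
    using product_kterms assms snoc gens_kterms by auto
  have "kauffman_eq n (Comp (product (xs @ ys)) y) (Comp (Comp (product xs) (product ys)) y)"
    using snoc k by (auto intro: kauffman_eq.cong kauffman_eq.refl)
  also have "kauffman_eq n \<dots> (Comp (product xs) (Comp (product ys) y))"
    using k by (auto intro: kauffman_eq.assoc)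
  finally show ?case by (simp flip: append_assoc)
qed

lemma list_eq_refl: "set xs \<subseteq> gens n \<Longrightarrow> list_eq n xs xs"
  by (simp add: list_eq_def kauffman_eq.refl product_kterms)

lemma list_eq_sym: "list_eq n xs ys \<Longrightarrow> list_eq n ys xs"
  by (simp add: list_eq_def kauffman_eq.sym)

lemma list_eq_trans [trans]: "list_eq n xs ys \<Longrightarrow> list_eq n ys zs \<Longrightarrow> list_eq n xs zs"
  unfolding list_eq_def using kauffman_eq.trans by blast

lemma list_eq_append:
  assumes "list_eq n xs xs'" "list_eq n ys ys'" "set xs \<subseteq> gens n" "set xs' \<subseteq> gens n" "set ys \<subseteq> gens n" "set ys' \<subseteq> gens n"
  shows "list_eq n (xs @ ys) (xs' @ ys')"
proof -
  have "kauffman_eq n (product (xs @ ys)) (Comp (product xs) (product ys))" using product_append assms by blast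
  also have "kauffman_eq n \<dots> (Comp (product xs') (product ys'))"
    using assms kauffman_eq.cong unfolding list_eq_def by blast
  also have "kauffman_eq n \<dots> (product (xs' @ ys'))"
    using product_append assms kauffman_eq.sym by blast
  finally show ?thesis by (simp add: list_eq_def)
qed

text \<open>By (hc1) circles can be collected in front of a word.\<close>

lemma Circ_central:
  assumes "set xs \<subseteq> gens n"
  shows "list_eq n (xs @ [Circ]) (Circ # xs)"
  using assms
proof (induction xs rule: rev_induct)
  case Nil
  then show ?case by (auto intro: list_eq_refl simp: gens_def)
next
  case (snoc x xs)
  have x: "x \<in> gens n" and xs: "set xs \<subseteq> gens n" using snoc by auto
  have C: "Circ \<in> gens n" by (simp add: gens_def)
  have sw: "list_eq n [x, Circ] [Circ, x]"
  proof (cases "x = Circ")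
    case True then show ?thesis using list_eq_refl[of "[Circ, Circ]" n] C by simp
  next
    case False
    then obtain i where i: "x = Diap i" "i \<in> {1..n-1}" using x by (auto simp: gens_def)
    have "kauffman_eq n (Comp (Comp One x) Circ) (Comp One (Comp x Circ))"
      using gens_kterms x by (auto intro: kauffman_eq.assoc)
    also have "kauffman_eq n \<dots> (Comp One (Comp Circ x))"
      unfolding i(1) using i by (auto intro!: kauffman_eq.cong kauffman_eq.refl kauffman_eq.hc1)
    also have "kauffman_eq n \<dots> (Comp (Comp One Circ) x)"
      using gens_kterms x by (auto intro!: kauffman_eq.sym[OF kauffman_eq.assoc])
    finally show ?thesis by (simp add: list_eq_def product_def)
  qed
  have "list_eq n (xs @ [x, Circ]) (xs @ [Circ, x])"
    by (rule list_eq_append[OF list_eq_refl sw]) (use x xs C in auto)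
  also have "list_eq n ((xs @ [Circ]) @ [x]) ((Circ # xs) @ [x])"
    by (rule list_eq_append[OF _ list_eq_refl]) (use snoc x xs C in auto)
  then have "list_eq n (xs @ [Circ, x]) ((Circ # xs) @ [x])" by simp
  finally show ?case by simp
qed

lemma Circs_central:
  assumes "set xs \<subseteq> gens n"
  shows "list_eq n (xs @ replicate k Circ) (replicate k Circ @ xs)"
proof (induction k)
  case 0 show ?case using list_eq_refl assms by simp
next
  case (Suc k)
  have C: "Circ \<in> gens n" by (simp add: gens_def)
  have "list_eq n ((xs @ [Circ]) @ replicate k Circ) ((Circ # xs) @ replicate k Circ)"
    by (rule list_eq_append[OF Circ_central list_eq_refl]) (use assms C in auto)
  also have "list_eq n ([Circ] @ (xs @ replicate k Circ)) ([Circ] @ (replicate k Circ @ xs))"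
    by (rule list_eq_append[OF list_eq_refl Suc]) (use assms C in auto)
  then have "list_eq n ((Circ # xs) @ replicate k Circ) ([Circ] @ (replicate k Circ @ xs))" by simp
  finally show ?case by simp
qed

definition word_eq :: "nat \<Rightarrow> nat \<Rightarrow> nat list \<Rightarrow> nat \<Rightarrow> nat list \<Rightarrow> bool" where
  "word_eq n k w l v \<longleftrightarrow> list_eq n (word k w) (word l v)"

definition words :: "nat \<Rightarrow> nat list set" where
  "words n = lists {1..n-1}"

lemma words_simps [simp]: "[] \<in> words n" "x # xs \<in> words n \<longleftrightarrow> 1 \<le> x \<and> x < n \<and> xs \<in> words n"
  "xs @ ys \<in> words n \<longleftrightarrow> xs \<in> words n \<and> ys \<in> words n"
  by (auto simp: words_def)

lemma word_gens: "w \<in> words n \<Longrightarrow> set (word k w) \<subseteq> gens n"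
  by (auto simp: word_def gens_def words_def)

lemma word_eq_refl: "w \<in> words n \<Longrightarrow> word_eq n k w k w"
  by (simp add: word_eq_def list_eq_refl word_gens)

lemma word_eq_sym: "word_eq n k w l v \<Longrightarrow> word_eq n l v k w"
  by (simp add: word_eq_def list_eq_sym)

lemma word_eq_trans [trans]: "word_eq n k w l v \<Longrightarrow> word_eq n l v r u \<Longrightarrow> word_eq n k w r u"
  unfolding word_eq_def by (rule list_eq_trans)

text \<open>Circles produced while rewriting a part of a word move to its front.\<close>

lemma word_eq_cong:
  assumes "word_eq n k w l v" "a \<in> words n" "b \<in> words n" "w \<in> words n" "v \<in> words n"
  shows "word_eq n (r + k) (a @ w @ b) (r + l) (a @ v @ b)"
proof -
  have move: "list_eq n (word (r + k) (a @ w @ b)) (word r a @ word k w @ word 0 b)" if "w \<in> words n" for k w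
  proof -
    have g: "set (map Diap a) \<subseteq> gens n" "set (map Diap (w @ b)) \<subseteq> gens n"
       "set (replicate j Circ) \<subseteq> gens n" for j
      using that assms by (auto simp: gens_def words_def)
    have "list_eq n (map Diap a @ replicate k Circ) (replicate k Circ @ map Diap a)"
      using Circs_central g by blast
    then have "list_eq n ((replicate r Circ @ (map Diap a @ replicate k Circ)) @ map Diap (w @ b))
        ((replicate r Circ @ (replicate k Circ @ map Diap a)) @ map Diap (w @ b))"
      using g
      by - (rule list_eq_append[OF list_eq_append[OF list_eq_refl _] list_eq_refl], auto)
    then show ?thesis by (simp add: word_def replicate_add list_eq_sym)
  qed
  have g: "set (word r a) \<subseteq> gens n" "set (word k w) \<subseteq> gens n" "set (word l v) \<subseteq> gens n" "set (word 0 b) \<subseteq> gens n"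
    using word_gens assms by auto
  have "list_eq n (word r a @ word k w @ word 0 b) (word r a @ word l v @ word 0 b)"
    using assms(1) g unfolding word_eq_def
    by - (rule list_eq_append[OF list_eq_refl list_eq_append[OF _ list_eq_refl]], auto)
  then show ?thesis unfolding word_eq_def
    using move[OF assms(4)] move[OF assms(5)] list_eq_trans list_eq_sym by blast
qed

lemma word_eq_gen:
  shows word_eq_comm: "i \<in> {1..n-1} \<Longrightarrow> j \<in> {1..n-1} \<Longrightarrow> i + 2 \<le> j \<or> j + 2 \<le> i \<Longrightarrow> word_eq n 0 [i, j] 0 [j, i]"
    and word_eq_braid: "i \<in> {1..n-1} \<Longrightarrow> j \<in> {1..n-1} \<Longrightarrow> j = i + 1 \<or> i = j + 1 \<Longrightarrow> word_eq n 0 [i, j, i] 0 [i]"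
    and word_eq_sq: "i \<in> {1..n-1} \<Longrightarrow> word_eq n 0 [i, i] 1 [i]"
proof -
  have two: "list_eq n [x, y] zs"
    if "kauffman_eq n (Comp x y) t" "kauffman_eq n t (product zs)" for x y t zs
  proof -
    have k: "x \<in> kterms n" "y \<in> kterms n" using kauffman_eq_kterms that by fastforce+
    have "kauffman_eq n (Comp (Comp One x) y) (Comp x y)"
      using k by (intro kauffman_eq.cong kauffman_eq.left_unit kauffman_eq.refl)
    then have "kauffman_eq n (Comp (Comp One x) y) (product zs)"
      using kauffman_eq.trans[OF _ kauffman_eq.trans[OF that]] by blast
    then show ?thesis by (simp add: list_eq_def product_def)
  qed
  have one: "kauffman_eq n x (Comp One x)" if "x \<in> kterms n" for x
    using that kauffman_eq.left_unit kauffman_eq.sym by blast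
  have onec: "kauffman_eq n (Comp x y) (Comp (Comp One x) y)" if "x \<in> kterms n" "y \<in> kterms n" for x y
    using that one by (intro kauffman_eq.cong kauffman_eq.refl) auto
  show "word_eq n 0 [i, j] 0 [j, i]" if "i \<in> {1..n-1}" "j \<in> {1..n-1}" "i + 2 \<le> j \<or> j + 2 \<le> i"
  proof -
    have "kauffman_eq n (Comp (Diap i) (Diap j)) (Comp (Diap j) (Diap i))"
      using that by (intro kauffman_eq.h1) auto
    then show ?thesis unfolding word_eq_def word_def
      using that onec by (auto intro!: two simp: product_def)
  qed
  show "word_eq n 0 [i, i] 1 [i]" if "i \<in> {1..n-1}"
    unfolding word_eq_def word_def
    using that onec kauffman_eq.hc2[OF that] by (auto intro!: two simp: product_def)
  show "word_eq n 0 [i, j, i] 0 [i]" if "i \<in> {1..n-1}" "j \<in> {1..n-1}" "j = i + 1 \<or> i = j + 1"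
  proof -
    have "kauffman_eq n (Comp (Comp (Comp One (Diap i)) (Diap j)) (Diap i)) (Comp (Comp (Diap i) (Diap j)) (Diap i))"
      using that by (intro kauffman_eq.cong kauffman_eq.left_unit kauffman_eq.refl) auto
    also have "kauffman_eq n \<dots> (Diap i)" using kauffman_eq.h2 that by blast
    also have "kauffman_eq n \<dots> (Comp One (Diap i))" using that one by simp
    finally show ?thesis by (simp add: word_eq_def word_def list_eq_def product_def)
  qed
qed

lemma word_eq_comm_word:
  assumes "w \<in> words n" "y \<in> {1..n-1}" "\<And>x. x \<in> set w \<Longrightarrow> x + 2 \<le> y \<or> y + 2 \<le> x"
  shows "word_eq n 0 (w @ [y]) 0 (y # w)"
  using assms
proof (induction w)
  case Nil then show ?case by (auto intro: word_eq_refl)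
next
  case (Cons x w)
  have "word_eq n (0 + 0) ([x] @ (w @ [y]) @ []) (0 + 0) ([x] @ (y # w) @ [])"
    using Cons by (intro word_eq_cong) auto
  also have "word_eq n (0 + 0) ([] @ [x, y] @ w) (0 + 0) ([] @ [y, x] @ w)"
    using Cons by (intro word_eq_cong word_eq_comm) auto
  then have "word_eq n (0 + 0) ([x] @ (y # w) @ []) 0 (y # x # w)" by simp
  finally show ?case by simp
qed

fun descend :: "nat \<Rightarrow> nat \<Rightarrow> nat list" where
  "descend 0 j = []"
| "descend (Suc m) j = (if Suc m < j then [] else Suc m # descend m j)"

lemma set_descend: "1 \<le> j \<Longrightarrow> set (descend m j) = {j..m}"
  by (induction m) (auto simp: atLeastAtMostSuc_conv)

lemma descend_words: "1 \<le> j \<Longrightarrow> m < n \<Longrightarrow> descend m j \<in> words n"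
  by (auto simp: words_def set_descend in_lists_conv_set)

lemma descend_Nil [simp]: "m < j \<Longrightarrow> descend m j = []"
  by (cases m) auto

lemma descend_split: "1 \<le> j \<Longrightarrow> j \<le> i \<Longrightarrow> i \<le> Suc m \<Longrightarrow> descend m j = descend m i @ descend (i - 1) j"
proof (induction m)
  case (Suc m)
  then show ?case by (cases "i = Suc (Suc m)") auto
qed (cases i; auto)

lemma descend_snoc: "1 \<le> j \<Longrightarrow> j \<le> m \<Longrightarrow> descend m j = descend m (Suc j) @ [j]"
  using descend_split[of j "Suc j" m] by (cases j) auto

text \<open>The counterpart of \<open>insert_exchange\<close> for words. If \<open>j = m\<close> this is one use of (h2); each larger \<open>m\<close> only
moves the new first letter of the second run to the left, past letters that are smaller by at least two.\<close>

lemma descend_exchange: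
  assumes "1 \<le> i" "i \<le> j" "j \<le> m" "Suc m < n"
  shows "word_eq n 0 (descend m i @ descend (Suc m) (j + 2)) 0 (descend m j @ descend (Suc m) i)"
  using assms(3,4)
proof (induction m rule: dec_induct)
  case base
  obtain k where k: "j = Suc k" using assms by (cases j) auto
  have "word_eq n (0 + 0) ([] @ [j, Suc j, j] @ descend k i) (0 + 0) ([] @ [j] @ descend k i)"
    using assms base k by (intro word_eq_cong word_eq_braid descend_words) (auto intro: descend_words)
  then show ?case using k assms word_eq_sym by simp
next
  case (step m)
  have w: "descend r i \<in> words n" "descend r j \<in> words n" "descend r (j + 2) \<in> words n" if "r < n" for r
    using descend_words that assms by auto
  have comm: "word_eq n 0 (Suc m # descend m a @ Suc (Suc m) # v) 0 (Suc m # Suc (Suc m) # descend m a @ v)"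
    if "1 \<le> a" "v \<in> words n" "descend (Suc m) a = Suc m # descend m a" for a v
  proof -
    have r: "descend (Suc m) a = Suc m # descend m a" using that by simp
    have "word_eq n 0 (descend m a @ [Suc (Suc m)]) 0 (Suc (Suc m) # descend m a)"
      using step that by (intro word_eq_comm_word descend_words) (auto simp: set_descend)
    then have "word_eq n (0 + 0) ([Suc m] @ (descend m a @ [Suc (Suc m)]) @ v) (0 + 0) ([Suc m] @ (Suc (Suc m) # descend m a) @ v)"
      using step that descend_words[of a m n] by (intro word_eq_cong) auto
    then show ?thesis by simp
  qed
  have IH: "word_eq n 0 (descend m i @ descend (Suc m) (j + 2)) 0 (descend m j @ descend (Suc m) i)"
    using step by simp
  have l: "descend (Suc m) i @ descend (Suc (Suc m)) (j + 2) = Suc m # descend m i @ Suc (Suc m) # descend (Suc m) (j + 2)"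
    using step assms by simp
  have "word_eq n 0 (Suc m # descend m i @ Suc (Suc m) # descend (Suc m) (j + 2)) 0 (Suc m # Suc (Suc m) # descend m i @ descend (Suc m) (j + 2))"
    using step assms w by (intro comm) auto
  also have "word_eq n 0 (Suc m # Suc (Suc m) # descend m i @ descend (Suc m) (j + 2)) 0 (Suc m # Suc (Suc m) # descend m j @ descend (Suc m) i)"
    using word_eq_cong[OF IH, of "[Suc m, Suc (Suc m)]" "[]" 0] step w[of m] w[of "Suc m"] by simp
  also have "word_eq n 0 (Suc m # Suc (Suc m) # descend m j @ descend (Suc m) i) 0 (Suc m # descend m j @ Suc (Suc m) # descend (Suc m) i)"
    using step assms w by (intro word_eq_sym[OF comm]) auto
  also have "Suc m # descend m j @ Suc (Suc m) # descend (Suc m) i = descend (Suc m) j @ descend (Suc (Suc m)) i"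
    using step assms by simp
  finally show ?case by (simp only: l)
qed

text \<open>A letter that is far from the place \<open>j\<close> passes through the descending run and loses two, as does the
point it acts on when the pair inserted at \<open>j\<close> is removed (\<open>act_insert_shift\<close>). Both sides are equal to the run with
the letter \<open>i - 1\<close> left out.\<close>

lemma descend_far:
  assumes "1 \<le> j" "j + 2 \<le> i" "i \<le> m" "m < n"
  shows "word_eq n 0 (descend m j @ [i]) 0 ((i - 2) # descend m j)"
proof -
  define k where "k = i - 2"
  have k: "i = Suc (Suc k)" "1 \<le> k" "j \<le> k" using assms by (auto simp: k_def)
  obtain l where l: "k = Suc l" using k by (cases k) auto
  define A where "A = descend m (Suc i)"
  define B where "B = descend k j"
  define B' where "B' = descend l j"
  have w: "A \<in> words n" "B \<in> words n" "B' \<in> words n" 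
    using assms k l by (auto simp: A_def B_def B'_def intro!: descend_words)
  have B: "B = k # B'" using k l by (simp add: B_def B'_def)
  have e: "descend m j = A @ [i, Suc k] @ B"
  proof -
    have "descend m j = descend m (Suc i) @ descend i j" using descend_split[of j "Suc i" m] assms by simp
    moreover have "descend i j = i # Suc k # B" using k by (simp add: B_def)
    ultimately show ?thesis by (simp add: A_def)
  qed
  have "word_eq n 0 (B @ [i]) 0 (i # B)"
    using assms k w by (intro word_eq_comm_word) (auto simp: B_def set_descend)
  then have "word_eq n (0 + 0) ((A @ [i, Suc k]) @ (B @ [i]) @ []) (0 + 0) ((A @ [i, Suc k]) @ (i # B) @ [])"
    using w assms k by (intro word_eq_cong) auto
  then have 1: "word_eq n 0 (descend m j @ [i]) 0 (A @ [i, Suc k, i] @ B)" by (simp add: e)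
  have 2: "word_eq n (0 + 0) (A @ [i, Suc k, i] @ B) (0 + 0) (A @ [i] @ B)"
    using w assms k by (intro word_eq_cong word_eq_braid) auto
  have "word_eq n 0 ((A @ [i]) @ [k]) 0 (k # (A @ [i]))"
    using assms k w by (intro word_eq_comm_word) (auto simp: A_def set_descend)
  then have "word_eq n (0 + 0) ([] @ (k # (A @ [i])) @ (Suc k # B)) (0 + 0) ([] @ ((A @ [i]) @ [k]) @ (Suc k # B))"
    using w assms k by (intro word_eq_cong[OF word_eq_sym]) auto
  then have 3: "word_eq n 0 (k # descend m j) 0 ((A @ [i]) @ [k, Suc k, k] @ B')" by (simp add: e B)
  have 4: "word_eq n (0 + 0) ((A @ [i]) @ [k, Suc k, k] @ B') (0 + 0) ((A @ [i]) @ [k] @ B')"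
    using w assms k by (intro word_eq_cong word_eq_braid) auto
  have "word_eq n 0 (k # descend m j) 0 (A @ [i] @ B)" using word_eq_trans[OF 3] 4 B by simp
  moreover have "word_eq n 0 (descend m j @ [i]) 0 (A @ [i] @ B)" using word_eq_trans[OF 1] 2 by simp
  ultimately have "word_eq n 0 (descend m j @ [i]) 0 (k # descend m j)" by (metis word_eq_trans word_eq_sym)
  then show ?thesis by (simp add: k_def)
qed

text \<open>Adding a vertical thread on the right to a diagram inserts a pair in the middle, at \<open>m + 1\<close>. The
descending run \<open>m, m - 1, \<dots>, j\<close> then moves this pair to the left until it is at \<open>j\<close>
(\<open>act_insert_pred\<close>). The words obtained need not be reduced; what matters is that they depend only on the matching.\<close>

fun normal_form :: "nat \<Rightarrow> (nat \<Rightarrow> nat) \<Rightarrow> nat list" where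
  "normal_form 0 f = []"
| "normal_form (Suc m) f = normal_form m (remove_pair (first_pair f) f) @ descend m (first_pair f)"

declare normal_form.simps(2) [simp del]

lemma nf_words: "noncrossing m f \<Longrightarrow> m \<le> n \<Longrightarrow> normal_form m f \<in> words n"
proof (induction m arbitrary: f)
  case (Suc m)
  then show ?case using noncrossing_remove_first_pair[OF Suc.prems(1)] by (simp add: normal_form.simps(2) descend_words)
qed simp

lemma nf_insert_first_pair: "1 \<le> j \<Longrightarrow> (\<And>p. 1 \<le> p \<Longrightarrow> p + 1 < j \<Longrightarrow> g p \<noteq> Suc p) \<Longrightarrow> normal_form (Suc m) (insert_pair j g) = normal_form m g @ descend m j"
  by (simp add: normal_form.simps(2) first_pair_insert)

text \<open>If the first pair of \<open>g\<close> stays the first pair after the insertion, the two insertions are exchanged, so that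
the one at the first place comes last: on matchings by \<open>insert_exchange\<close>, on words by \<open>descend_exchange\<close>.\<close>

lemma nf_insert:
  assumes "noncrossing m g" "1 \<le> j" "j \<le> m + 1" "m < n"
  shows "word_eq n 0 (normal_form m g @ descend m j) 0 (normal_form (Suc m) (insert_pair j g))"
  using assms
proof (induction m arbitrary: g j)
  case 0
  then have "normal_form (Suc 0) (insert_pair j g) = normal_form 0 g @ descend 0 j" by (intro nf_insert_first_pair) auto
  then show ?case by (simp add: word_eq_refl)
next
  case (Suc m)
  have W: "normal_form (Suc m) g @ descend (Suc m) j \<in> words n" using Suc.prems nf_words descend_words by auto
  show ?case
  proof (cases "j \<le> first_pair g + 1")
    case True
    have "normal_form (Suc (Suc m)) (insert_pair j g) = normal_form (Suc m) g @ descend (Suc m) j"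
      by (rule nf_insert_first_pair) (use Suc.prems True first_pair_least[of _ g] in auto)
    then show ?thesis using W word_eq_refl by metis
  next
    case False
    define i where "i = first_pair g"
    define h where "h = remove_pair i g"
    have g: "1 \<le> i" "i \<le> m + 1" "noncrossing m h" "g = insert_pair i h"
      using noncrossing_remove_first_pair[OF Suc.prems(1)] by (auto simp: i_def h_def)
    define k where "k = j - 2"
    have k: "j = k + 2" "i \<le> k" "k \<le> m" using False Suc.prems by (auto simp: k_def i_def)
    have ng: "normal_form (Suc m) g = normal_form m h @ descend m i" by (simp add: i_def h_def normal_form.simps(2))
    have hw: "normal_form m h \<in> words n" using nf_words g(3) Suc.prems by simp
    have dws: "descend r s \<in> words n" if "1 \<le> s" "r \<le> Suc m" for r s using descend_words that Suc.prems by simp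
    have "word_eq n (0 + 0) (normal_form m h @ (descend m i @ descend (Suc m) (k + 2)) @ []) (0 + 0) (normal_form m h @ (descend m k @ descend (Suc m) i) @ [])"
      using hw dws g k Suc.prems by (intro word_eq_cong descend_exchange) auto
    then have 1: "word_eq n 0 (normal_form (Suc m) g @ descend (Suc m) j) 0 (normal_form m h @ descend m k @ descend (Suc m) i)"
      using ng k by simp
    have IH: "word_eq n 0 (normal_form m h @ descend m k) 0 (normal_form (Suc m) (insert_pair k h))"
      using Suc.IH[of h k] g k Suc.prems by simp
    have NCk: "noncrossing (Suc m) (insert_pair k h)" using g k by (intro noncrossing_insert) auto
    have 2: "word_eq n (0 + 0) ([] @ (normal_form m h @ descend m k) @ descend (Suc m) i) (0 + 0) ([] @ normal_form (Suc m) (insert_pair k h) @ descend (Suc m) i)"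
      using hw dws g k Suc.prems nf_words[OF NCk, of n] by (intro word_eq_cong IH) auto
    have "normal_form (Suc (Suc m)) (insert_pair i (insert_pair k h)) = normal_form (Suc m) (insert_pair k h) @ descend (Suc m) i"
    proof (rule nf_insert_first_pair[OF g(1)])
      fix p assume p: "1 \<le> p" "p + 1 < i"
      then have "g p \<noteq> Suc p" using first_pair_least[of p g] i_def by auto
      then have "h p \<noteq> Suc p" using p unfolding g(4) by (auto simp: insert_pair_def skip_def unskip_def)
      then show "insert_pair k h p \<noteq> Suc p" using p k by (auto simp: insert_pair_def skip_def unskip_def)
    qed
    moreover have "insert_pair i (insert_pair k h) = insert_pair j g" using insert_exchange[OF k(2)] g k by simp
    ultimately show ?thesis using word_eq_trans[OF 1] 2 by simp
  qed
qed

text \<open>The number of circles that appear when $H^i$ is put on top of a diagram with matching \<open>f\<close>.\<close>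

definition loops :: "nat \<Rightarrow> (nat \<Rightarrow> nat) \<Rightarrow> nat" where
  "loops i f = (if f i = Suc i then 1 else 0)"

text \<open>The last run of the normal form inserts a pair at \<open>j\<close>. If the letter \<open>i\<close> is not close to \<open>j\<close>, it passes
through the run, and the induction hypothesis applies. If \<open>i = j\<close> then (hc2) produces a circle, if
\<open>i = j + 1\<close> then (h2) shortens the run, and if \<open>i = j - 1\<close> the run becomes longer. In the last
two cases, as in the first, the result is the normal form of an insertion by \<open>nf_insert\<close>.\<close>

lemma nf_act:
  assumes "noncrossing m f" "1 \<le> i" "i < m" "m \<le> n"
  shows "word_eq n 0 (normal_form m f @ [i]) (loops i f) (normal_form m (act i f))"
  using assms
proof (induction m arbitrary: f i)
  case (Suc m)
  define j where "j = first_pair f"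
  define g where "g = remove_pair j f"
  have f: "1 \<le> j" "j \<le> m + 1" "noncrossing m g" "f = insert_pair j g"
    using noncrossing_remove_first_pair[OF Suc.prems(1)] by (auto simp: j_def g_def)
  have M: "matching m g" "\<And>p. g (g p) = p" using noncrossing_matching[OF f(3)] by (auto simp: matching_def)
  have nff: "normal_form (Suc m) f = normal_form m g @ descend m j" by (simp add: j_def g_def normal_form.simps(2))
  have gw: "normal_form m g \<in> words n" using nf_words f(3) Suc.prems by simp
  have dws: "descend r s \<in> words n" if "1 \<le> s" "r \<le> m" for r s using descend_words that Suc.prems by simp
  have shift: "word_eq n 0 (normal_form (Suc m) f @ [i]) (loops i f) (normal_form (Suc m) (act i f))"
    if k: "1 \<le> k" "k < m" "act i f = insert_pair j (act k g)" "loops i f = loops k g"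
      "word_eq n 0 (descend m j @ [i]) 0 (k # descend m j)" for k
  proof -
    have "word_eq n (0 + 0) (normal_form m g @ (descend m j @ [i]) @ []) (0 + 0) (normal_form m g @ (k # descend m j) @ [])"
      using k gw dws f Suc.prems by (intro word_eq_cong) auto
    then have 1: "word_eq n 0 (normal_form (Suc m) f @ [i]) 0 ((normal_form m g @ [k]) @ descend m j)" by (simp add: nff)
    have N: "noncrossing m (act k g)" using noncrossing_act f k by simp
    have "word_eq n 0 (normal_form m g @ [k]) (loops k g) (normal_form m (act k g))"
      using Suc.IH[of g k] k f Suc.prems by simp
    then have 2: "word_eq n (0 + 0) ([] @ (normal_form m g @ [k]) @ descend m j) (0 + loops k g) ([] @ normal_form m (act k g) @ descend m j)"
      using k gw dws f Suc.prems nf_words[OF N, of n] by (intro word_eq_cong) auto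
    have "word_eq n 0 (normal_form m (act k g) @ descend m j) 0 (normal_form (Suc m) (insert_pair j (act k g)))"
      using nf_insert[OF N, of j n] f Suc.prems by simp
    then have 3: "word_eq n (loops k g + 0) ([] @ (normal_form m (act k g) @ descend m j) @ []) (loops k g + 0) ([] @ normal_form (Suc m) (insert_pair j (act k g)) @ [])"
      using k gw dws f Suc.prems nf_words[OF N, of n] nf_words[OF noncrossing_insert[OF N], of j n] by (intro word_eq_cong) auto
    show ?thesis using word_eq_trans[OF 1] word_eq_trans[OF 2] 3 k by simp
  qed
  have fi: "f i = (if i = j then Suc j else if i = Suc j then j else skip j (g (unskip j i)))"
    by (simp add: f(4) insert_pair_def)
  consider "i + 2 \<le> j" | "Suc i = j" | "i = j" | "i = Suc j" | k where "i = k + 2" "j \<le> k"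
    by (rule index_cases)
  then show ?case
  proof cases
    case 1
    have a: "act i f = insert_pair j (act i g)" unfolding f(4)
      using act_insert_shift[OF M(2), of j i] 1 by (simp add: skip_def)
    have l: "loops i f = loops i g" using 1 unfolding loops_def fi by (auto simp: skip_def unskip_def)
    have "word_eq n 0 (descend m j @ [i]) 0 (i # descend m j)"
      using 1 Suc.prems f dws by (intro word_eq_comm_word) (auto simp: set_descend)
    then show ?thesis using shift[OF _ _ a l] 1 Suc.prems f by simp
  next
    case 2
    have a: "act i f = insert_pair i g" using act_insert_pred[OF M(1), of i] 2 Suc.prems f(4) by simp
    have l: "loops i f = 0" using 2 unfolding loops_def fi by (auto simp: skip_def)
    have "normal_form (Suc m) f @ [i] = normal_form m g @ descend m i"
      using descend_snoc[of i m] 2 f(2) Suc.prems(2,3) by (simp add: nff)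
    then show ?thesis using nf_insert[OF f(3), of i n] Suc.prems a l by simp
  next
    case 3
    have a: "act i f = f" unfolding f(4) 3 by (rule act_insert_same)
    have l: "loops i f = 1" using 3 fi by (simp add: loops_def)
    have e: "normal_form (Suc m) f = (normal_form m g @ descend m (Suc i)) @ [i]"
      using descend_snoc[of j m] 3 Suc.prems(2,3) by (simp add: nff)
    have "word_eq n (0 + 0) ((normal_form m g @ descend m (Suc i)) @ [i, i] @ []) (0 + 1) ((normal_form m g @ descend m (Suc i)) @ [i] @ [])"
      using gw dws Suc.prems by (intro word_eq_cong word_eq_sq) auto
    then show ?thesis using a l e by simp
  next
    case 4
    have a: "act i f = insert_pair i g" using act_insert_Suc[OF M(1), of j] 4 Suc.prems f by simp
    have l: "loops i f = 0" using 4 unfolding loops_def fi by auto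
    have "descend m j = descend m (Suc i) @ [i, j]"
      using descend_snoc[of j m] descend_snoc[of i m] 4 f(1) Suc.prems(2,3) by simp
    then have e: "normal_form (Suc m) f @ [i] = (normal_form m g @ descend m (Suc i)) @ [i, j, i] @ []" by (simp add: nff)
    have "word_eq n (0 + 0) ((normal_form m g @ descend m (Suc i)) @ [i, j, i] @ []) (0 + 0) ((normal_form m g @ descend m (Suc i)) @ [i] @ [])"
      using gw dws Suc.prems 4 f by (intro word_eq_cong word_eq_braid) auto
    then have "word_eq n 0 (normal_form (Suc m) f @ [i]) 0 (normal_form m g @ descend m i)"
      using e descend_snoc[of i m] Suc.prems by simp
    moreover have "word_eq n 0 (normal_form m g @ descend m i) 0 (normal_form (Suc m) (insert_pair i g))"
      using nf_insert[OF f(3), of i n] Suc.prems by simp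
    ultimately show ?thesis using word_eq_trans a l by metis
  next
    case (5 k)
    have a: "act i f = insert_pair j (act k g)" unfolding f(4)
      using act_insert_shift[OF M(2), of j k] 5 by (simp add: skip_def)
    have l: "loops i f = loops k g" using 5 unfolding loops_def fi by (auto simp: skip_def unskip_def)
    have "word_eq n 0 (descend m j @ [i]) 0 (k # descend m j)"
      using descend_far[of j i m n] 5 Suc.prems f by simp
    then show ?thesis using shift[OF _ _ a l] 5 Suc.prems f by simp
  qed
qed simp

definition act_inv :: "nat \<Rightarrow> (nat \<Rightarrow> nat) \<times> nat \<Rightarrow> (nat \<Rightarrow> nat) \<times> nat" where
  "act_inv i = (\<lambda>(f, k). (act i f, k + loops i f))"

definition eval_word :: "nat list \<Rightarrow> (nat \<Rightarrow> nat) \<times> nat \<Rightarrow> (nat \<Rightarrow> nat) \<times> nat" where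
  "eval_word w = fold act_inv w"

lemma nf_id_matching: "normal_form n (id_matching n) = []"
proof (induction n)
  case (Suc n)
  have "normal_form (Suc n) (insert_pair (Suc n) (id_matching n)) = normal_form n (id_matching n) @ descend n (Suc n)"
    by (rule nf_insert_first_pair) (auto simp: id_matching_def)
  then show ?case using Suc by (simp add: id_matching_Suc)
qed simp

lemma word_nf:
  assumes "w \<in> words n" "eval_word w (id_matching n, k) = (f, l)"
  shows "word_eq n k w l (normal_form n f) \<and> noncrossing n f"
  using assms
proof (induction w arbitrary: f l rule: rev_induct)
  case Nil
  then show ?case using nf_id_matching noncrossing_id_matching by (auto simp: eval_word_def word_eq_refl)
next
  case (snoc i w)
  obtain g r where g: "eval_word w (id_matching n, k) = (g, r)" by fastforce
  have IH: "word_eq n k w r (normal_form n g)" "noncrossing n g" using snoc g by auto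
  have fl: "f = act i g" "l = r + loops i g" using snoc.prems g by (auto simp: eval_word_def act_inv_def)
  have i: "1 \<le> i" "i < n" "w \<in> words n" using snoc by auto
  have N: "noncrossing n f" using noncrossing_act IH i fl by simp
  have "word_eq n (0 + k) ([] @ w @ [i]) (0 + r) ([] @ normal_form n g @ [i])"
    using IH i nf_words by (intro word_eq_cong) auto
  moreover have "word_eq n (r + 0) ([] @ (normal_form n g @ [i]) @ []) (r + loops i g) ([] @ normal_form n (act i g) @ [])"
    using IH i nf_words nf_act N fl by (intro word_eq_cong) auto
  ultimately have "word_eq n k (w @ [i]) l (normal_form n f)" using word_eq_trans fl by simp
  then show ?case using N by simp
qed

text \<open>Each letter moves the inserted pair one place to the left and closes no circle.\<close>

lemma eval_descend:
  assumes "matching m g" "1 \<le> j" "j \<le> m + 1"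
  shows "eval_word (descend m j) (insert_pair (Suc m) g, k) = (insert_pair j g, k)"
proof -
  have "eval_word (descend m j) (insert_pair (Suc m) g, k) = (insert_pair j g, k)" if "j \<le> m + 1" "1 \<le> j" for j
    using that
  proof (induction "m + 1 - j" arbitrary: j)
    case 0
    then show ?case by (simp add: eval_word_def)
  next
    case (Suc d)
    then have IH: "eval_word (descend m (Suc j)) (insert_pair (Suc m) g, k) = (insert_pair (Suc j) g, k)" by simp
    have "descend m j = descend m (Suc j) @ [j]" using Suc descend_snoc by simp
    moreover have "act j (insert_pair (Suc j) g) = insert_pair j g" using act_insert_pred assms Suc by simp
    moreover have "loops j (insert_pair (Suc j) g) = 0" by (auto simp: loops_def insert_pair_def skip_def)
    ultimately show ?case using IH by (simp add: eval_word_def act_inv_def)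
  qed
  then show ?thesis using assms by blast
qed

lemma matching_act:
  assumes "matching n f" "1 \<le> i" "i < 2*n"
  shows "matching n (act i f)"
proof (cases "f i = Suc i")
  case True
  have "f (Suc i) = i" using assms True unfolding matching_def by metis
  then have "act i f = f" using True by (auto simp: act_def)
  then show ?thesis using assms by simp
next
  case False
  define a b where ab: "a = f i" "b = f (Suc i)"
  have ff: "f (f p) = p" for p using assms by (simp add: matching_def)
  have inj: "f x = f y \<longleftrightarrow> x = y" for x y using ff by metis
  have ne: "a \<noteq> i" "b \<noteq> Suc i" using assms by (auto simp: ab matching_def)
  have ne': "a \<noteq> Suc i" "b \<noteq> i" "a \<noteq> b" using False ff[of i] ff[of "Suc i"] inj by (auto simp: ab)
  have fi: "f p = i \<longleftrightarrow> p = a" "f p = Suc i \<longleftrightarrow> p = b" "f p = a \<longleftrightarrow> p = i" "f p = b \<longleftrightarrow> p = Suc i" for p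
    using ff inj unfolding ab by metis+
  have e: "act i f p = (if p = i then Suc i else if p = Suc i then i else if p = a then b else if p = b then a else f p)" for p
    using ne ne' by (auto simp: act_def ab)
  have r: "a \<in> {1..2*n}" "b \<in> {1..2*n}"
    using matching_range[OF assms(1)] assms by (auto simp: ab)
  show ?thesis unfolding matching_def
  proof (intro conjI allI ballI impI)
    fix p show "act i f (act i f p) = p" using ne ne' ff fi by (auto simp: e)
  next
    fix p assume "p \<in> {1..2*n}"
    then have "f p \<noteq> p" using assms by (auto simp: matching_def)
    then show "act i f p \<noteq> p" using ne ne' by (auto simp: e)
  next
    fix p assume p: "p \<notin> {1..2*n}"
    then have "f p = p" using assms by (auto simp: matching_def)
    moreover have "p \<noteq> i" "p \<noteq> Suc i" "p \<noteq> a" "p \<noteq> b" using assms p r by auto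
    ultimately show "act i f p = p" by (simp add: e)
  qed
qed

text \<open>A word in the letters below \<open>m\<close> leaves the last thread of \<open>m + 1\<close> threads alone.\<close>

lemma eval_word_insert:
  assumes "w \<in> words m" "matching m g" "eval_word w (g, k) = (f, l)"
  shows "eval_word w (insert_pair (Suc m) g, k) = (insert_pair (Suc m) f, l) \<and> matching m f"
  using assms(1,3)
proof (induction w arbitrary: f l rule: rev_induct)
  case Nil then show ?case using assms by (simp add: eval_word_def)
next
  case (snoc i w)
  obtain h r where h: "eval_word w (g, k) = (h, r)" by fastforce
  have IH: "eval_word w (insert_pair (Suc m) g, k) = (insert_pair (Suc m) h, r)" "matching m h"
    using snoc h by auto
  have fl: "f = act i h" "l = r + loops i h" using snoc.prems h by (auto simp: eval_word_def act_inv_def)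
  have i: "1 \<le> i" "i < m" using snoc by auto
  have "h (h p) = p" for p using IH by (simp add: matching_def)
  then have "act i (insert_pair (Suc m) h) = insert_pair (Suc m) (act i h)"
    using act_insert_shift[of h "Suc m" i] i by (simp add: skip_def)
  moreover have "loops i (insert_pair (Suc m) h) = loops i h"
    using i by (auto simp: loops_def insert_pair_def skip_def unskip_def)
  moreover have "matching m (act i h)" using matching_act[OF IH(2)] i by simp
  ultimately show ?case using fl IH by (simp add: eval_word_def act_inv_def)
qed

lemma eval_nf:
  assumes "noncrossing n f"
  shows "eval_word (normal_form n f) (id_matching n, k) = (f, k)"
  using assms
proof (induction n arbitrary: f)
  case 0
  then have "f = (\<lambda>p. p)" by (cases rule: noncrossing.cases) auto
  then show ?case by (auto simp: eval_word_def id_matching_def)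
next
  case (Suc m)
  define j where "j = first_pair f"
  define g where "g = remove_pair j f"
  have f: "1 \<le> j" "j \<le> m + 1" "noncrossing m g" "f = insert_pair j g"
    using noncrossing_remove_first_pair[OF Suc.prems(1)] by (auto simp: j_def g_def)
  have "eval_word (normal_form m g) (insert_pair (Suc m) (id_matching m), k) = (insert_pair (Suc m) g, k)"
    using eval_word_insert[OF nf_words[OF f(3), of m] noncrossing_matching[OF noncrossing_id_matching] Suc.IH[OF f(3)]] by simp
  moreover have "eval_word (descend m j) (insert_pair (Suc m) g, k) = (insert_pair j g, k)"
    using eval_descend[OF noncrossing_matching[OF f(3)]] f by simp
  moreover have "normal_form (Suc m) f = normal_form m g @ descend m j" by (simp add: j_def g_def normal_form.simps(2))
  ultimately show ?case using f by (simp add: eval_word_def id_matching_Suc)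
qed


section \<open>Arcs in one-manifolds\<close>

text \<open>Charts are replaced by arcs: an interval around a point in a chart gives an arc whose
interior, or whose image without the final point, is open. A set is a one-manifold iff all its points are of
one of the two kinds (\<open>manifold_iff\<close>), and arcs are easier to cut and join than charts.\<close>

definition inner_pt :: "'a::euclidean_space set \<Rightarrow> 'a \<Rightarrow> bool" where
  "inner_pt M x \<longleftrightarrow> (\<exists>g. arc g \<and> path_image g \<subseteq> M \<and>
    openin (top_of_set M) (path_image g - {pathstart g, pathfinish g}) \<and>
    x \<in> path_image g - {pathstart g, pathfinish g})"

definition end_pt :: "'a::euclidean_space set \<Rightarrow> 'a \<Rightarrow> bool" where
  "end_pt M x \<longleftrightarrow> (\<exists>g. arc g \<and> path_image g \<subseteq> M \<and> pathstart g = x \<and>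
    openin (top_of_set M) (path_image g - {pathfinish g}))"

lemma arc_image_open:
  assumes "arc g"
  shows "path_image g - {pathfinish g} = g ` {0..<1}"
    and "path_image g - {pathstart g, pathfinish g} = g ` {0<..<1}"
proof -
  have inj: "inj_on g {0..1}" using assms by (simp add: arc_def)
  have "{0..1::real} - {1} = {0..<1}" "{0..1::real} - {0, 1} = {0<..<1}"
    "{0..<1} \<subseteq> {0..1::real}" "{0<..<1} \<subseteq> {0..1::real}" by auto
  then show "path_image g - {pathfinish g} = g ` {0..<1}"
      "path_image g - {pathstart g, pathfinish g} = g ` {0<..<1}"
    using inj_on_image_set_diff[OF inj, of "{0..1}" "{1}"] inj_on_image_set_diff[OF inj, of "{0..1}" "{0, 1}"]
    by (simp_all add: path_image_def pathstart_def pathfinish_def)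
qed

lemma homeomorphism_inj_on: "homeomorphism U V f k \<Longrightarrow> inj_on f U \<and> inj_on k V"
  unfolding homeomorphism_def by (metis inj_on_inverseI)

lemma homeomorphism_value: "homeomorphism U V f k \<Longrightarrow> p \<in> U \<Longrightarrow> f p \<in> V \<and> k (f p) = p"
  unfolding homeomorphism_def by blast

lemma homeomorphism_cancel:
  assumes "homeomorphism U V f k" "A \<subseteq> U"
  shows "k ` f ` A = A"
proof -
  have "k (f x) = x" if "x \<in> A" for x using homeomorphism_apply1[OF assms(1)] that assms(2) by blast
  then show ?thesis by (simp add: image_image)
qed

lemma chart_arc:
  fixes M :: "'a::euclidean_space set"
  assumes hom: "homeomorphism U V f k" and opU: "openin (top_of_set M) U"
    and ab: "a \<noteq> b" "closed_segment a b \<subseteq> V"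
  shows "arc (k \<circ> linepath a b)" "path_image (k \<circ> linepath a b) = k ` closed_segment a b"
    "path_image (k \<circ> linepath a b) \<subseteq> M" "pathstart (k \<circ> linepath a b) = k a"
    "pathfinish (k \<circ> linepath a b) = k b" "inj_on k V"
proof -
  show inj: "inj_on k V" using homeomorphism_inj_on[OF hom] by simp
  have c: "continuous_on V k" using hom by (simp add: homeomorphism_def)
  show im: "path_image (k \<circ> linepath a b) = k ` closed_segment a b"
    by (simp add: path_image_compose)
  have "path (k \<circ> linepath a b)"
    by (rule path_continuous_image) (use c ab continuous_on_subset in auto)
  moreover have "inj_on (k \<circ> linepath a b) {0..1}"
  proof (rule comp_inj_on)
    show "inj_on (linepath a b) {0..1}" using arc_linepath[OF ab(1)] by (simp add: arc_def)
    show "inj_on k (linepath a b ` {0..1})"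
      using inj ab(2) by (metis inj_on_subset path_image_def path_image_linepath)
  qed
  ultimately show "arc (k \<circ> linepath a b)" by (simp add: arc_def)
  show "path_image (k \<circ> linepath a b) \<subseteq> M"
    unfolding im using image_mono[OF ab(2), of k] homeomorphism_image2[OF hom] openin_imp_subset[OF opU] by simp
  show "pathstart (k \<circ> linepath a b) = k a" "pathfinish (k \<circ> linepath a b) = k b"
    by (simp_all add: pathstart_compose pathfinish_compose)
qed

lemma chart_open:
  fixes M :: "'a::euclidean_space set"
  assumes "homeomorphism U V f k" "openin (top_of_set M) U" "openin (top_of_set {0..}) V"
    "openin (top_of_set {0..}) W" "W \<subseteq> V"
  shows "openin (top_of_set M) (k ` W)"
proof -
  have "openin (top_of_set V) W"
    using assms by (metis openin_imp_subset openin_subset_trans)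
  then have "openin (top_of_set U) (k ` W)"
    using homeomorphism_imp_open_map homeomorphism_symD assms(1) by metis
  then show ?thesis using assms(2) openin_trans by blast
qed

text \<open>The radius \<open>2 * e\<close> leaves room for an arc on either side of the interval of radius \<open>e\<close>, which
\<open>closed_manifold_is_circle\<close> needs. In a boundary chart, where \<open>v = 0\<close>, only the right half is used.\<close>

lemma chart_interval:
  fixes V :: "real set"
  assumes "openin (top_of_set {0..}) V" "v \<in> V"
  obtains e where "e > 0" "{0..} \<inter> {v - 2*e..v + 2*e} \<subseteq> V" "v > 0 \<Longrightarrow> v - 2*e > 0"
proof -
  have "v \<ge> 0" using openin_imp_subset[OF assms(1)] assms(2) by auto
  obtain d where d: "d > 0" "ball v d \<inter> {0..} \<subseteq> V"
    using assms unfolding openin_contains_ball by blast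
  define e where "e = (if v > 0 then min d v / 3 else d / 3)"
  have e: "e > 0" "2 * e < d" "v > 0 \<Longrightarrow> 2 * e < v" using d by (auto simp: e_def)
  have "{v - 2*e..v + 2*e} \<subseteq> ball v d" using e by (auto simp: dist_real_def)
  then have "{0..} \<inter> {v - 2*e..v + 2*e} \<subseteq> V" using d by blast
  then show thesis using that[of e] e by simp
qed

lemma chart_end_pt:
  fixes M :: "'a::euclidean_space set"
  assumes "half_line_chart M U f" "p \<in> U" "f p = 0"
  shows "end_pt M p"
proof -
  obtain V k where U: "openin (top_of_set M) U" and V: "openin (top_of_set {0..}) V"
    and hom: "homeomorphism U V f k" using assms unfolding half_line_chart_def by blast
  have "0 \<in> V" "k 0 = p" using homeomorphism_value[OF hom assms(2)] assms(3) by auto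
  then obtain e where e: "e > 0" "{0..} \<inter> {0 - 2*e..0 + 2*e} \<subseteq> V"
    using chart_interval[OF V \<open>0 \<in> V\<close>] by metis
  have seg: "closed_segment 0 e = {0..e}" using e by (simp add: closed_segment_eq_real_ivl)
  have sub: "closed_segment 0 e \<subseteq> V" using e by (auto simp: seg)
  note g = chart_arc[OF hom U _ sub]
  have "{0..e} - {e} = {0..<e}" by auto
  moreover have "{0..<e} \<subseteq> V" "e \<in> V" using sub e(1) unfolding seg by auto
  ultimately have "k ` {0..e} - {k e} = k ` {0..<e}"
    using inj_on_image_set_diff[of k V "{0..e}" "{e}"] g(6) e(1) sub unfolding seg by simp
  moreover have "{0..<e} = {0..} \<inter> {..<e}" by auto
  then have "openin (top_of_set {0..}) {0..<e}" by (metis openin_open_Int open_lessThan)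
  then have "openin (top_of_set M) (k ` {0..<e})"
    using sub by (intro chart_open[OF hom U V]) (auto simp: seg)
  ultimately show ?thesis unfolding end_pt_def
    using g(1-5) e \<open>k 0 = p\<close> by (intro exI[of _ "k \<circ> linepath 0 e"]) (simp add: seg)
qed

lemma chart_inner_pt:
  fixes M :: "'a::euclidean_space set"
  assumes "half_line_chart M U f" "p \<in> U" "f p \<noteq> 0"
  shows "inner_pt M p"
proof -
  obtain V k where U: "openin (top_of_set M) U" and V: "openin (top_of_set {0..}) V"
    and hom: "homeomorphism U V f k" using assms unfolding half_line_chart_def by blast
  define v where "v = f p"
  have vV: "v \<in> V" "k v = p" using homeomorphism_value[OF hom assms(2)] by (auto simp: v_def)
  have "v \<ge> 0" using openin_imp_subset[OF V] vV(1) by auto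
  then have v: "v > 0" using assms(3) by (simp add: v_def)
  obtain e where e: "e > 0" "{0..} \<inter> {v - 2*e..v + 2*e} \<subseteq> V" "v - 2*e > 0"
    using chart_interval[OF V vV(1)] v by metis
  have seg: "closed_segment (v - e) (v + e) = {v - e..v + e}"
    using e by (simp add: closed_segment_eq_real_ivl)
  have sub: "closed_segment (v - e) (v + e) \<subseteq> V" using e by (auto simp: seg)
  note g = chart_arc[OF hom U _ sub]
  have ke: "k ` {v - e..v + e} - {k (v - e), k (v + e)} = k ` {v - e<..<v + e}"
  proof -
    have "{v - e..v + e} - {v - e, v + e} = {v - e<..<v + e}" by auto
    moreover have "{v - e..v + e} - {v - e, v + e} \<subseteq> V" "{v - e, v + e} \<subseteq> V"
      using sub e(1) unfolding seg by auto
    ultimately show ?thesis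
      using inj_on_image_set_diff[of k V "{v - e..v + e}" "{v - e, v + e}"] g(6) e(1) by simp
  qed
  have "{v - e<..<v + e} = {0..} \<inter> {v - e<..<v + e}" using e by auto
  then have "openin (top_of_set {0..}) {v - e<..<v + e}" by (metis openin_open_Int open_greaterThanLessThan)
  then have "openin (top_of_set M) (k ` {v - e<..<v + e})"
    using sub by (intro chart_open[OF hom U V]) (auto simp: seg)
  moreover have "p \<in> k ` {v - e<..<v + e}" using vV e by auto
  ultimately show ?thesis unfolding inner_pt_def
    using g(1-5) e ke by (intro exI[of _ "k \<circ> linepath (v - e) (v + e)"]) (simp add: seg)
qed

lemma end_pt_chart:
  fixes M :: "'a::euclidean_space set"
  assumes "end_pt M x"
  shows "\<exists>U f. x \<in> U \<and> half_line_chart M U f \<and> f x = 0"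
proof -
  obtain g where g: "arc g" "pathstart g = x" "openin (top_of_set M) (path_image g - {pathfinish g})"
    using assms unfolding end_pt_def by blast
  obtain h where h: "homeomorphism {0..1} (path_image g) g h" using homeomorphism_arc g by blast
  have hom: "homeomorphism (g ` {0..<1}) {0..<1} h g"
    by (rule homeomorphism_symD, rule homeomorphism_of_subsets[OF h]) (auto simp: path_image_def)
  have "{0..<1::real} = {0..} \<inter> {..<1}" by auto
  then have "openin (top_of_set {0..}) {0..<1::real}" by (metis openin_open_Int open_lessThan)
  then have "half_line_chart M (g ` {0..<1}) h"
    unfolding half_line_chart_def using g hom arc_image_open by metis
  moreover have "x \<in> g ` {0..<1}" "h x = 0" using g homeomorphism_apply1[OF h, of 0] by (auto simp: pathstart_def)
  ultimately show ?thesis by blast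
qed

lemma inner_pt_chart:
  fixes M :: "'a::euclidean_space set"
  assumes "inner_pt M x"
  shows "\<exists>U f. x \<in> U \<and> half_line_chart M U f \<and> f x \<noteq> 0"
proof -
  obtain g where g: "arc g" "openin (top_of_set M) (path_image g - {pathstart g, pathfinish g})"
     "x \<in> path_image g - {pathstart g, pathfinish g}"
    using assms unfolding inner_pt_def by blast
  obtain h where h: "homeomorphism {0..1} (path_image g) g h" using homeomorphism_arc g by blast
  have hom: "homeomorphism (g ` {0<..<1}) {0<..<1} h g"
    by (rule homeomorphism_symD, rule homeomorphism_of_subsets[OF h]) (auto simp: path_image_def)
  have "{0<..<1::real} = {0..} \<inter> {0<..<1}" by auto
  then have "openin (top_of_set {0..}) {0<..<1::real}" by (metis openin_open_Int open_greaterThanLessThan)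
  then have "half_line_chart M (g ` {0<..<1}) h"
    unfolding half_line_chart_def using g hom arc_image_open by metis
  moreover have x: "x \<in> g ` {0<..<1}" using g arc_image_open by metis
  moreover have "h x \<noteq> 0" using homeomorphism_value[OF hom x] by auto
  ultimately show ?thesis by blast
qed

lemma manifold_iff: "one_manifold_with_boundary M \<longleftrightarrow> (\<forall>p\<in>M. inner_pt M p \<or> end_pt M p)"
  unfolding one_manifold_with_boundary_def
  using inner_pt_chart end_pt_chart chart_inner_pt chart_end_pt by meson

lemma boundary_iff: "boundary_points M = {p \<in> M. end_pt M p}"
  unfolding boundary_points_def using end_pt_chart chart_end_pt by blast

lemma chart_local:
  fixes M :: "'a::euclidean_space set"
  assumes "openin (top_of_set M) W"
  shows "half_line_chart M U f \<Longrightarrow> half_line_chart W (U \<inter> W) f"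
    and "half_line_chart W U f \<Longrightarrow> half_line_chart M U f"
proof -
  show "half_line_chart W U f \<Longrightarrow> half_line_chart M U f"
    unfolding half_line_chart_def using assms openin_trans by blast
  assume "half_line_chart M U f"
  then obtain V k where U: "openin (top_of_set M) U" and V: "openin (top_of_set {0..}) V"
    and hom: "homeomorphism U V f k" unfolding half_line_chart_def by blast
  have UW: "openin (top_of_set M) (U \<inter> W)" using U assms by blast
  then have oU: "openin (top_of_set U) (U \<inter> W)"
    by (meson U inf_le1 openin_imp_subset openin_subset_trans)
  have "openin (top_of_set V) (f ` (U \<inter> W))" using homeomorphism_imp_open_map[OF hom oU] .
  then have "openin (top_of_set {0..}) (f ` (U \<inter> W))" using V openin_trans by blast
  moreover have "homeomorphism (U \<inter> W) (f ` (U \<inter> W)) f k"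
    using homeomorphism_of_subsets[OF hom, of "U \<inter> W" "f ` (U \<inter> W)" "f ` (U \<inter> W)"]
      homeomorphism_image1[OF hom] by blast
  moreover have "openin (top_of_set W) (U \<inter> W)"
    using UW by (meson assms inf_le2 openin_imp_subset openin_subset_trans)
  ultimately show "half_line_chart W (U \<inter> W) f" unfolding half_line_chart_def by blast
qed

lemma inner_pt_local:
  assumes "openin (top_of_set M) W" "x \<in> W"
  shows "inner_pt W x \<longleftrightarrow> inner_pt M x"
  using chart_local[OF assms(1)] assms(2) inner_pt_chart chart_inner_pt by (metis IntI)

lemma end_pt_local:
  assumes "openin (top_of_set M) W" "x \<in> W"
  shows "end_pt W x \<longleftrightarrow> end_pt M x"
  using chart_local[OF assms(1)] assms(2) end_pt_chart chart_end_pt by (metis IntI)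

lemma manifold_open_subset:
  fixes M :: "'a::euclidean_space set"
  assumes "one_manifold_with_boundary M" "openin (top_of_set M) W"
  shows "one_manifold_with_boundary W" "boundary_points W = boundary_points M \<inter> W"
  using assms(1) openin_imp_subset[OF assms(2)] inner_pt_local[OF assms(2)] end_pt_local[OF assms(2)]
  unfolding manifold_iff boundary_iff by auto

text \<open>Near an interior point of the arc, the arc followed by the chart is an injective continuous function
of a real variable. By invariance of domain in dimension one its image is open, and an open subset of the half-line
does not contain \<open>0\<close>.\<close>

lemma arc_interior_nbhd:
  fixes M :: "'a::euclidean_space set"
  assumes g: "arc g" "path_image g \<subseteq> M" and ch: "half_line_chart M U f" "x \<in> U"
    and x: "x \<in> path_image g - {pathstart g, pathfinish g}"
  shows "f x \<noteq> 0"
    and "\<exists>T. openin (top_of_set M) T \<and> x \<in> T \<and> T \<subseteq> path_image g - {pathstart g, pathfinish g}"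
proof -
  obtain V k where U: "openin (top_of_set M) U" and V: "openin (top_of_set {0..}) V"
    and hom: "homeomorphism U V f k" using ch unfolding half_line_chart_def by blast
  note e = arc_image_open[OF g(1)]
  obtain t where t: "x = g t" "0 < t" "t < 1" using x e(2) by auto
  have cg: "continuous_on {0<..<1} g"
    using g by (auto simp: arc_def path_def intro: continuous_on_subset)
  define S where "S = {0<..<1} \<inter> g -` U"
  have "openin (top_of_set {0<..<1}) S" unfolding S_def
    by (rule continuous_openin_preimage[OF cg _ U]) (use g e in \<open>auto simp: path_image_def\<close>)
  then have S: "open S" by (rule openin_open_trans) simp
  have gS: "g ` S \<subseteq> U" by (auto simp: S_def)
  have "continuous_on S (f \<circ> g)"
    using cg hom gS by (intro continuous_on_compose) (auto simp: S_def homeomorphism_def intro: continuous_on_subset)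
  moreover have "inj_on (f \<circ> g) S"
  proof (rule comp_inj_on)
    show "inj_on g S" using g by (auto simp: arc_def S_def intro: inj_on_subset)
    show "inj_on f (g ` S)" using homeomorphism_inj_on[OF hom] gS inj_on_subset by blast
  qed
  ultimately have op: "open (f ` g ` S)" using invariance_of_domain[OF _ S] by (metis image_comp)
  have sub: "f ` g ` S \<subseteq> V" using image_mono[OF gS, of f] homeomorphism_image1[OF hom] by simp
  have fx: "f x \<in> f ` g ` S" using t ch by (auto simp: S_def)
  have V0: "V \<subseteq> {0..}" using openin_imp_subset[OF V] .
  show "f x \<noteq> 0"
  proof
    assume "f x = 0"
    then obtain d where d: "d > 0" "ball 0 d \<subseteq> f ` g ` S" using op fx openE by metis
    moreover have "- d / 2 \<in> ball 0 d" using d by (simp add: dist_real_def)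
    ultimately have "- d / 2 \<in> {0..}" using sub V0 by blast
    then show False using d by simp
  qed
  have "openin (top_of_set {0..}) (f ` g ` S)" using op sub V0 by (metis open_subset subset_trans)
  then have "openin (top_of_set M) (k ` f ` g ` S)" using chart_open[OF hom U V] sub by blast
  moreover have "k ` f ` g ` S = g ` S" using homeomorphism_cancel[OF hom gS] by simp
  ultimately have "openin (top_of_set M) (g ` S)" by simp
  moreover have "g ` S \<subseteq> path_image g - {pathstart g, pathfinish g}" unfolding e by (auto simp: S_def)
  moreover have "x \<in> g ` S" using t ch by (auto simp: S_def)
  ultimately show "\<exists>T. openin (top_of_set M) T \<and> x \<in> T \<and> T \<subseteq> path_image g - {pathstart g, pathfinish g}"
    by blast
qed

lemma arc_interior_not_boundary:
  assumes "arc g" "path_image g \<subseteq> M" "x \<in> path_image g - {pathstart g, pathfinish g}"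
  shows "\<not> end_pt M x"
  using arc_interior_nbhd(1)[OF assms(1,2) _ _ assms(3)] end_pt_chart by metis

lemma inner_pt_not_end_pt: "inner_pt M x \<Longrightarrow> \<not> end_pt M x"
  unfolding inner_pt_def using arc_interior_not_boundary by blast

text \<open>In a chart in which the arc starts at \<open>0\<close>, the image of a short initial piece is
connected and contains \<open>0\<close> and a positive number, hence an interval \<open>{0..<c}\<close>.\<close>

lemma arc_start_nbhd:
  assumes g: "arc g" "path_image g \<subseteq> M" and "end_pt M (pathstart g)"
  shows "\<exists>T. openin (top_of_set M) T \<and> pathstart g \<in> T \<and> T \<subseteq> path_image g - {pathfinish g}"
proof -
  define x where "x = pathstart g"
  obtain U f where ch: "half_line_chart M U f" "x \<in> U" "f x = 0"
    using end_pt_chart assms x_def by blast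
  obtain V k where U: "openin (top_of_set M) U" and V: "openin (top_of_set {0..}) V"
    and hom: "homeomorphism U V f k" using ch unfolding half_line_chart_def by blast
  note e = arc_image_open[OF g(1)]
  have cg: "continuous_on {0..1} g" using g by (auto simp: arc_def path_def)
  define S where "S = {0..1} \<inter> g -` U"
  have "openin (top_of_set {0..1}) S" unfolding S_def
    by (rule continuous_openin_preimage[OF cg _ U]) (use g in \<open>auto simp: path_image_def\<close>)
  moreover have "0 \<in> S" using ch by (auto simp: S_def x_def pathstart_def)
  ultimately obtain r where r: "r > 0" "ball 0 r \<inter> {0..1} \<subseteq> S"
    unfolding openin_contains_ball by blast
  define d where "d = min r 1 / 2"
  have d: "0 < d" "d < 1" "d < r" using r by (auto simp: d_def)
  have "{0..d} \<subseteq> ball 0 r \<inter> {0..1}" using d by (auto simp: dist_real_def)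
  then have dS: "{0..d} \<subseteq> S" using r by blast
  have gS: "g ` {0..d} \<subseteq> U" using dS by (auto simp: S_def)
  have "continuous_on {0..d} (f \<circ> g)"
    using cg hom gS d by (intro continuous_on_compose) (auto simp: homeomorphism_def intro: continuous_on_subset)
  then have conn: "connected (f ` g ` {0..d})"
    by (metis connected_continuous_image connected_Icc image_comp)
  define c where "c = f (g d)"
  have V0: "V \<subseteq> {0..}" using openin_imp_subset[OF V] .
  have sub: "f ` g ` {0..d} \<subseteq> V" using image_mono[OF gS, of f] homeomorphism_image1[OF hom] by simp
  have gd: "g d \<noteq> x" using inj_onD[of g "{0..1}" d 0] g d by (auto simp: x_def pathstart_def arc_def)
  have "c \<noteq> 0"
  proof
    assume "c = 0"
    moreover have "g d \<in> U" using gS d by auto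
    ultimately have "g d = x"
      using homeomorphism_value[OF hom] ch unfolding c_def by metis
    then show False using gd by simp
  qed
  moreover have "c \<in> V" using sub d by (auto simp: c_def)
  ultimately have c: "c > 0" using V0 by force
  have "0 = f (g 0)" using ch by (simp add: x_def pathstart_def)
  then have "0 \<in> f ` g ` {0..d}" using d by (metis atLeastAtMost_iff imageI less_eq_real_def order_refl)
  moreover have "c \<in> f ` g ` {0..d}" using d by (auto simp: c_def)
  ultimately have "{0..c} \<subseteq> f ` g ` {0..d}" using conn connected_contains_Icc by metis
  then have W: "{0..<c} \<subseteq> f ` g ` {0..d}" by auto
  have "{0..<c} = {0..} \<inter> {..<c}" by auto
  then have "openin (top_of_set {0..}) {0..<c}" by (metis openin_open_Int open_lessThan)
  then have "openin (top_of_set M) (k ` {0..<c})"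
    using W sub by (intro chart_open[OF hom U V]) auto
  moreover have "k ` {0..<c} \<subseteq> g ` {0..d}"
    using image_mono[OF W, of k] homeomorphism_cancel[OF hom gS] by simp
  moreover have "x = k 0" using homeomorphism_value[OF hom ch(2)] ch(3) by simp
  moreover have "g ` {0..d} \<subseteq> g ` {0..<1}" using d by auto
  ultimately show ?thesis unfolding e x_def[symmetric]
    using c by (intro exI[of _ "k ` {0..<c}"]) auto
qed

lemma arc_open_in_manifold:
  fixes M :: "'a::euclidean_space set"
  assumes M: "one_manifold_with_boundary M" and g: "arc g" "path_image g \<subseteq> M"
  shows "openin (top_of_set M) (path_image g - ({pathstart g, pathfinish g} - boundary_points M))"
    (is "openin _ ?O")
  unfolding openin_subopen[of _ ?O]
proof
  fix x assume x: "x \<in> ?O"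
  then have xM: "x \<in> M" using g by auto
  show "\<exists>T. openin (top_of_set M) T \<and> x \<in> T \<and> T \<subseteq> ?O"
  proof (cases "x \<in> {pathstart g, pathfinish g}")
    case False
    then obtain U f where "half_line_chart M U f" "x \<in> U"
      using M xM unfolding one_manifold_with_boundary_def by blast
    then obtain T where "openin (top_of_set M) T" "x \<in> T" "T \<subseteq> path_image g - {pathstart g, pathfinish g}"
      using arc_interior_nbhd(2)[OF g, of U f x] x False by auto
    then show ?thesis by blast
  next
    case True
    then have E: "end_pt M x" using x by (auto simp: boundary_iff)
    then show ?thesis
    proof (cases "x = pathstart g")
      case True
      then show ?thesis using arc_start_nbhd[OF g] E x xM by (auto simp: boundary_iff)
    next
      case False
      then have "x = pathfinish g" using True x by auto
      then show ?thesis using arc_start_nbhd[OF arc_reversepath[OF g(1)], of M] g(2) E x xM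
        by (auto simp: boundary_iff)
    qed
  qed
qed

lemma manifold_locally_path_connected:
  fixes M :: "'a::euclidean_space set"
  assumes M: "one_manifold_with_boundary M"
  shows "locally path_connected M"
  unfolding locally_def
proof (intro allI impI, elim conjE)
  fix w x assume w: "openin (top_of_set M) w" "x \<in> w"
  then obtain U f where ch: "half_line_chart w U f" "x \<in> U"
    using manifold_open_subset[OF M] unfolding one_manifold_with_boundary_def by blast
  then obtain V k where U: "openin (top_of_set w) U" and V: "openin (top_of_set {0..}) V"
    and hom: "homeomorphism U V f k" unfolding half_line_chart_def by blast
  have fx: "f x \<in> V" "k (f x) = x" using homeomorphism_value[OF hom ch(2)] by auto
  then obtain d where d: "d > 0" "ball (f x) d \<inter> {0..} \<subseteq> V"
    using V unfolding openin_contains_ball by blast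
  define I where "I = ball (f x) d \<inter> {0..}"
  have "openin (top_of_set {0..}) I" by (auto simp: I_def Int_commute)
  then have op: "openin (top_of_set w) (k ` I)" using chart_open[OF hom U V] d I_def by blast
  have "convex I" unfolding I_def by (intro convex_Int convex_ball convex_real_interval)
  then have "path_connected (k ` I)"
    using hom d by (intro path_connected_continuous_image convex_imp_path_connected)
      (auto simp: homeomorphism_def I_def intro: continuous_on_subset)
  moreover have "f x \<in> I" using fx(1) d openin_imp_subset[OF V] by (auto simp: I_def)
  then have "x \<in> k ` I" using fx(2) by (metis imageI)
  ultimately show "\<exists>u v. openin (top_of_set M) u \<and> path_connected v \<and> x \<in> u \<and> u \<subseteq> v \<and> v \<subseteq> w"
    using op openin_trans[OF op w(1)] openin_imp_subset[OF op] by blast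
qed

lemma manifold_component:
  fixes M :: "'a::euclidean_space set"
  assumes M: "one_manifold_with_boundary M" and C: "C \<in> components M"
  shows "openin (top_of_set M) C" "one_manifold_with_boundary C"
    "boundary_points C = boundary_points M \<inter> C"
proof -
  show o: "openin (top_of_set M) C"
    using manifold_locally_path_connected[OF M] locally_path_connected_imp_locally_connected
      openin_components_locally_connected C by blast
  show "one_manifold_with_boundary C" "boundary_points C = boundary_points M \<inter> C"
    using manifold_open_subset[OF M o] by auto
qed

lemma manifold_arc_exists:
  fixes M :: "'a::euclidean_space set"
  assumes "one_manifold_with_boundary M" "connected M" "x \<in> M" "y \<in> M" "x \<noteq> y"
  obtains g where "arc g" "path_image g \<subseteq> M" "pathstart g = x" "pathfinish g = y"
proof -
  have "path_component M x y"
    using path_component_eq_connected_component[OF manifold_locally_path_connected[OF assms(1)]]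
      assms connected_component_eq_self by (metis connected_iff_eq_connected_component_set mem_Collect_eq)
  then obtain p where "path p" "path_image p \<subseteq> M" "pathstart p = x" "pathfinish p = y"
    unfolding path_component_def by blast
  then obtain q where "arc q" "path_image q \<subseteq> path_image p" "pathstart q = x" "pathfinish q = y"
    using path_contains_arc assms(5) by metis
  then show thesis using that \<open>path_image p \<subseteq> M\<close> by blast
qed

text \<open>An arc between two boundary points is open in the manifold at all of its points, and it is closed,
so it is everything.\<close>

lemma arc_component:
  fixes M :: "'a::euclidean_space set"
  assumes M: "one_manifold_with_boundary M" "connected M"
    and pq: "p \<in> boundary_points M" "q \<in> boundary_points M" "p \<noteq> q"
  obtains g where "arc g" "path_image g = M" "pathstart g = p" "pathfinish g = q" "boundary_points M = {p, q}"
proof -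
  have "p \<in> M" "q \<in> M" using pq by (auto simp: boundary_iff)
  then obtain g where g: "arc g" "path_image g \<subseteq> M" "pathstart g = p" "pathfinish g = q"
    using manifold_arc_exists[OF M _ _ pq(3)] by blast
  have "path_image g - ({pathstart g, pathfinish g} - boundary_points M) = path_image g"
    using pq g by auto
  then have "openin (top_of_set M) (path_image g)" using arc_open_in_manifold[OF M(1) g(1,2)] by metis
  moreover have "closedin (top_of_set M) (path_image g)" using g closed_arc_image closed_subset by metis
  ultimately have im: "path_image g = M" using M(2) g unfolding connected_clopen by (metis path_image_nonempty)
  have "boundary_points M \<subseteq> {p, q}"
    using arc_interior_not_boundary[OF g(1,2)] im g by (auto simp: boundary_iff)
  then show thesis using that g im pq by blast
qed


section \<open>Gluing and classification of one-manifolds\<close>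

lemma openin_Diff_closed: "closed E \<Longrightarrow> openin (top_of_set D) (D - E)"
  by (simp add: Diff_eq openin_open_Int open_Compl)

lemma openin_Int_subset:
  assumes "openin (top_of_set M) S" "N \<subseteq> M"
  shows "openin (top_of_set N) (N \<inter> S)"
proof -
  obtain T where T: "open T" "S = M \<inter> T" using assms(1) by (auto simp: openin_open)
  then have "N \<inter> S = N \<inter> T" using assms(2) by blast
  then show ?thesis using T(1) openin_open by blast
qed

lemma boundary_subset: "boundary_points M \<subseteq> M"
  by (auto simp: boundary_points_def)

text \<open>Two arcs that leave the common boundary point \<open>x\<close> into \<open>A\<close> and into \<open>B\<close> join to an arc with \<open>x\<close> in its interior.
Finiteness of \<open>A \<inter> B\<close> allows to choose them so that they meet only in \<open>x\<close>.\<close>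

lemma glue_inner_pt:
  fixes A B :: "'a::euclidean_space set"
  assumes AB: "closed A" "closed B" "finite (A \<inter> B)"
    and x: "x \<in> A \<inter> B" "end_pt A x" "end_pt B x"
  shows "inner_pt (A \<union> B) x"
proof -
  have avoid: "\<exists>g. arc g \<and> path_image g \<subseteq> D \<and> path_image g \<inter> (A \<inter> B) \<subseteq> {x} \<and> pathstart g = x \<and>
      openin (top_of_set D) (path_image g - {pathfinish g})"
    if D: "end_pt D x" "x \<in> D" for D
  proof -
    have "closed (A \<inter> B - {x})" using AB(3) by (simp add: finite_imp_closed)
    then have op: "openin (top_of_set D) (D - (A \<inter> B - {x}))"
      by (rule openin_Diff_closed)
    then have "end_pt (D - (A \<inter> B - {x})) x" using D end_pt_local[OF op] by simp
    then obtain g where g: "arc g" "path_image g \<subseteq> D - (A \<inter> B - {x})" "pathstart g = x"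
        "openin (top_of_set (D - (A \<inter> B - {x}))) (path_image g - {pathfinish g})"
      unfolding end_pt_def by blast
    show ?thesis
      using g openin_trans[OF g(4) op] by (intro exI[of _ g]) auto
  qed
  obtain g where g: "arc g" "path_image g \<subseteq> A" "path_image g \<inter> (A \<inter> B) \<subseteq> {x}" "pathstart g = x"
      "openin (top_of_set A) (path_image g - {pathfinish g})"
    using avoid x by blast
  obtain h where h: "arc h" "path_image h \<subseteq> B" "path_image h \<inter> (A \<inter> B) \<subseteq> {x}" "pathstart h = x"
      "openin (top_of_set B) (path_image h - {pathfinish h})"
    using avoid x by blast
  define P where "P = path_image g - {pathfinish g}"
  define Q where "Q = path_image h - {pathfinish h}"
  have fin: "pathfinish g \<noteq> x" "pathfinish h \<noteq> x" "pathfinish g \<in> path_image g" "pathfinish h \<in> path_image h"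
    using arc_distinct_ends[OF g(1)] arc_distinct_ends[OF h(1)] g(4) h(4) by auto
  have xin: "x \<in> path_image g" "x \<in> path_image h"
    using g(4) h(4) pathstart_in_path_image[of g] pathstart_in_path_image[of h] by auto
  have arc: "arc (reversepath g +++ h)"
    by (rule arc_join) (use g h in \<open>auto simp: arc_reversepath\<close>)
  have im: "path_image (reversepath g +++ h) = path_image g \<union> path_image h"
    using g h by (simp add: path_image_join)
  have ends: "pathstart (reversepath g +++ h) = pathfinish g" "pathfinish (reversepath g +++ h) = pathfinish h"
    by auto
  have O: "path_image g \<union> path_image h - {pathfinish g, pathfinish h} = P \<union> Q"
    unfolding P_def Q_def using fin g h by blast
  have "closedin (top_of_set A) (A - P)" "closedin (top_of_set B) (B - Q)"
    using g(5) h(5) by (auto simp: P_def Q_def)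
  then have "closed ((A - P) \<union> (B - Q))" using AB closedin_closed_trans by blast
  moreover have "(A \<union> B) - (P \<union> Q) = (A - P) \<union> (B - Q)"
  proof -
    have "P \<subseteq> A" "Q \<subseteq> B" "P \<inter> B \<subseteq> {x}" "Q \<inter> A \<subseteq> {x}" "x \<in> P" "x \<in> Q"
      using g h fin xin by (auto simp: P_def Q_def)
    then show ?thesis by blast
  qed
  ultimately have "closedin (top_of_set (A \<union> B)) ((A \<union> B) - (P \<union> Q))"
    by (metis Diff_subset closed_subset)
  then have "openin (top_of_set (A \<union> B)) (P \<union> Q)"
    using g h by (subst openin_closedin_eq) (auto simp: P_def Q_def)
  then show ?thesis unfolding inner_pt_def
    using arc im ends O g h fin xin by (intro exI[of _ "reversepath g +++ h"]) auto
qed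

text \<open>This lemma serves for composites of diagrams, for closed curves made of two arcs, and, with an empty
intersection, for disjoint unions.\<close>

lemma glue_manifolds:
  fixes A B :: "'a::euclidean_space set"
  assumes AB: "closed A" "closed B" "finite (A \<inter> B)"
    and M: "one_manifold_with_boundary A" "one_manifold_with_boundary B"
    and sub: "A \<inter> B \<subseteq> boundary_points A \<inter> boundary_points B"
  shows "one_manifold_with_boundary (A \<union> B)"
    "boundary_points (A \<union> B) = (boundary_points A \<union> boundary_points B) - A \<inter> B"
proof -
  have loc: "(inner_pt (D \<union> E) x \<longleftrightarrow> inner_pt D x) \<and> (end_pt (D \<union> E) x \<longleftrightarrow> end_pt D x)"
    if "closed D" "closed E" "x \<in> D" "x \<notin> E" for D E :: "'a set" and x
  proof -
    have o1: "openin (top_of_set D) (D - E)" "openin (top_of_set (D \<union> E)) (D - E)"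
      using openin_Diff_closed[OF that(2), of D] openin_Diff_closed[OF that(2), of "D \<union> E"]
      by (simp_all add: Un_Diff)
    show ?thesis using inner_pt_local[OF o1(1)] inner_pt_local[OF o1(2)]
        end_pt_local[OF o1(1)] end_pt_local[OF o1(2)] that by simp
  qed
  have inn: "inner_pt (A \<union> B) x" if "x \<in> A \<inter> B" for x
    using glue_inner_pt[OF AB that] that sub by (auto simp: boundary_iff)
  have Aloc: "(inner_pt (A \<union> B) x \<longleftrightarrow> inner_pt A x) \<and> (end_pt (A \<union> B) x \<longleftrightarrow> end_pt A x)" if "x \<in> A" "x \<notin> B" for x
    using loc[OF AB(1,2)] that by blast
  have Bloc: "(inner_pt (A \<union> B) x \<longleftrightarrow> inner_pt B x) \<and> (end_pt (A \<union> B) x \<longleftrightarrow> end_pt B x)" if "x \<in> B" "x \<notin> A" for x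
    using loc[OF AB(2,1)] that by (metis Un_commute)
  show "one_manifold_with_boundary (A \<union> B)"
    unfolding manifold_iff
  proof
    fix x assume "x \<in> A \<union> B"
    then consider "x \<in> A \<inter> B" | "x \<in> A" "x \<notin> B" | "x \<in> B" "x \<notin> A" by blast
    then show "inner_pt (A \<union> B) x \<or> end_pt (A \<union> B) x"
    proof cases
      case 1 then show ?thesis using inn by simp
    next
      case 2 then show ?thesis using Aloc[OF 2] M(1) unfolding manifold_iff by simp
    next
      case 3 then show ?thesis using Bloc[OF 3] M(2) unfolding manifold_iff by simp
    qed
  qed
  show "boundary_points (A \<union> B) = (boundary_points A \<union> boundary_points B) - A \<inter> B"
  proof (rule Set.set_eqI)
    fix x
    consider "x \<in> A \<inter> B" | "x \<in> A" "x \<notin> B" | "x \<in> B" "x \<notin> A" | "x \<notin> A" "x \<notin> B" by blast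
    then show "x \<in> boundary_points (A \<union> B) \<longleftrightarrow> x \<in> (boundary_points A \<union> boundary_points B) - A \<inter> B"
    proof cases
      case 1
      then show ?thesis using inn[OF 1] inner_pt_not_end_pt by (auto simp: boundary_iff)
    next
      case 2
      then show ?thesis using Aloc by (auto simp: boundary_iff)
    next
      case 3
      then show ?thesis using Bloc by (auto simp: boundary_iff)
    qed (auto simp: boundary_iff)
  qed
qed

lemma arc_manifold:
  fixes g :: "real \<Rightarrow> 'a::euclidean_space"
  assumes g: "arc g"
  shows "one_manifold_with_boundary (path_image g)" "boundary_points (path_image g) = {pathstart g, pathfinish g}"
proof -
  have op: "openin (top_of_set (path_image g)) (path_image g - {a})" for a
    by (simp add: openin_delete)
  have start: "end_pt (path_image h) (pathstart h)" if "arc h" for h :: "real \<Rightarrow> 'a"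
    unfolding end_pt_def using that by (intro exI[of _ h]) (simp add: openin_delete)
  have s: "end_pt (path_image g) (pathstart g)" "end_pt (path_image g) (pathfinish g)"
    using start[OF g] start[OF arc_reversepath[OF g]] by auto
  have "openin (top_of_set (path_image g)) (path_image g - {pathstart g} - {pathfinish g})"
    using op openin_delete by blast
  then have "openin (top_of_set (path_image g)) (path_image g - {pathstart g, pathfinish g})"
    by (metis Diff_insert2)
  then have i: "inner_pt (path_image g) x" if "x \<in> path_image g - {pathstart g, pathfinish g}" for x
    unfolding inner_pt_def using that g by (intro exI[of _ g]) auto
  show "one_manifold_with_boundary (path_image g)"
    unfolding manifold_iff using i s by blast
  show "boundary_points (path_image g) = {pathstart g, pathfinish g}"
    using s i inner_pt_not_end_pt[OF i] by (auto simp: boundary_iff)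
qed

lemma two_arcs_manifold:
  fixes g h :: "real \<Rightarrow> 'a::euclidean_space"
  assumes "arc g" "arc h" "pathstart g = pathstart h" "pathfinish g = pathfinish h"
    "path_image g \<inter> path_image h \<subseteq> {pathstart g, pathfinish g}"
  shows "one_manifold_with_boundary (path_image g \<union> path_image h)"
    "boundary_points (path_image g \<union> path_image h) = {}"
proof -
  have I: "path_image g \<inter> path_image h = {pathstart g, pathfinish g}"
    using assms pathstart_in_path_image[of g] pathstart_in_path_image[of h]
      pathfinish_in_path_image[of g] pathfinish_in_path_image[of h] by auto
  note G = glue_manifolds[of "path_image g" "path_image h", unfolded I arc_manifold(2)[OF assms(1)] arc_manifold(2)[OF assms(2)]]
  show "one_manifold_with_boundary (path_image g \<union> path_image h)"
    "boundary_points (path_image g \<union> path_image h) = {}"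
    using G assms closed_arc_image arc_manifold(1) by auto
qed

lemma arc_minus_finish_connected:
  assumes "arc g"
  shows "connected (path_image g - {pathfinish g})"
  unfolding arc_image_open(1)[OF assms]
  by (rule connected_continuous_image)
    (use assms in \<open>auto simp: arc_def path_def intro: continuous_on_subset\<close>)

text \<open>If \<open>p\<close> were the only boundary point, choose for every other point \<open>x\<close> an arc from \<open>p\<close> to \<open>x\<close>. Without
\<open>x\<close> it is open in \<open>M\<close> and is separated by \<open>x\<close> from the rest of \<open>M\<close>, so these open sets form a chain.
The rest is not empty, because the end point of an arc that fills \<open>M\<close> is a boundary point; so every arc
can be exceeded, and the sets cover \<open>M\<close>. By compactness one of them covers \<open>M\<close>, although it
omits its own end point.\<close>

lemma not_one_boundary_point:
  fixes M :: "'a::euclidean_space set"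
  assumes M: "one_manifold_with_boundary M" "connected M" "compact M"
  shows "boundary_points M \<noteq> {p}"
proof
  assume bd: "boundary_points M = {p}"
  then have p: "p \<in> M" "end_pt M p" by (auto simp: boundary_iff)
  have "\<exists>A. arc A \<and> path_image A \<subseteq> M \<and> pathstart A = p \<and> pathfinish A = x" if "x \<in> M - {p}" for x
    using manifold_arc_exists[OF M(1,2), of p x] that p by blast
  then obtain A where A: "\<And>x. x \<in> M - {p} \<Longrightarrow> arc (A x) \<and> path_image (A x) \<subseteq> M \<and> pathstart (A x) = p \<and> pathfinish (A x) = x"
    by metis
  define I where "I x = path_image (A x)" for x
  \<comment> \<open>An arc that starts at \<open>p\<close> is separated by its end point from the rest of \<open>M\<close>.\<close>
  have sep: "connected T \<Longrightarrow> T \<subseteq> M - {pathfinish g} \<Longrightarrow> p \<in> T \<Longrightarrow> T \<subseteq> path_image g - {pathfinish g}"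
    if g: "arc g" "path_image g \<subseteq> M" "pathstart g = p" for g T
  proof -
    assume T: "connected T" "T \<subseteq> M - {pathfinish g}" "p \<in> T"
    have ne: "pathfinish g \<noteq> p" using arc_distinct_ends[OF g(1)] g(3) by simp
    have "{pathstart g, pathfinish g} - boundary_points M = {pathfinish g}" using ne bd g by auto
    then have "openin (top_of_set M) (path_image g - {pathfinish g})"
      using arc_open_in_manifold[OF M(1) g(1,2)] by simp
    then have o1: "openin (top_of_set T) (T \<inter> (path_image g - {pathfinish g}))"
      using T(2) by (intro openin_Int_subset[of M]) auto
    have "closedin (top_of_set T) (T \<inter> path_image g)"
      using closed_arc_image[OF g(1)] by (simp add: closedin_closed_Int)
    moreover have "T \<inter> path_image g = T \<inter> (path_image g - {pathfinish g})" using T(2) by blast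
    ultimately have "T \<inter> (path_image g - {pathfinish g}) = T"
      using T(1,3) o1 ne g pathstart_in_path_image[of g] unfolding connected_clopen by (metis Diff_iff IntI empty_iff singletonD)
    then show ?thesis by blast
  qed
  define U where "U x = I x - {x}" for x
  have U_open: "openin (top_of_set M) (U x)" if x: "x \<in> M - {p}" for x
  proof -
    have "{pathstart (A x), pathfinish (A x)} - boundary_points M = {x}" using A[OF x] bd x by auto
    then show ?thesis using arc_open_in_manifold[OF M(1), of "A x"] A[OF x] by (simp add: U_def I_def)
  qed
  have proper: "I x \<noteq> M" if x: "x \<in> M - {p}" for x
  proof
    assume "I x = M"
    then have "end_pt M x" using arc_manifold(2)[of "A x"] A[OF x] by (auto simp: I_def boundary_iff)
    then show False using bd x by (auto simp: boundary_iff)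
  qed
  have inI: "p \<in> I x" "x \<in> I x" "I x \<subseteq> M" "connected (I x)" if "x \<in> M - {p}" for x
    using A[OF that] pathstart_in_path_image[of "A x"] pathfinish_in_path_image[of "A x"] connected_arc_image
    by (auto simp: I_def)
  have sepI: "T \<subseteq> U x" if "x \<in> M - {p}" "connected T" "T \<subseteq> M - {x}" "p \<in> T" for x T
    using sep[of "A x" T] A[OF that(1)] that by (simp add: U_def I_def)
  have cover: "\<exists>y\<in>M - {p}. x \<in> U y" if x: "x \<in> M - {p}" for x
  proof -
    obtain y where y: "y \<in> M" "y \<notin> I x" using proper[OF x] inI[OF x] by blast
    then have yp: "y \<in> M - {p}" using inI[OF x] by auto
    have "x \<in> I y"
    proof (rule ccontr)
      assume "x \<notin> I y"
      then have "I y \<subseteq> U x" using sepI[OF x, of "I y"] inI[OF yp] by blast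
      then show False using inI[OF yp] y by (auto simp: U_def)
    qed
    moreover have "x \<noteq> y" using y inI[OF x] by auto
    ultimately show ?thesis using yp by (auto simp: U_def)
  qed
  have chain: "U x \<subseteq> U y \<or> U y \<subseteq> U x" if x: "x \<in> M - {p}" and y: "y \<in> M - {p}" for x y
  proof -
    consider "x = y" | "y \<notin> I x" | "x \<notin> I y" | "x \<noteq> y" "y \<in> I x" "x \<in> I y" by blast
    then show ?thesis
    proof cases
      case 1 then show ?thesis by simp
    next
      case 2
      then have "I x \<subseteq> U y" using sepI[OF y, of "I x"] inI[OF x] by blast
      then show ?thesis by (auto simp: U_def)
    next
      case 3
      then have "I y \<subseteq> U x" using sepI[OF x, of "I y"] inI[OF y] by blast
      then show ?thesis by (auto simp: U_def)
    next
      case 4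
      \<comment> \<open>The part \<open>B\<close> of the arc to \<open>x\<close> up to \<open>y\<close> separates \<open>y\<close> just as the arc to \<open>y\<close> does, but it omits \<open>x\<close>.\<close>
      have Ax: "arc (A x)" "path_image (A x) \<subseteq> M" "A x 0 = p" "A x 1 = x"
        using A[OF x] by (auto simp: pathstart_def pathfinish_def)
      obtain t where t: "t \<in> {0..1}" "A x t = y" using 4 by (auto simp: I_def path_image_def)
      have t01: "t \<noteq> 0" "t \<noteq> 1" using t Ax 4 y by auto
      define B where "B = subpath 0 t (A x)"
      have B: "arc B" "pathstart B = p" "pathfinish B = y" "path_image B = A x ` {0..t}"
        using t t01 Ax by (auto simp: B_def arc_subpath_arc path_image_subpath)
      have BM: "path_image B \<subseteq> M" using B(4) Ax(2) t by (force simp: path_image_def)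
      have xB: "x \<notin> path_image B"
      proof
        assume "x \<in> path_image B"
        then obtain s where "s \<in> {0..t}" "A x s = A x 1" using B(4) Ax by auto
        moreover have "inj_on (A x) {0..1}" using Ax by (simp add: arc_def)
        ultimately have "s = 1" using t inj_onD[of "A x" "{0..1}" s 1] by auto
        then show False using \<open>s \<in> {0..t}\<close> t t01 by auto
      qed
      have "U y \<subseteq> path_image B - {pathfinish B}"
      proof (rule sep[OF B(1) BM B(2)])
        show "connected (U y)" using arc_minus_finish_connected[of "A y"] A[OF y] by (simp add: U_def I_def)
        show "U y \<subseteq> M - {pathfinish B}" using inI[OF y] B by (auto simp: U_def)
        show "p \<in> U y" using inI[OF y] y by (auto simp: U_def)
      qed
      then have "x \<notin> U y" using xB by blast
      then show ?thesis using 4 by (simp add: U_def)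
    qed
  qed
  obtain x0 where x0: "x0 \<in> M - {p}"
  proof -
    obtain g where "arc g" "path_image g \<subseteq> M" "pathstart g = p" using p unfolding end_pt_def by blast
    then show thesis using that[of "pathfinish g"] arc_distinct_ends[of g] pathfinish_in_path_image[of g] by auto
  qed
  have all: "M \<subseteq> \<Union> (U ` (M - {p}))"
    using cover x0 inI(1)[OF x0] by (auto simp: U_def)
  obtain W where W: "\<And>x. x \<in> M - {p} \<Longrightarrow> open (W x) \<and> U x = M \<inter> W x"
    using U_open unfolding openin_open by metis
  have "M \<subseteq> (\<Union>x\<in>M - {p}. W x)" using all W by blast
  then obtain F where F: "F \<subseteq> M - {p}" "finite F" "M \<subseteq> (\<Union>x\<in>F. W x)"
    using compactE_image[OF M(3), of "M - {p}" W] W by auto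
  have "F \<noteq> {}" using F p by auto
  then have "finite (U ` F)" "U ` F \<noteq> {}" using F by auto
  from finite_has_maximal[OF this] obtain m where m: "m \<in> F" "\<And>x. x \<in> F \<Longrightarrow> U m \<subseteq> U x \<Longrightarrow> U m = U x" by auto
  have "U x \<subseteq> U m" if "x \<in> F" for x using chain[of x m] m that F(1) by blast
  then have "M \<subseteq> U m" using F W by blast
  then show False using m F(1) by (auto simp: U_def)
qed

text \<open>Cutting a small open interval out of \<open>M\<close> leaves a compact manifold \<open>N\<close> with exactly two boundary
points, the ends \<open>a\<close> and \<open>b\<close> of the interval. The component of \<open>a\<close> in \<open>N\<close> also contains \<open>b\<close>, because it
does not have exactly one boundary point; so it is an arc from \<open>a\<close> to \<open>b\<close>. This arc and
the interval form a closed curve that is open and closed in \<open>M\<close>.\<close>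

lemma closed_manifold_is_circle:
  fixes M :: "'a::euclidean_space set"
  assumes M: "one_manifold_with_boundary M" "connected M" "compact M" "M \<noteq> {}" "boundary_points M = {}"
  obtains g where "simple_path g" "pathfinish g = pathstart g" "path_image g = M"
proof -
  obtain p where p: "p \<in> M" using M by blast
  then obtain U f where ch: "half_line_chart M U f" "p \<in> U"
    using M(1) unfolding one_manifold_with_boundary_def by blast
  then obtain V k where U: "openin (top_of_set M) U" and V: "openin (top_of_set {0..}) V"
    and hom: "homeomorphism U V f k" unfolding half_line_chart_def by blast
  define v where "v = f p"
  have vV: "v \<in> V" using homeomorphism_value[OF hom ch(2)] by (simp add: v_def)
  have "v \<noteq> 0" using chart_end_pt[OF ch] p M(5) by (auto simp: v_def boundary_iff)
  moreover have "v \<ge> 0" using openin_imp_subset[OF V] vV by auto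
  ultimately have v: "v > 0" by simp
  obtain e where e: "e > 0" "{0..} \<inter> {v - 2*e..v + 2*e} \<subseteq> V" "v - 2*e > 0"
    using chart_interval[OF V vV] v by metis
  have J: "{v - 2*e..v + 2*e} \<subseteq> V" using e by auto
  have kinj: "inj_on k V" using homeomorphism_inj_on[OF hom] by simp
  have kdiff: "k ` S - k ` T = k ` R"
    if "S \<subseteq> {v - 2*e..v + 2*e}" "T \<subseteq> {v - 2*e..v + 2*e}" "S - T = R" for S T R
    using inj_on_image_set_diff[OF kinj, of S T] that J by (metis Diff_subset subset_trans)
  have kM: "k ` V \<subseteq> M" using openin_imp_subset[OF U] homeomorphism_image2[OF hom] by simp
  have kS: "k ` S \<subseteq> M" if "S \<subseteq> {v - 2*e..v + 2*e}" for S
    using kM J image_mono[of S V k] that by blast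
  have kopen: "openin (top_of_set M) (k ` {s<..<t})" if "v - 2*e \<le> s" "t \<le> v + 2*e" for s t
  proof -
    have "{s<..<t} = {0..} \<inter> {s<..<t}" using that e by auto
    then have "openin (top_of_set {0..}) {s<..<t}" by (metis openin_open_Int open_greaterThanLessThan)
    moreover have "{s<..<t} \<subseteq> V" using J that by force
    ultimately show ?thesis using chart_open[OF hom U V] by blast
  qed
  have karc: "arc (k \<circ> linepath s t) \<and> path_image (k \<circ> linepath s t) = k ` closed_segment s t \<and>
      pathstart (k \<circ> linepath s t) = k s \<and> pathfinish (k \<circ> linepath s t) = k t"
    if "s \<noteq> t" "s \<in> {v - 2*e..v + 2*e}" "t \<in> {v - 2*e..v + 2*e}" for s t
  proof -
    have "closed_segment s t \<subseteq> {v - 2*e..v + 2*e}"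
      using that(2,3) by (intro closed_segment_subset) auto
    then have "closed_segment s t \<subseteq> V" using J by blast
    then show ?thesis using chart_arc[OF hom U that(1)] by blast
  qed
  define a where "a = k (v - e)"
  define b where "b = k (v + e)"
  define I where "I = k ` {v - e<..<v + e}"
  define N where "N = M - I"
  define C where "C = k \<circ> linepath (v - e) (v + e)"
  have C: "arc C" "path_image C = k ` {v - e..v + e}" "pathstart C = a" "pathfinish C = b"
    using karc[of "v - e" "v + e"] e by (auto simp: C_def a_def b_def closed_segment_eq_real_ivl)
  have CI: "path_image C - {a, b} = I"
  proof -
    have "k ` {v - e..v + e} - k ` {v - e, v + e} = k ` {v - e<..<v + e}"
      by (rule kdiff) (use e(1) in auto)
    then show ?thesis using C(2) by (simp add: I_def a_def b_def)
  qed
  have Iop: "openin (top_of_set M) I" unfolding I_def by (rule kopen) (use e in auto)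
  have "closedin (top_of_set M) (M - I)" using Iop by (simp add: closedin_diff)
  then have "compact N" unfolding N_def using M(3) closedin_compact by blast
  have "path_image C \<subseteq> M" unfolding C(2) by (rule kS) (use e(1) in auto)
  then have ab: "a \<noteq> b" "a \<in> N" "b \<in> N"
    using C(3,4) arc_distinct_ends[OF C(1)] CI pathstart_in_path_image[of C] pathfinish_in_path_image[of C]
    unfolding N_def by auto
  have NM: "N \<subseteq> M" by (auto simp: N_def)
  have enda: "end_pt N a"
  proof -
    define g where "g = k \<circ> linepath (v - e) (v - 2*e)"
    have g: "arc g" "path_image g = k ` {v - 2*e..v - e}" "pathstart g = a" "pathfinish g = k (v - 2*e)"
      using karc[of "v - e" "v - 2*e"] e by (auto simp: g_def a_def closed_segment_eq_real_ivl)
    have "k ` {v - 2*e..v - e} - I = k ` {v - 2*e..v - e}"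
      unfolding I_def by (rule kdiff) (use e(1) in auto)
    moreover have "k ` {v - 2*e..v - e} \<subseteq> M" using e by (intro kS) auto
    ultimately have gN: "path_image g \<subseteq> N" unfolding g(2) N_def by blast
    have "openin (top_of_set N) (N \<inter> k ` {v - 2*e<..<v + e})"
      using kopen[of "v - 2*e" "v + e"] e NM by (intro openin_Int_subset[of M]) auto
    moreover have "N \<inter> k ` {v - 2*e<..<v + e} = k ` {v - 2*e<..v - e}"
    proof -
      have "k ` {v - 2*e<..<v + e} \<subseteq> M" using e by (intro kS) auto
      then have "N \<inter> k ` {v - 2*e<..<v + e} = k ` {v - 2*e<..<v + e} - k ` {v - e<..<v + e}"
        unfolding N_def I_def by blast
      also have "\<dots> = k ` {v - 2*e<..v - e}"
        by (rule kdiff) (use e(1) in auto)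
      finally show ?thesis .
    qed
    moreover have "k ` {v - 2*e..v - e} - k ` {v - 2*e} = k ` {v - 2*e<..v - e}"
      by (rule kdiff) (use e(1) in auto)
    then have "path_image g - {pathfinish g} = k ` {v - 2*e<..v - e}" unfolding g by simp
    ultimately show ?thesis unfolding end_pt_def using g gN by (intro exI[of _ g]) simp
  qed
  have endb: "end_pt N b"
  proof -
    define g where "g = k \<circ> linepath (v + e) (v + 2*e)"
    have g: "arc g" "path_image g = k ` {v + e..v + 2*e}" "pathstart g = b" "pathfinish g = k (v + 2*e)"
      using karc[of "v + e" "v + 2*e"] e by (auto simp: g_def b_def closed_segment_eq_real_ivl)
    have "k ` {v + e..v + 2*e} - I = k ` {v + e..v + 2*e}"
      unfolding I_def by (rule kdiff) (use e(1) in auto)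
    moreover have "k ` {v + e..v + 2*e} \<subseteq> M" using e by (intro kS) auto
    ultimately have gN: "path_image g \<subseteq> N" unfolding g(2) N_def by blast
    have "openin (top_of_set N) (N \<inter> k ` {v - e<..<v + 2*e})"
      using kopen[of "v - e" "v + 2*e"] e NM by (intro openin_Int_subset[of M]) auto
    moreover have "N \<inter> k ` {v - e<..<v + 2*e} = k ` {v + e..<v + 2*e}"
    proof -
      have "k ` {v - e<..<v + 2*e} \<subseteq> M" using e by (intro kS) auto
      then have "N \<inter> k ` {v - e<..<v + 2*e} = k ` {v - e<..<v + 2*e} - k ` {v - e<..<v + e}"
        unfolding N_def I_def by blast
      also have "\<dots> = k ` {v + e..<v + 2*e}"
        by (rule kdiff) (use e(1) in auto)
      finally show ?thesis .
    qed
    moreover have "k ` {v + e..v + 2*e} - k ` {v + 2*e} = k ` {v + e..<v + 2*e}"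
      by (rule kdiff) (use e(1) in auto)
    then have "path_image g - {pathfinish g} = k ` {v + e..<v + 2*e}" unfolding g by simp
    ultimately show ?thesis unfolding end_pt_def using g gN by (intro exI[of _ g]) simp
  qed
  define W where "W = M - path_image C"
  have WN: "W = N - {a, b}" using CI C pathstart_in_path_image[of C] pathfinish_in_path_image[of C] by (auto simp: W_def N_def)
  have Wop: "openin (top_of_set M) W" "openin (top_of_set N) W"
    using openin_Diff_closed[OF closed_arc_image[OF C(1)], of M]
      openin_Diff_closed[of "{a, b}" N] WN by (simp_all add: W_def)
  have inW: "inner_pt N x" if x: "x \<in> W" for x
  proof -
    have "inner_pt M x" using M(1,5) Wop(1) x unfolding manifold_iff boundary_iff W_def by blast
    then show ?thesis using inner_pt_local[OF Wop(1) x] inner_pt_local[OF Wop(2) x] by simp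
  qed
  have N: "one_manifold_with_boundary N"
    unfolding manifold_iff using inW enda endb WN by blast
  have bdN: "boundary_points N = {a, b}"
    using inW inner_pt_not_end_pt enda endb ab unfolding boundary_iff WN by blast
  define K where "K = connected_component_set N a"
  have K: "K \<in> components N" "a \<in> K" "connected K" "K \<subseteq> N"
    using ab by (auto simp: K_def componentsI connected_component_subset)
  note mK = manifold_component[OF N K(1)]
  have cK: "compact K" using closedin_compact[OF \<open>compact N\<close> closedin_component[OF K(1)]] .
  have bK: "b \<in> K"
  proof (rule ccontr)
    assume "b \<notin> K"
    then have "boundary_points K = {a}" using mK(3) bdN K(2) by auto
    then show False using not_one_boundary_point[OF mK(2) K(3) cK] by blast
  qed
  then obtain g where g: "arc g" "path_image g = K" "pathstart g = a" "pathfinish g = b"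
    using arc_component[OF mK(2) K(3), of a b] mK(3) bdN K(2) ab by blast
  have CK: "path_image C \<inter> K \<subseteq> {a, b}" using CI K(4) by (auto simp: N_def)
  have "simple_path (C +++ reversepath g)"
    by (rule simple_path_join_loop) (use C g CK in \<open>auto simp: arc_reversepath\<close>)
  moreover have im: "path_image (C +++ reversepath g) = path_image C \<union> K"
    using C g by (simp add: path_image_join)
  moreover have "path_image C \<union> K = M"
  proof -
    have e1: "path_image C \<union> K = I \<union> K" using CI C K(2) bK pathstart_in_path_image[of C] pathfinish_in_path_image[of C] by blast
    have "closedin (top_of_set N) (N - K)" using mK(1) by (simp add: closedin_diff)
    then have "closed (N - K)" using closedin_compact[OF \<open>compact N\<close>] compact_imp_closed by blast
    moreover have "I \<subseteq> M" using openin_imp_subset[OF Iop] .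
    then have "M - (path_image C \<union> K) = N - K" unfolding e1 by (auto simp: N_def)
    ultimately have "closedin (top_of_set M) (M - (path_image C \<union> K))"
      using closed_subset[of "M - (path_image C \<union> K)" M] by auto
    moreover have sub: "path_image C \<union> K \<subseteq> M" unfolding e1 using \<open>I \<subseteq> M\<close> K(4) NM by blast
    ultimately have "openin (top_of_set M) (path_image C \<union> K)" by (subst openin_closedin_eq) simp
    moreover have "closedin (top_of_set M) (path_image C \<union> K)"
      using closed_subset[OF sub] closed_arc_image[OF C(1)] cK compact_imp_closed by blast
    ultimately show ?thesis using M(2) K(2) unfolding connected_clopen by blast
  qed
  ultimately show thesis
    using that[of "C +++ reversepath g"] C g by simp
qed


section \<open>Matching and number of circles of a diagram\<close>

lemma connected_component_image:
  assumes "continuous_on X f" "f ` X \<subseteq> Y" "connected_component X x y"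
  shows "connected_component Y (f x) (f y)"
proof -
  obtain T where T: "connected T" "T \<subseteq> X" "x \<in> T" "y \<in> T"
    using assms(3) unfolding connected_component_def by blast
  have "connected (f ` T)" using T assms(1) by (intro connected_continuous_image continuous_on_subset[OF assms(1)])
  then show ?thesis unfolding connected_component_def using T assms(2) by (intro exI[of _ "f ` T"]) auto
qed

lemma connected_component_set_eq_iff:
  assumes "y \<in> S"
  shows "connected_component_set S x = connected_component_set S y \<longleftrightarrow> connected_component S x y"
proof
  assume "connected_component_set S x = connected_component_set S y"
  moreover have "y \<in> connected_component_set S y" using assms by simp
  ultimately have "y \<in> connected_component_set S x" by (simp only:)
  then show "connected_component S x y" by simp
next
  assume "connected_component S x y"
  then show "connected_component_set S x = connected_component_set S y"
    using connected_component_eq[of y S x] by simp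
qed

lemma ex_component: "x \<in> D \<Longrightarrow> \<exists>C\<in>components D. x \<in> C"
  by (intro bexI[of _ "connected_component_set D x"]) (auto simp: componentsI)

lemma homeomorphism_component_set:
  assumes h: "homeomorphism X Y f g" and x: "x \<in> X"
  shows "connected_component_set Y (f x) = f ` connected_component_set X x"
proof
  have c: "continuous_on X f" "continuous_on Y g" "f ` X \<subseteq> Y" "g ` Y \<subseteq> X"
    using h by (auto simp: homeomorphism_def)
  show "f ` connected_component_set X x \<subseteq> connected_component_set Y (f x)"
    using connected_component_image[OF c(1,3)] by auto
  show "connected_component_set Y (f x) \<subseteq> f ` connected_component_set X x"
  proof
    fix y assume "y \<in> connected_component_set Y (f x)"
    then have y: "connected_component Y (f x) y" by simp
    then have "connected_component X (g (f x)) (g y)" using connected_component_image[OF c(2,4)] by blast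
    then have "g y \<in> connected_component_set X x" using homeomorphism_apply1[OF h x] by simp
    moreover have "f (g y) = y" using homeomorphism_apply2[OF h] connected_component_in[OF y] by blast
    ultimately show "y \<in> f ` connected_component_set X x" by (metis imageI)
  qed
qed

lemma homeomorphism_components:
  assumes h: "homeomorphism X Y f g"
  shows "components Y = (`) f ` components X"
proof -
  have Y: "Y = f ` X" using h by (simp add: homeomorphism_def)
  show ?thesis unfolding components_def using homeomorphism_component_set[OF h]
    by (subst Y) (simp add: image_image)
qed

lemma homeomorphism_chart:
  assumes h: "homeomorphism X Y f g" and ch: "half_line_chart X U c"
  shows "half_line_chart Y (f ` U) (c \<circ> g)"
proof -
  obtain V k where U: "openin (top_of_set X) U" and V: "openin (top_of_set {0..}) V"
    and hom: "homeomorphism U V c k" using ch unfolding half_line_chart_def by blast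
  have "openin (top_of_set Y) (f ` U)" using homeomorphism_imp_open_map[OF h U] .
  moreover have "homeomorphism U (f ` U) f g"
    by (rule homeomorphism_of_subsets[OF h]) (use openin_imp_subset[OF U] in auto)
  then have "homeomorphism (f ` U) V (c \<circ> g) (f \<circ> k)"
    using homeomorphism_compose[OF homeomorphism_symD hom] by blast
  ultimately show ?thesis unfolding half_line_chart_def using V by blast
qed

lemma homeomorphism_boundary:
  fixes X :: "'a::euclidean_space set" and Y :: "'b::euclidean_space set"
  assumes h: "homeomorphism X Y f g"
  shows "boundary_points Y = f ` boundary_points X"
    and "one_manifold_with_boundary X \<Longrightarrow> one_manifold_with_boundary Y"
proof -
  have sub: "f ` boundary_points X \<subseteq> boundary_points Y"
    if h: "homeomorphism X Y f g" for X :: "'c::euclidean_space set" and Y :: "'d::euclidean_space set" and f g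
  proof
    fix y assume "y \<in> f ` boundary_points X"
    then obtain x U c where x: "x \<in> X" "x \<in> U" "half_line_chart X U c" "c x = 0" "y = f x"
      unfolding boundary_points_def by auto
    have "half_line_chart Y (f ` U) (c \<circ> g)" using homeomorphism_chart[OF h x(3)] .
    moreover have "(c \<circ> g) y = 0" "y \<in> f ` U" "y \<in> Y"
      using x homeomorphism_value[OF h x(1)] by auto
    ultimately show "y \<in> boundary_points Y" unfolding boundary_points_def by blast
  qed
  have "g ` boundary_points Y \<subseteq> boundary_points X" using sub homeomorphism_symD[OF h] .
  then have "f ` g ` boundary_points Y \<subseteq> f ` boundary_points X" by blast
  moreover have "f ` g ` boundary_points Y = boundary_points Y"
    using homeomorphism_cancel[OF homeomorphism_symD[OF h]] boundary_subset by blast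
  ultimately show "boundary_points Y = f ` boundary_points X" using sub[OF h] by blast
  assume M: "one_manifold_with_boundary X"
  show "one_manifold_with_boundary Y" unfolding one_manifold_with_boundary_def
  proof
    fix y assume y: "y \<in> Y"
    then have "g y \<in> X" "f (g y) = y" using homeomorphism_value[OF homeomorphism_symD[OF h] y] by auto
    moreover obtain U c where "g y \<in> U" "half_line_chart X U c"
      using M calculation(1) unfolding one_manifold_with_boundary_def by blast
    ultimately show "\<exists>U f. y \<in> U \<and> half_line_chart Y U f"
      using homeomorphism_chart[OF h] by (metis imageI)
  qed
qed

text \<open>The marked points in the order in which they lie on the boundary of the rectangle: along the top from left
to right, then along the bottom from right to left.\<close>

definition mark :: "nat \<Rightarrow> real \<Rightarrow> nat \<Rightarrow> real \<times> real" where
  "mark n a p = (if p \<le> n then (real p, a) else (real (2*n + 1 - p), 0))"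

lemma mark_image: "mark n a ` {1..2*n} = top_points n a \<union> bottom_points n"
proof -
  have "{1..2*n} = {1..n} \<union> (\<lambda>i. 2*n + 1 - i) ` {1..n}"
  proof
    show "{1..2*n} \<subseteq> {1..n} \<union> (\<lambda>i. 2*n + 1 - i) ` {1..n}"
    proof
      fix p assume "p \<in> {1..2*n}"
      then show "p \<in> {1..n} \<union> (\<lambda>i. 2*n + 1 - i) ` {1..n}"
        by (cases "p \<le> n") (auto intro!: image_eqI[of p _ "2*n + 1 - p"])
    qed
  qed auto
  then have "mark n a ` {1..2*n} = mark n a ` {1..n} \<union> (\<lambda>i. mark n a (2*n + 1 - i)) ` {1..n}"
    by (simp only: image_Un image_image)
  also have "mark n a ` {1..n} = top_points n a"
    unfolding top_points_def by (rule image_cong) (auto simp: mark_def)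
  also have "(\<lambda>i. mark n a (2*n + 1 - i)) ` {1..n} = bottom_points n"
    unfolding bottom_points_def by (rule image_cong) (auto simp: mark_def)
  finally show ?thesis .
qed

lemma mark_inj: "a \<noteq> 0 \<Longrightarrow> inj_on (mark n a) {1..2*n}"
  by (rule inj_onI) (auto simp: mark_def split: if_splits)

text \<open>Points that are not marked are fixed, as matchings require.\<close>

definition matching_of :: "nat \<Rightarrow> diagram \<Rightarrow> nat \<Rightarrow> nat" where
  "matching_of n X p = (if p \<in> {1..2*n}
    then THE q. q \<in> {1..2*n} \<and> q \<noteq> p \<and> connected_component (snd X) (mark n (fst X) p) (mark n (fst X) q)
    else p)"

definition circles :: "'a::topological_space set \<Rightarrow> 'a set set" where
  "circles D = {C \<in> components D. C \<inter> boundary_points D = {}}"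

definition circle_count :: "diagram \<Rightarrow> nat" where
  "circle_count X = card (circles (snd X))"

lemma diagramsD:
  assumes "(a, D) \<in> diagrams n"
  shows "a > 0" "D \<subseteq> R n a" "compact D" "one_manifold_with_boundary D" "finite (components D)"
    "D \<inter> R_top n a = top_points n a" "D \<inter> R_bottom n = bottom_points n"
    "boundary_points D = mark n a ` {1..2*n}"
  using assms unfolding diagrams_def mark_image by auto

text \<open>The component of a marked point has boundary points, but not exactly one of them.\<close>

lemma diagram_arc:
  assumes D: "(a, D) \<in> diagrams n" and p: "p \<in> {1..2*n}"
  obtains q g where "q \<in> {1..2*n}" "q \<noteq> p" "arc g" "pathstart g = mark n a p" "pathfinish g = mark n a q"
    "path_image g = connected_component_set D (mark n a p)"
    "boundary_points D \<inter> connected_component_set D (mark n a p) = {mark n a p, mark n a q}"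
proof -
  note d = diagramsD[OF D]
  define C where "C = connected_component_set D (mark n a p)"
  have bd: "mark n a p \<in> boundary_points D" using d(8) p by auto
  then have pD: "mark n a p \<in> D" using boundary_subset by blast
  then have C: "C \<in> components D" "mark n a p \<in> C" by (auto simp: C_def componentsI)
  note m = manifold_component[OF d(4) C(1)]
  have conn: "connected C" by (simp add: C_def)
  have comp: "compact C" using closedin_compact[OF d(3) closedin_component[OF C(1)]] .
  have pC: "mark n a p \<in> boundary_points C" using m(3) bd C by auto
  have "boundary_points C \<noteq> {mark n a p}" using not_one_boundary_point[OF m(2) conn comp] .
  then obtain y where y: "y \<in> boundary_points C" "y \<noteq> mark n a p" using pC by blast
  then obtain q where q: "q \<in> {1..2*n}" "y = mark n a q" using m(3) d(8) by auto
  obtain g where "arc g" "path_image g = C" "pathstart g = mark n a p" "pathfinish g = y" "boundary_points C = {mark n a p, y}"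
    using arc_component[OF m(2) conn pC y(1)] y(2) by metis
  then show thesis using that[of q g] q y m(3) by (auto simp: C_def)
qed

lemma matching_of_props:
  assumes D: "(a, D) \<in> diagrams n" and p: "p \<in> {1..2*n}"
  shows "matching_of n (a, D) p \<in> {1..2*n}" "matching_of n (a, D) p \<noteq> p"
    "connected_component D (mark n a p) (mark n a (matching_of n (a, D) p))"
    "q \<in> {1..2*n} \<Longrightarrow> q \<noteq> p \<Longrightarrow> connected_component D (mark n a p) (mark n a q) \<Longrightarrow> matching_of n (a, D) p = q"
proof -
  obtain r g where r: "r \<in> {1..2*n}" "r \<noteq> p" "arc g" "pathfinish g = mark n a r"
    "path_image g = connected_component_set D (mark n a p)"
    "boundary_points D \<inter> connected_component_set D (mark n a p) = {mark n a p, mark n a r}"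
    using diagram_arc[OF D p] by metis
  note d = diagramsD[OF D]
  have inj: "inj_on (mark n a) {1..2*n}" using mark_inj d(1) by simp
  have conn: "connected_component D (mark n a p) (mark n a r)" using r(6) by auto
  have uniq: "q = r" if "q \<in> {1..2*n}" "q \<noteq> p" "connected_component D (mark n a p) (mark n a q)" for q
  proof -
    have "mark n a q \<in> {mark n a p, mark n a r}" using that d(8) r(6) by auto
    then show ?thesis using inj_onD[OF inj] that r p by blast
  qed
  have "matching_of n (a, D) p = (THE q. q \<in> {1..2*n} \<and> q \<noteq> p \<and> connected_component D (mark n a p) (mark n a q))"
    using p by (simp add: matching_of_def)
  also have "\<dots> = r"
  proof (rule the_equality)
    show "r \<in> {1..2*n} \<and> r \<noteq> p \<and> connected_component D (mark n a p) (mark n a r)"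
      using r(1,2) conn by blast
  qed (use uniq in blast)
  finally have e: "matching_of n (a, D) p = r" .
  show "matching_of n (a, D) p \<in> {1..2*n}" "matching_of n (a, D) p \<noteq> p"
    "connected_component D (mark n a p) (mark n a (matching_of n (a, D) p))"
    using e r conn by auto
  show "q \<in> {1..2*n} \<Longrightarrow> q \<noteq> p \<Longrightarrow> connected_component D (mark n a p) (mark n a q) \<Longrightarrow> matching_of n (a, D) p = q"
    using e uniq by simp
qed

lemma matching_of_outside: "p \<notin> {1..2*n} \<Longrightarrow> matching_of n X p = p"
  unfolding matching_of_def by (rule if_not_P)

lemma matching_of_is_matching:
  assumes D: "(a, D) \<in> diagrams n"
  shows "matching n (matching_of n (a, D))"
proof -
  have "matching_of n (a, D) (matching_of n (a, D) p) = p" for p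
  proof (cases "p \<in> {1..2*n}")
    case True
    show ?thesis
      using matching_of_props(4)[OF D matching_of_props(1)[OF D True] True] matching_of_props(2,3)[OF D True]
        connected_component_sym by metis
  next
    case False
    then show ?thesis using matching_of_outside by metis
  qed
  then show ?thesis unfolding matching_def using matching_of_props(2)[OF D] matching_of_outside by blast
qed

lemma matching_of_arc:
  assumes D: "(a, D) \<in> diagrams n" and p: "p \<in> {1..2*n}"
  obtains g where "arc g" "pathstart g = mark n a p" "pathfinish g = mark n a (matching_of n (a, D) p)"
    "path_image g = connected_component_set D (mark n a p)"
    "boundary_points D \<inter> connected_component_set D (mark n a p) = {mark n a p, mark n a (matching_of n (a, D) p)}"
proof -
  obtain r g where r: "r \<in> {1..2*n}" "r \<noteq> p" "arc g" "pathstart g = mark n a p" "pathfinish g = mark n a r"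
    "path_image g = connected_component_set D (mark n a p)"
    "boundary_points D \<inter> connected_component_set D (mark n a p) = {mark n a p, mark n a r}"
    using diagram_arc[OF D p] by metis
  have "connected_component D (mark n a p) (mark n a r)" using r(7) by auto
  then have "matching_of n (a, D) p = r" using matching_of_props(4)[OF D p] r by blast
  then show thesis using that r by blast
qed

lemma circle_component:
  assumes D: "(a, D) \<in> diagrams n" and C: "C \<in> circles D"
  obtains g where "simple_path g" "pathfinish g = pathstart g" "path_image g = C"
proof -
  note d = diagramsD[OF D]
  have C': "C \<in> components D" "C \<inter> boundary_points D = {}" using C by (auto simp: circles_def)
  note m = manifold_component[OF d(4) C'(1)]
  have comp: "compact C" using closedin_compact[OF d(3) closedin_component[OF C'(1)]] .
  have "boundary_points C = {}" using m(3) C'(2) by blast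
  then show thesis
    using closed_manifold_is_circle[OF m(2) in_components_connected[OF C'(1)] comp in_components_nonempty[OF C'(1)]] that
    by metis
qed

definition threads :: "nat \<Rightarrow> diagram \<Rightarrow> (real \<times> real) set set" where
  "threads n X = (\<lambda>p. connected_component_set (snd X) (mark n (fst X) p)) ` {1..2*n}"

lemma components_split:
  assumes D: "(a, D) \<in> diagrams n"
  shows "components D = threads n (a, D) \<union> circles D" "threads n (a, D) \<inter> circles D = {}"
proof -
  note d = diagramsD[OF D]
  have P: "mark n a p \<in> D" if "p \<in> {1..2*n}" for p using d(8) boundary_subset that by blast
  show "components D = threads n (a, D) \<union> circles D"
  proof
    show "threads n (a, D) \<union> circles D \<subseteq> components D"
      using P by (auto simp: threads_def circles_def componentsI)
    show "components D \<subseteq> threads n (a, D) \<union> circles D"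
    proof
      fix C assume C: "C \<in> components D"
      show "C \<in> threads n (a, D) \<union> circles D"
      proof (cases "C \<inter> boundary_points D = {}")
        case False
        then obtain x where x: "x \<in> C" "x \<in> mark n a ` {1..2*n}" using d(8) by blast
        then obtain p where p: "p \<in> {1..2*n}" "mark n a p \<in> C" by blast
        then have "C = connected_component_set D (mark n a p)"
          using C by (metis connected_component_eq componentsE)
        then show ?thesis using p by (auto simp: threads_def)
      qed (use C in \<open>auto simp: circles_def\<close>)
    qed
  qed
  show "threads n (a, D) \<inter> circles D = {}"
  proof (rule ccontr)
    assume "threads n (a, D) \<inter> circles D \<noteq> {}"
    then obtain K where K: "K \<in> threads n (a, D)" "K \<in> circles D" by blast
    obtain p where p: "p \<in> {1..2*n}" "K = connected_component_set D (mark n a p)"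
      using K(1) by (auto simp: threads_def)
    have "K \<inter> boundary_points D = {}" using K(2) by (simp add: circles_def)
    moreover have "mark n a p \<in> K" using P[OF p(1)] p(2) by simp
    moreover have "mark n a p \<in> boundary_points D" using d(8) p(1) by blast
    ultimately show False by blast
  qed
qed

text \<open>Finitely many components are open and closed, so homeomorphisms chosen on each of them fit together.
The condition on \<open>S\<close> keeps track of the marked points.\<close>

lemma glue_component_homeomorphisms:
  fixes D :: "'a::t2_space set" and E :: "'b::t2_space set"
  assumes D: "compact D" "finite (components D)"
    and bij: "bij_betw \<phi> (components D) (components E)"
    and hom: "\<And>C. C \<in> components D \<Longrightarrow> \<exists>h k. homeomorphism C (\<phi> C) h k \<and> (\<forall>x\<in>C \<inter> S. h x = \<sigma> x)"
  obtains h k where "homeomorphism D E h k" "\<forall>x\<in>D \<inter> S. h x = \<sigma> x"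
proof -
  obtain H K where HK: "\<And>C. C \<in> components D \<Longrightarrow> homeomorphism C (\<phi> C) (H C) (K C) \<and> (\<forall>x\<in>C \<inter> S. H C x = \<sigma> x)"
    using hom by metis
  define h where "h x = H (connected_component_set D x) x" for x
  have cc: "connected_component_set D x = C" if "C \<in> components D" "x \<in> C" for x C
    using that by (metis connected_component_eq componentsE)
  have h: "h x = H C x" if "C \<in> components D" "x \<in> C" for x C
    using cc[OF that] by (simp add: h_def)
  have contC: "continuous_on C h" if "C \<in> components D" for C
    using HK[OF that] h[OF that] by (subst continuous_on_cong[OF HOL.refl, of _ _ "H C"]) (auto simp: homeomorphism_def)
  have clC: "closed C" if "C \<in> components D" for C
    using closedin_compact[OF D(1) closedin_component[OF that]] compact_imp_closed by blast
  have "continuous_on (\<Union>C\<in>components D. C) h"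
    by (rule continuous_on_closed_Union) (use D contC clC in auto)
  then have cont: "continuous_on D h" by (simp add: Union_components[symmetric])
  have imC: "h ` C = \<phi> C" if "C \<in> components D" for C
    using HK[OF that] h[OF that] by (simp add: homeomorphism_def)
  have "h ` D = (\<Union>C\<in>components D. h ` C)" by (metis Union_components image_Union)
  also have "\<dots> = (\<Union>C\<in>components D. \<phi> C)" using imC by simp
  also have "\<dots> = E" using bij by (metis Union_components bij_betw_def)
  finally have im: "h ` D = E" .
  have inj: "inj_on h D"
  proof (rule inj_onI)
    fix x y assume xy: "x \<in> D" "y \<in> D" "h x = h y"
    obtain C C' where C: "C \<in> components D" "x \<in> C" "C' \<in> components D" "y \<in> C'"
      using ex_component[OF xy(1)] ex_component[OF xy(2)] by blast
    have "h x \<in> \<phi> C" "h x \<in> \<phi> C'" using imC C xy by blast+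
    moreover have "\<phi> C \<in> components E" "\<phi> C' \<in> components E" using bij C by (auto simp: bij_betw_def)
    ultimately have "\<phi> C = \<phi> C'" using components_nonoverlap by blast
    then have "C = C'" using bij C by (auto simp: bij_betw_def inj_on_def)
    then show "x = y" using xy C h HK[OF C(1)] homeomorphism_inj_on by (metis inj_onD)
  qed
  obtain k where "homeomorphism D E h k" using homeomorphism_compact[OF D(1) cont im inj] by blast
  moreover have "h x = \<sigma> x" if "x \<in> D \<inter> S" for x
  proof -
    have "x \<in> D" using that by blast
    from ex_component[OF this] obtain C where C: "C \<in> components D" "x \<in> C" by blast
    then show ?thesis using HK[OF C(1)] h[OF C] that by auto
  qed
  ultimately show thesis using that by blast
qed

lemma diagram_rel_iff_pt:
  "((a, D), (b, E)) \<in> diagram_rel n \<longleftrightarrow> (a, D) \<in> diagrams n \<and> (b, E) \<in> diagrams n \<and>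
    (\<exists>g g'. homeomorphism D E g g' \<and> (\<forall>p\<in>{1..2*n}. g (mark n a p) = mark n b p))"
proof -
  have "(\<forall>i\<in>{1..n}. g (real i, 0) = (real i, 0) \<and> g (real i, a) = (real i, b)) \<longleftrightarrow>
    (\<forall>p\<in>{1..2*n}. g (mark n a p) = mark n b p)" (is "?L \<longleftrightarrow> ?R") for g
  proof
    assume L: ?L
    show ?R
    proof
      fix p assume p: "p \<in> {1..2*n}"
      then have "p \<in> {1..n} \<or> (p > n \<and> 2*n + 1 - p \<in> {1..n})" by auto
      then show "g (mark n a p) = mark n b p" using L unfolding mark_def by auto
    qed
  next
    assume R: ?R
    show ?L
    proof
      fix i assume i: "i \<in> {1..n}"
      then have "i \<in> {1..2*n}" "2*n + 1 - i \<in> {1..2*n}" by auto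
      then have "g (mark n a i) = mark n b i" "g (mark n a (2*n + 1 - i)) = mark n b (2*n + 1 - i)" using R by blast+
      then show "g (real i, 0) = (real i, 0) \<and> g (real i, a) = (real i, b)"
        using i by (auto simp: mark_def split: if_splits)
    qed
  qed
  then show ?thesis unfolding diagram_rel_def by simp
qed

text \<open>The threads of the two diagrams correspond by their end points, and equally many circles correspond in some way.
Corresponding threads are parametrised by arcs that start at corresponding marked points, and any two
simple closed curves are homeomorphic.\<close>

lemma invariants_imp_diagram_rel:
  assumes D: "(a, D) \<in> diagrams n" and E: "(b, E) \<in> diagrams n"
    and matching_of: "matching_of n (a, D) = matching_of n (b, E)" and circle_count: "circle_count (a, D) = circle_count (b, E)"
  shows "((a, D), (b, E)) \<in> diagram_rel n"
proof -
  note d = diagramsD[OF D] and e = diagramsD[OF E]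
  note sD = components_split[OF D] and sE = components_split[OF E]
  define f where "f = matching_of n (a, D)"
  let ?cD = "\<lambda>p. connected_component_set D (mark n a p)"
  let ?cE = "\<lambda>p. connected_component_set E (mark n b p)"
  have same: "?cD p = ?cD q \<longleftrightarrow> q = p \<or> q = f p" if "p \<in> {1..2*n}" "q \<in> {1..2*n}" for p q
  proof -
    have qD: "mark n a q \<in> D" using d(8) boundary_subset that by blast
    then have "?cD p = ?cD q \<longleftrightarrow> connected_component D (mark n a p) (mark n a q)"
      by (rule connected_component_set_eq_iff)
    then show ?thesis using matching_of_props(3)[OF D that(1)] matching_of_props(4)[OF D that] f_def connected_component_refl[OF qD] by metis
  qed
  have sameE: "?cE p = ?cE q \<longleftrightarrow> q = p \<or> q = f p" if "p \<in> {1..2*n}" "q \<in> {1..2*n}" for p q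
  proof -
    have qE: "mark n b q \<in> E" using e(8) boundary_subset that by blast
    then have "?cE p = ?cE q \<longleftrightarrow> connected_component E (mark n b p) (mark n b q)"
      by (rule connected_component_set_eq_iff)
    then show ?thesis using matching_of_props(3)[OF E that(1)] matching_of_props(4)[OF E that] f_def matching_of connected_component_refl[OF qE] by metis
  qed
  define r where "r C = (SOME p. p \<in> {1..2*n} \<and> C = ?cD p)" for C
  have r: "r C \<in> {1..2*n} \<and> C = ?cD (r C)" if "C \<in> threads n (a, D)" for C
    unfolding r_def by (rule someI_ex) (use that in \<open>auto simp: threads_def\<close>)
  have b1: "bij_betw (\<lambda>C. ?cE (r C)) (threads n (a, D)) (threads n (b, E))"
    unfolding bij_betw_def
  proof
    show "inj_on (\<lambda>C. ?cE (r C)) (threads n (a, D))"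
    proof (rule inj_onI)
      fix C C' assume C: "C \<in> threads n (a, D)" "C' \<in> threads n (a, D)" "?cE (r C) = ?cE (r C')"
      then have "?cD (r C) = ?cD (r C')"
        using same[of "r C" "r C'"] sameE[of "r C" "r C'"] r[OF C(1)] r[OF C(2)] by blast
      then show "C = C'" using r[OF C(1)] r[OF C(2)] by metis
    qed
    show "(\<lambda>C. ?cE (r C)) ` threads n (a, D) = threads n (b, E)"
    proof
      show "(\<lambda>C. ?cE (r C)) ` threads n (a, D) \<subseteq> threads n (b, E)"
        using r by (auto simp: threads_def)
      show "threads n (b, E) \<subseteq> (\<lambda>C. ?cE (r C)) ` threads n (a, D)"
      proof
        fix K assume "K \<in> threads n (b, E)"
        then obtain p where p: "p \<in> {1..2*n}" "K = ?cE p" by (auto simp: threads_def)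
        have C: "?cD p \<in> threads n (a, D)" using p by (auto simp: threads_def)
        then have "?cD p = ?cD (r (?cD p))" "r (?cD p) \<in> {1..2*n}" using r by blast+
        then have "?cE p = ?cE (r (?cD p))" using same sameE p(1) by blast
        then show "K \<in> (\<lambda>C. ?cE (r C)) ` threads n (a, D)" using C p(2) by blast
      qed
    qed
  qed
  have fin: "finite (circles D)" "finite (circles E)" using d(5) e(5) by (auto simp: circles_def)
  obtain \<psi> where b2: "bij_betw \<psi> (circles D) (circles E)"
    using finite_same_card_bij[OF fin] circle_count by (auto simp: circle_count_def)
  define \<phi> where "\<phi> C = (if C \<in> threads n (a, D) then ?cE (r C) else \<psi> C)" for C
  have "bij_betw \<phi> (threads n (a, D)) (threads n (b, E))"
    using b1 by (rule bij_betw_cong[THEN iffD1, rotated]) (simp add: \<phi>_def)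
  moreover have "bij_betw \<phi> (circles D) (circles E)"
    using b2 by (rule bij_betw_cong[THEN iffD1, rotated]) (use sD(2) in \<open>auto simp: \<phi>_def\<close>)
  ultimately have b: "bij_betw \<phi> (components D) (components E)"
    unfolding sD(1) sE(1) using sE(2) by (rule bij_betw_combine)
  \<comment> \<open>The prescribed values on the marked points.\<close>
  define \<sigma> where "\<sigma> x = mark n b (the_inv_into {1..2*n} (mark n a) x)" for x
  have \<sigma>: "\<sigma> (mark n a p) = mark n b p" if "p \<in> {1..2*n}" for p
    using the_inv_into_f_f[OF mark_inj that] d(1) by (simp add: \<sigma>_def)
  have "\<exists>h k. homeomorphism C (\<phi> C) h k \<and> (\<forall>x\<in>C \<inter> boundary_points D. h x = \<sigma> x)" if C: "C \<in> components D" for C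
  proof (cases "C \<in> threads n (a, D)")
    case True
    define p where "p = r C"
    have p: "p \<in> {1..2*n}" "C = ?cD p" "\<phi> C = ?cE p" using r[OF True] True by (auto simp: p_def \<phi>_def)
    obtain g where g: "arc g" "pathstart g = mark n a p" "pathfinish g = mark n a (f p)" "path_image g = C"
      "boundary_points D \<inter> C = {mark n a p, mark n a (f p)}"
      using matching_of_arc[OF D p(1)] p(2) f_def by metis
    obtain g' where g': "arc g'" "pathstart g' = mark n b p" "pathfinish g' = mark n b (f p)" "path_image g' = \<phi> C"
      using matching_of_arc[OF E p(1)] p(3) f_def matching_of by metis
    obtain h where h: "homeomorphism {0..1} C g h" using homeomorphism_arc[OF g(1)] g(4) by metis
    obtain h' where h': "homeomorphism {0..1} (\<phi> C) g' h'" using homeomorphism_arc[OF g'(1)] g'(4) by metis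
    have "homeomorphism C (\<phi> C) (g' \<circ> h) (g \<circ> h')"
      using homeomorphism_compose[OF homeomorphism_symD[OF h] h'] .
    moreover have "h (mark n a p) = 0" "h (mark n a (f p)) = 1"
      using homeomorphism_apply1[OF h, of 0] homeomorphism_apply1[OF h, of 1] g(2,3)
      by (auto simp: pathstart_def pathfinish_def)
    then have "(g' \<circ> h) (mark n a p) = mark n b p" "(g' \<circ> h) (mark n a (f p)) = mark n b (f p)"
      using g' by (auto simp: pathstart_def pathfinish_def)
    moreover have fp: "f p \<in> {1..2*n}" using matching_of_props(1)[OF D p(1)] f_def by simp
    have "(g' \<circ> h) x = \<sigma> x" if "x \<in> C \<inter> boundary_points D" for x
    proof -
      have "x = mark n a p \<or> x = mark n a (f p)" using that g(5) by blast
      then show ?thesis using \<sigma>[OF p(1)] \<sigma>[OF fp] \<open>(g' \<circ> h) (mark n a p) = mark n b p\<close>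
          \<open>(g' \<circ> h) (mark n a (f p)) = mark n b (f p)\<close> by metis
    qed
    ultimately show ?thesis by blast
  next
    case False
    then have Cc: "C \<in> circles D" using C sD by blast
    then have "\<phi> C \<in> circles E" using b2 False by (auto simp: \<phi>_def bij_betw_def)
    then obtain g' where g': "simple_path g'" "pathfinish g' = pathstart g'" "path_image g' = \<phi> C"
      using circle_component[OF E] by metis
    obtain g where g: "simple_path g" "pathfinish g = pathstart g" "path_image g = C"
      using circle_component[OF D Cc] by metis
    have "C homeomorphic \<phi> C" using homeomorphic_simple_path_images[OF g(1,2) g'(1,2)] g(3) g'(3) by simp
    then show ?thesis using Cc unfolding homeomorphic_def circles_def by auto
  qed
  then obtain h k where hk: "homeomorphism D E h k" "\<forall>x\<in>D \<inter> boundary_points D. h x = \<sigma> x"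
    using glue_component_homeomorphisms[OF d(3,5) b, of "boundary_points D" \<sigma>] by metis
  have "h (mark n a p) = mark n b p" if "p \<in> {1..2*n}" for p
  proof -
    have "mark n a p \<in> D \<inter> boundary_points D" using that d(8) boundary_subset by blast
    then show ?thesis using hk(2) \<sigma>[OF that] by simp
  qed
  then show ?thesis unfolding diagram_rel_iff_pt using D E hk(1) by blast
qed

lemma card_circles_homeomorphism:
  fixes D :: "'a::euclidean_space set" and E :: "'b::euclidean_space set"
  assumes h: "homeomorphism D E g g'"
  shows "card (circles E) = card (circles D)"
proof -
  have bd: "boundary_points E = g ` boundary_points D" using homeomorphism_boundary(1)[OF h] .
  have inj: "inj_on g D" using homeomorphism_inj_on[OF h] by simp
  have dj: "g ` C \<inter> g ` boundary_points D = {} \<longleftrightarrow> C \<inter> boundary_points D = {}" if "C \<in> components D" for C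
    using inj_on_image_Int[OF inj in_components_subset[OF that] boundary_subset] by (metis image_is_empty)
  have "circles E = (`) g ` circles D"
    unfolding circles_def homeomorphism_components[OF h] bd using dj by blast
  moreover have "inj_on ((`) g) (circles D)"
  proof (rule inj_onI)
    fix A B assume "A \<in> circles D" "B \<in> circles D" "g ` A = g ` B"
    then show "A = B" using inj_on_image_eq_iff[OF inj, of A B] in_components_subset[of A D] in_components_subset[of B D]
      unfolding circles_def by simp
  qed
  ultimately show ?thesis by (simp add: card_image)
qed

lemma diagram_rel_imp_invariants:
  assumes "((a, D), (b, E)) \<in> diagram_rel n"
  shows "matching_of n (a, D) = matching_of n (b, E)" "circle_count (a, D) = circle_count (b, E)"
proof -
  obtain g g' where D: "(a, D) \<in> diagrams n" and E: "(b, E) \<in> diagrams n"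
    and h: "homeomorphism D E g g'" and pts: "\<And>p. p \<in> {1..2*n} \<Longrightarrow> g (mark n a p) = mark n b p"
    using assms unfolding diagram_rel_iff_pt by blast
  have c: "continuous_on D g" "g ` D \<subseteq> E" using h by (auto simp: homeomorphism_def)
  show "matching_of n (a, D) = matching_of n (b, E)"
  proof
    fix p
    show "matching_of n (a, D) p = matching_of n (b, E) p"
    proof (cases "p \<in> {1..2*n}")
      case True
      note m = matching_of_props(1,2,3)[OF D True]
      have "connected_component E (g (mark n a p)) (g (mark n a (matching_of n (a, D) p)))"
        using connected_component_image[OF c m(3)] .
      then have "connected_component E (mark n b p) (mark n b (matching_of n (a, D) p))" using pts True m(1) by simp
      then show ?thesis using matching_of_props(4)[OF E True m(1,2)] by simp
    next
      case False
      then show ?thesis using matching_of_outside by metis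
    qed
  qed
  show "circle_count (a, D) = circle_count (b, E)" using card_circles_homeomorphism[OF h] by (simp add: circle_count_def)
qed

lemma diagram_rel_iff:
  "(X, Y) \<in> diagram_rel n \<longleftrightarrow> X \<in> diagrams n \<and> Y \<in> diagrams n \<and> matching_of n X = matching_of n Y \<and> circle_count X = circle_count Y"
proof (cases X, cases Y)
  fix a D b E assume "X = (a, D)" "Y = (b, E)"
  then show ?thesis
    using diagram_rel_imp_invariants[of a D b E n] invariants_imp_diagram_rel[of a D n b E]
    by (auto simp: diagram_rel_def)
qed

lemma equiv_diagram_rel: "equiv (diagrams n) (diagram_rel n)"
  by (rule equivI) (auto simp: refl_on_def sym_def trans_def diagram_rel_iff)


section \<open>Composition of diagrams\<close>

lemma finite_components_Un:
  assumes "finite (components A)" "finite (components B)"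
  shows "finite (components (A \<union> B))"
proof -
  have "components (A \<union> B) \<subseteq> (\<lambda>C. connected_component_set (A \<union> B) (SOME x. x \<in> C)) ` (components A \<union> components B)"
  proof
    fix K assume K: "K \<in> components (A \<union> B)"
    obtain x where x: "x \<in> K" using in_components_nonempty[OF K] by blast
    then have "x \<in> A \<or> x \<in> B" using in_components_subset[OF K] by blast
    then obtain C where C: "C \<in> components A \<union> components B" "x \<in> C"
      using ex_component[of x A] ex_component[of x B] by blast
    have "connected C" "C \<subseteq> A \<union> B" using C(1) in_components_connected in_components_subset by blast+
    then have CK: "C \<subseteq> K" using components_maximal[OF K, of C] C(2) x by blast
    define y where "y = (SOME x. x \<in> C)"
    have "y \<in> C" unfolding y_def using C(2) by (rule someI)
    then have "K = connected_component_set (A \<union> B) y"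
      using CK K by (metis connected_component_eq componentsE subsetD)
    then show "K \<in> (\<lambda>C. connected_component_set (A \<union> B) (SOME x. x \<in> C)) ` (components A \<union> components B)"
      using C(1) y_def by blast
  qed
  then show ?thesis using assms by (meson finite_Un finite_imageI finite_subset)
qed

lemma clopen_component:
  assumes "connected K" "K \<noteq> {}" "closedin (top_of_set X) K" "openin (top_of_set X) K"
  shows "K \<in> components X"
proof -
  obtain x where x: "x \<in> K" using assms by blast
  define C where "C = connected_component_set X x"
  have KX: "K \<subseteq> X" using openin_imp_subset[OF assms(4)] .
  have CX: "C \<subseteq> X" by (simp add: C_def connected_component_subset)
  have "K \<subseteq> C" unfolding C_def using connected_component_maximal[OF x assms(1) KX] .
  moreover have "openin (top_of_set C) (C \<inter> K)" using openin_Int_subset[OF assms(4) CX] .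
  moreover have "closedin (top_of_set C) (C \<inter> K)"
    using closedin_closed_subset[OF assms(3) CX] by (simp add: Int_commute)
  moreover have "connected C" by (simp add: C_def)
  ultimately have "C \<inter> K = C" unfolding connected_clopen using x by blast
  then have "K = C" using \<open>K \<subseteq> C\<close> by blast
  then show ?thesis using x KX by (auto simp: C_def componentsI)
qed

lemma finite_component_open:
  assumes "finite (components A)" "C \<in> components A"
  shows "closedin (top_of_set A) (A - C)"
proof -
  have "A - C = \<Union> (components A - {C})"
  proof
    show "A - C \<subseteq> \<Union> (components A - {C})" using ex_component by fastforce
    show "\<Union> (components A - {C}) \<subseteq> A - C"
      using components_nonoverlap[OF _ assms(2)] in_components_subset by blast
  qed
  moreover have "closedin (top_of_set A) (\<Union> (components A - {C}))"
    by (rule closedin_Union) (use assms closedin_component in auto)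
  ultimately show ?thesis by simp
qed

text \<open>The two pieces meet the other set only in each other, so their union is open and closed. One of
them may be empty, in which case a component of one set that avoids the other set is meant.\<close>

lemma component_Un:
  fixes A B :: "'a::t2_space set"
  assumes A: "compact A" "finite (components A)" and B: "compact B" "finite (components B)"
    and C1: "C1 \<in> components A \<or> C1 = {}" and C2: "C2 \<in> components B \<or> C2 = {}"
    and sub: "C1 \<inter> B \<subseteq> C2" "C2 \<inter> A \<subseteq> C1" and conn: "connected (C1 \<union> C2)" "C1 \<union> C2 \<noteq> {}"
  shows "C1 \<union> C2 \<in> components (A \<union> B)"
proof -
  have cl: "closed C \<and> closed (D - C) \<and> C \<subseteq> D" if "C \<in> components D \<or> C = {}" "compact D" "finite (components D)" for C D :: "'a set"
  proof (cases "C = {}")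
    case True then show ?thesis using that(2) compact_imp_closed by auto
  next
    case False
    then have C: "C \<in> components D" using that(1) by blast
    show ?thesis
      using closedin_compact[OF that(2) closedin_component[OF C]] closedin_compact[OF that(2) finite_component_open[OF that(3) C]]
        compact_imp_closed in_components_subset[OF C] by blast
  qed
  note cA = cl[OF C1 A] and cB = cl[OF C2 B]
  have "closed (C1 \<union> C2)" using cA cB by auto
  moreover have s: "C1 \<union> C2 \<subseteq> A \<union> B" using cA cB by blast
  ultimately have c: "closedin (top_of_set (A \<union> B)) (C1 \<union> C2)" by (simp add: closed_subset)
  have "(A \<union> B) - (C1 \<union> C2) = (A - C1) \<union> (B - C2)" using sub by blast
  moreover have "closed ((A - C1) \<union> (B - C2))" using cA cB by auto
  ultimately have "closed ((A \<union> B) - (C1 \<union> C2))" by simp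
  then have "closedin (top_of_set (A \<union> B)) ((A \<union> B) - (C1 \<union> C2))" by (rule closed_subset[rotated]) blast
  then have "openin (top_of_set (A \<union> B)) (C1 \<union> C2)" using s by (subst openin_closedin_eq) simp
  then show ?thesis using clopen_component[OF conn c] by blast
qed

lemma components_Un_avoiding:
  fixes A B :: "'a::t2_space set"
  assumes A: "compact A" "finite (components A)" and B: "compact B" "finite (components B)"
  shows "{K \<in> components (A \<union> B). K \<inter> (A \<inter> B) = {}} =
    {K \<in> components A. K \<inter> (A \<inter> B) = {}} \<union> {K \<in> components B. K \<inter> (A \<inter> B) = {}}"
proof -
  have "K \<in> components (A \<union> B)" if "K \<in> components A" "K \<inter> (A \<inter> B) = {}" for K
  proof -
    have "K \<union> {} \<in> components (A \<union> B)"
      by (rule component_Un[OF A B]) (use that in_components_connected in_components_nonempty in_components_subset in fastforce)+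
    then show ?thesis by simp
  qed
  moreover have "K \<in> components (A \<union> B)" if "K \<in> components B" "K \<inter> (A \<inter> B) = {}" for K
  proof -
    have "{} \<union> K \<in> components (A \<union> B)"
      by (rule component_Un[OF A B]) (use that in_components_connected in_components_nonempty in_components_subset in fastforce)+
    then show ?thesis by simp
  qed
  moreover have "K \<in> components A \<or> K \<in> components B" if K: "K \<in> components (A \<union> B)" "K \<inter> (A \<inter> B) = {}" for K
  proof -
    have KU: "K \<subseteq> A \<union> B" "K \<noteq> {}" "connected K"
      using in_components_subset[OF K(1)] in_components_nonempty[OF K(1)] in_components_connected[OF K(1)] by auto
    have "A \<inter> B \<inter> K = {}" using K(2) by blast
    then have "A \<inter> K = {} \<or> B \<inter> K = {}"
      using connected_closed[of K] KU A B compact_imp_closed by metis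
    then have "K \<subseteq> A \<or> K \<subseteq> B" using KU by blast
    moreover have "K \<in> components D" if "K \<subseteq> D" "D \<subseteq> A \<union> B" for D
    proof -
      obtain x where x: "x \<in> K" using KU by blast
      have "K \<subseteq> connected_component_set D x" using connected_component_maximal[OF x KU(3) that(1)] .
      moreover have "connected_component_set D x \<subseteq> K"
        using components_maximal[OF K(1), of "connected_component_set D x"] x that connected_component_subset[of D x]
        by (metis IntI calculation connected_connected_component dual_order.trans empty_iff subsetD)
      ultimately show ?thesis using x that(1) by (metis componentsI subset_antisym subsetD)
    qed
    ultimately show ?thesis by blast
  qed
  ultimately show ?thesis by blast
qed

abbreviation shift :: "real \<Rightarrow> real \<times> real \<Rightarrow> real \<times> real" where
  "shift b \<equiv> (\<lambda>(x, y). (x, y + b))"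

lemma shift_homeomorphism: "homeomorphism D (shift b ` D) (shift b) (shift (- b))"
proof -
  have e: "shift c = (\<lambda>p. (fst p, snd p + c))" for c by (auto simp: fun_eq_iff)
  show ?thesis unfolding homeomorphism_def e
    by (auto intro!: continuous_intros simp: image_image)
qed

text \<open>\<open>U\<close> is the upper and \<open>L\<close> the lower of the two diagrams that are composed; \<open>A\<close> is the upper one moved to its
place, and \<open>S\<close> consists of the points at which the two meet.\<close>

locale composition =
  fixes n :: nat and a b :: real and U L :: "(real \<times> real) set"
  assumes U: "(a, U) \<in> diagrams n" and L: "(b, L) \<in> diagrams n"
begin

definition A where "A = shift b ` U"

lemma dcomp_eq: "dcomp (b, L) (a, U) = (a + b, A \<union> L)"
  by (simp add: A_def)

lemma mark_top: "p \<le> n \<Longrightarrow> mark n (a + b) p = shift b (mark n a p)"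
  by (simp add: mark_def)

lemma mark_bottom: "p > n \<Longrightarrow> mark n (a + b) p = mark n b p"
  by (simp add: mark_def)

lemma mark_middle: "1 \<le> q \<Longrightarrow> q \<le> n \<Longrightarrow> mark n b q = shift b (mark n a (2*n + 1 - q))"
  by (auto simp: mark_def)

definition S where "S = mark n b ` {1..n}"

lemma S_eq: "S = top_points n b" "S = shift b ` bottom_points n"
proof -
  show "S = top_points n b" unfolding S_def top_points_def by (rule image_cong) (auto simp: mark_def)
  then show "S = shift b ` bottom_points n" by (simp add: top_points_def bottom_points_def image_image)
qed

lemma A_facts: "compact A" "one_manifold_with_boundary A" "finite (components A)"
  "boundary_points A = shift b ` mark n a ` {1..2*n}" "A \<subseteq> {0..real n + 1} \<times> {b..a + b}"
proof -
  note u = diagramsD[OF U] and h = shift_homeomorphism[of U b]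
  have "continuous_on U (shift b)" using h by (simp add: homeomorphism_def)
  then show "compact A" unfolding A_def using u(3) by (rule compact_continuous_image)
  show "one_manifold_with_boundary A" using homeomorphism_boundary(2)[OF h u(4)] by (simp add: A_def)
  show "finite (components A)" using homeomorphism_components[OF h] u(5) by (simp add: A_def)
  show "boundary_points A = shift b ` mark n a ` {1..2*n}"
    using homeomorphism_boundary(1)[OF h] u(8) by (simp add: A_def)
  show "A \<subseteq> {0..real n + 1} \<times> {b..a + b}" using u(2) by (auto simp: A_def R_def)
qed

lemma S_Int: "A \<inter> L = S"
proof -
  note u = diagramsD[OF U] and l = diagramsD[OF L]
  show ?thesis
  proof
    have "bottom_points n \<subseteq> U" "top_points n b \<subseteq> L" using u(7) l(6) by blast+
    then show "S \<subseteq> A \<inter> L" using S_eq image_mono[of "bottom_points n" U "shift b"] by (simp add: A_def)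
    show "A \<inter> L \<subseteq> S"
    proof
      fix z assume z: "z \<in> A \<inter> L"
      then have "z \<in> {0..real n + 1} \<times> {b..a + b}" "z \<in> R n b" using A_facts(5) l(2) by auto
      then have "z \<in> R_top n b" by (auto simp: R_def R_top_def)
      then show "z \<in> S" using z l(6) S_eq(1) by blast
    qed
  qed
qed

lemma glue:
  "one_manifold_with_boundary (A \<union> L)" "boundary_points (A \<union> L) = mark n (a + b) ` {1..2*n}"
  "boundary_points A = S \<union> mark n (a + b) ` {1..n}" "boundary_points L = S \<union> mark n (a + b) ` {n+1..2*n}"
proof -
  note u = diagramsD[OF U] and l = diagramsD[OF L]
  have split: "{1..2*n} = {1..n} \<union> {n+1..2*n}" by auto
  have "shift b ` mark n a ` {1..n} = mark n (a + b) ` {1..n}"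
    unfolding image_image by (rule image_cong) (auto simp: mark_top)
  moreover have "shift b ` mark n a ` {n+1..2*n} = S"
  proof -
    have "{n+1..2*n} = (\<lambda>q. 2*n + 1 - q) ` {1..n}"
    proof
      show "{n+1..2*n} \<subseteq> (\<lambda>q. 2*n + 1 - q) ` {1..n}"
      proof
        fix p assume "p \<in> {n+1..2*n}"
        then show "p \<in> (\<lambda>q. 2*n + 1 - q) ` {1..n}" by (intro image_eqI[of _ _ "2*n + 1 - p"]) auto
      qed
    qed auto
    then have "shift b ` mark n a ` {n+1..2*n} = (\<lambda>q. shift b (mark n a (2*n + 1 - q))) ` {1..n}"
      by (simp only: image_image)
    also have "\<dots> = S" unfolding S_def by (rule image_cong) (auto simp: mark_middle)
    finally show ?thesis .
  qed
  ultimately show bA: "boundary_points A = S \<union> mark n (a + b) ` {1..n}"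
    unfolding A_facts(4) split image_Un by blast
  have "mark n b ` {n+1..2*n} = mark n (a + b) ` {n+1..2*n}"
    by (rule image_cong) (auto simp: mark_bottom)
  then show bL: "boundary_points L = S \<union> mark n (a + b) ` {n+1..2*n}"
    unfolding l(8) split image_Un S_def by blast
  have cl: "closed A" "closed L" using A_facts(1) l(3) compact_imp_closed by auto
  have "A \<inter> L \<subseteq> boundary_points A \<inter> boundary_points L" unfolding S_Int using bA bL by blast
  note g = glue_manifolds[OF cl _ A_facts(2) l(4) this]
  have fin: "finite (A \<inter> L)" unfolding S_Int by (simp add: S_def)
  show "one_manifold_with_boundary (A \<union> L)" using g fin by blast
  have "mark n (a + b) p \<notin> S" if "p \<in> {1..2*n}" for p
    using that u(1) l(1) by (auto simp: S_def mark_def)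
  then have "mark n (a + b) ` {1..2*n} \<inter> S = {}" by blast
  then show "boundary_points (A \<union> L) = mark n (a + b) ` {1..2*n}"
    unfolding g(2)[OF fin] bA bL S_Int unfolding split image_Un by blast
qed

lemma dcomp_diagram: "(a + b, A \<union> L) \<in> diagrams n"
proof -
  note u = diagramsD[OF U] and l = diagramsD[OF L]
  have sub: "A \<union> L \<subseteq> R n (a + b)" using A_facts(5) l(1,2) u(1) by (auto simp: R_def)
  have comp: "compact (A \<union> L)" using A_facts(1) l(3) by auto
  have fin: "finite (components (A \<union> L))" using finite_components_Un[OF A_facts(3) l(5)] .
  have "L \<inter> R_top n (a + b) = {}" using l(2) u(1) by (auto simp: R_def R_top_def)
  moreover have "A \<inter> R_top n (a + b) = top_points n (a + b)"
  proof -
    have "A \<inter> R_top n (a + b) = shift b ` (U \<inter> R_top n a)" by (auto simp: A_def R_top_def)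
    then show ?thesis unfolding u(6) by (auto simp: top_points_def image_image)
  qed
  ultimately have top: "(A \<union> L) \<inter> R_top n (a + b) = top_points n (a + b)" by blast
  have "A \<inter> R_bottom n = {}" using A_facts(5) l(1) by (auto simp: R_bottom_def)
  then have bot: "(A \<union> L) \<inter> R_bottom n = bottom_points n" using l(7) by blast
  show ?thesis unfolding diagrams_def
    using u(1) l(1) sub comp fin top bot glue(1,2) mark_image by auto
qed

lemma conn_lower: "connected_component L x y \<Longrightarrow> connected_component (A \<union> L) x y"
  using connected_component_of_subset by blast

lemma conn_upper: "connected_component U x y \<Longrightarrow> connected_component (A \<union> L) (shift b x) (shift b y)"
proof -
  have "continuous_on U (shift b)" using shift_homeomorphism[of U b] by (simp add: homeomorphism_def)
  then show "connected_component U x y \<Longrightarrow> connected_component (A \<union> L) (shift b x) (shift b y)"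
    by (rule connected_component_image) (auto simp: A_def)
qed

text \<open>In a diagram each marked point is connected to only one other marked point, so to determine the matching of
a composite it is enough to find connections.\<close>

lemma matching_of_dcomp_I:
  assumes "p \<in> {1..2*n}" "q \<in> {1..2*n}" "q \<noteq> p" "connected_component (A \<union> L) (mark n (a + b) p) (mark n (a + b) q)"
  shows "matching_of n (dcomp (b, L) (a, U)) p = q"
  unfolding dcomp_eq using matching_of_props(4)[OF dcomp_diagram] assms by blast

lemma mark_in: "p \<in> {1..2*n} \<Longrightarrow> mark n (a + b) p \<in> A \<union> L"
  using glue(2) boundary_subset by blast

lemma id_matching_conn:
  assumes "matching_of n (c, D) = id_matching n" "(c, D) \<in> diagrams n" "p \<in> {1..2*n}"
  shows "connected_component D (mark n c p) (mark n c (2*n + 1 - p))"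
  using matching_of_props(3)[OF assms(2,3)] assms(1,3) by (simp add: id_matching_def)

lemma matching_of_dcomp_upper_identity:
  assumes "matching_of n (a, U) = id_matching n"
  shows "matching_of n (dcomp (b, L) (a, U)) = matching_of n (b, L)"
    and "p \<in> {1..2*n} \<Longrightarrow> connected_component (A \<union> L) (mark n (a + b) p) (mark n b p)"
proof -
  show link: "connected_component (A \<union> L) (mark n (a + b) p) (mark n b p)" if p: "p \<in> {1..2*n}" for p
  proof (cases "p \<le> n")
    case True
    then show ?thesis using conn_upper[OF id_matching_conn[OF assms U p]] p mark_top mark_middle by simp
  next
    case False
    then show ?thesis using mark_bottom[of p] mark_in[OF p] by simp
  qed
  show "matching_of n (dcomp (b, L) (a, U)) = matching_of n (b, L)"
  proof
    fix p
    show "matching_of n (dcomp (b, L) (a, U)) p = matching_of n (b, L) p"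
    proof (cases "p \<in> {1..2*n}")
      case True
      note m = matching_of_props(1,2,3)[OF L True]
      have "connected_component (A \<union> L) (mark n (a + b) p) (mark n (a + b) (matching_of n (b, L) p))"
        using connected_component_trans[OF connected_component_trans[OF link[OF True] conn_lower[OF m(3)]]
            connected_component_sym[OF link[OF m(1)]]] .
      then show ?thesis using matching_of_dcomp_I True m by blast
    next
      case False
      then show ?thesis using matching_of_outside by metis
    qed
  qed
qed

lemma matching_of_dcomp_lower_identity:
  assumes "matching_of n (b, L) = id_matching n"
  shows "matching_of n (dcomp (b, L) (a, U)) = matching_of n (a, U)"
    and "p \<in> {1..2*n} \<Longrightarrow> connected_component (A \<union> L) (mark n (a + b) p) (shift b (mark n a p))"
proof -
  show link: "connected_component (A \<union> L) (mark n (a + b) p) (shift b (mark n a p))" if p: "p \<in> {1..2*n}" for p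
  proof (cases "p \<le> n")
    case True
    then show ?thesis using mark_in[OF p] mark_top by simp
  next
    case False
    then have "mark n b (2*n + 1 - p) = shift b (mark n a p)" using mark_middle[of "2*n + 1 - p"] p by simp
    then show ?thesis using conn_lower[OF id_matching_conn[OF assms L p]] mark_bottom[of p] False by simp
  qed
  show "matching_of n (dcomp (b, L) (a, U)) = matching_of n (a, U)"
  proof
    fix p
    show "matching_of n (dcomp (b, L) (a, U)) p = matching_of n (a, U) p"
    proof (cases "p \<in> {1..2*n}")
      case True
      note m = matching_of_props(1,2,3)[OF U True]
      have "connected_component (A \<union> L) (mark n (a + b) p) (mark n (a + b) (matching_of n (a, U) p))"
        using connected_component_trans[OF connected_component_trans[OF link[OF True] conn_upper[OF m(3)]]
            connected_component_sym[OF link[OF m(1)]]] .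
      then show ?thesis using matching_of_dcomp_I True m by blast
    next
      case False
      then show ?thesis using matching_of_outside by metis
    qed
  qed
qed

definition new_circles where
  "new_circles = {K \<in> components (A \<union> L). K \<inter> S \<noteq> {} \<and> K \<inter> mark n (a + b) ` {1..2*n} = {}}"

text \<open>A component of the composite that avoids \<open>S\<close> is a component of one of the two diagrams.
Circles of the diagrams avoid \<open>S\<close>, which consists of boundary points; the other circles of the composite pass through \<open>S\<close>.\<close>

lemma circle_count_dcomp: "circle_count (dcomp (b, L) (a, U)) = circle_count (b, L) + circle_count (a, U) + card new_circles"
proof -
  note u = diagramsD[OF U] and l = diagramsD[OF L] and h = shift_homeomorphism[of U b]
  note g = glue
  have split: "{1..2*n} = {1..n} \<union> {n+1..2*n}" by auto
  define P where "P = mark n (a + b) ` {1..2*n}"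
  have bd: "boundary_points A = S \<union> mark n (a + b) ` {1..n}" "boundary_points L = S \<union> mark n (a + b) ` {n+1..2*n}"
    "P = mark n (a + b) ` {1..n} \<union> mark n (a + b) ` {n+1..2*n}"
    using g unfolding P_def split image_Un by auto
  have PS: "P \<inter> S = {}" using u(1) l(1) by (auto simp: P_def S_def mark_def)
  have av: "{K \<in> components (A \<union> L). K \<inter> S = {}} = {K \<in> components A. K \<inter> S = {}} \<union> {K \<in> components L. K \<inter> S = {}}"
    using components_Un_avoiding[OF A_facts(1,3) l(3,5)] unfolding S_Int .
  have PA: "P \<inter> A \<subseteq> boundary_points A"
  proof
    fix x assume x: "x \<in> P \<inter> A"
    then have "x \<notin> L" using PS S_Int by blast
    then have "x \<notin> boundary_points L" using boundary_subset by blast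
    then show "x \<in> boundary_points A" using x bd by blast
  qed
  have PL: "P \<inter> L \<subseteq> boundary_points L"
  proof
    fix x assume x: "x \<in> P \<inter> L"
    then have "x \<notin> A" using PS S_Int by blast
    then have "x \<notin> boundary_points A" using boundary_subset by blast
    then show "x \<in> boundary_points L" using x bd by blast
  qed
  have cA: "K \<inter> S = {} \<and> K \<inter> P = {} \<longleftrightarrow> K \<inter> boundary_points A = {}" if "K \<in> components A" for K
  proof -
    have "K \<inter> P \<subseteq> boundary_points A" "S \<subseteq> boundary_points A" "boundary_points A \<subseteq> S \<union> P"
      using in_components_subset[OF that] PA bd by auto
    then show ?thesis by blast
  qed
  have cL: "K \<inter> S = {} \<and> K \<inter> P = {} \<longleftrightarrow> K \<inter> boundary_points L = {}" if "K \<in> components L" for K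
  proof -
    have "K \<inter> P \<subseteq> boundary_points L" "S \<subseteq> boundary_points L" "boundary_points L \<subseteq> S \<union> P"
      using in_components_subset[OF that] PL bd by auto
    then show ?thesis by blast
  qed
  have "circles (A \<union> L) = {K \<in> components (A \<union> L). K \<inter> S = {} \<and> K \<inter> P = {}} \<union> new_circles"
    unfolding circles_def new_circles_def g(2) P_def by blast
  moreover have "{K \<in> components (A \<union> L). K \<inter> S = {} \<and> K \<inter> P = {}} = circles A \<union> circles L"
  proof -
    have "{K \<in> components (A \<union> L). K \<inter> S = {} \<and> K \<inter> P = {}} =
      {K \<in> components A. K \<inter> S = {} \<and> K \<inter> P = {}} \<union> {K \<in> components L. K \<inter> S = {} \<and> K \<inter> P = {}}"
      using av by blast
    moreover have "{K \<in> components A. K \<inter> S = {} \<and> K \<inter> P = {}} = circles A"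
      "{K \<in> components L. K \<inter> S = {} \<and> K \<inter> P = {}} = circles L"
      unfolding circles_def using cA cL by (auto cong: conj_cong)
    ultimately show ?thesis by simp
  qed
  ultimately have C: "circles (A \<union> L) = circles A \<union> circles L \<union> new_circles" by simp
  have "K \<inter> S = {}" if "K \<in> circles A \<union> circles L" for K using that bd unfolding circles_def by blast
  then have d1: "(circles A \<union> circles L) \<inter> new_circles = {}" unfolding new_circles_def by blast
  have d2: "circles A \<inter> circles L = {}"
  proof (rule ccontr)
    assume "circles A \<inter> circles L \<noteq> {}"
    then obtain K where K: "K \<in> circles A" "K \<in> circles L" by blast
    then have "K \<noteq> {}" "K \<subseteq> A \<inter> L" "K \<inter> boundary_points A = {}"
      using in_components_nonempty in_components_subset unfolding circles_def by blast+
    then show False using S_Int bd by blast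
  qed
  have fin: "finite (circles A)" "finite (circles L)" "finite new_circles"
    using A_facts(3) l(5) finite_components_Un[OF A_facts(3) l(5)] by (auto simp: circles_def new_circles_def)
  have "card (circles A) = circle_count (a, U)"
    using card_circles_homeomorphism[OF h] by (simp add: circle_count_def A_def)
  moreover have "card (circles (A \<union> L)) = card (circles A) + card (circles L) + card new_circles"
    unfolding C using d1 d2 fin by (simp add: card_Un_disjoint)
  ultimately show ?thesis unfolding dcomp_eq by (simp add: circle_count_def)
qed

lemma new_circles_empty:
  assumes "\<And>q. q \<in> {1..n} \<Longrightarrow> \<exists>p\<in>{1..2*n}. connected_component (A \<union> L) (mark n b q) (mark n (a + b) p)"
  shows "new_circles = {}"
proof (rule ccontr)
  assume "new_circles \<noteq> {}"
  then obtain K q where K: "K \<in> components (A \<union> L)" "q \<in> {1..n}" "mark n b q \<in> K" "K \<inter> mark n (a + b) ` {1..2*n} = {}"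
    unfolding new_circles_def S_def by blast
  obtain p where p: "p \<in> {1..2*n}" "connected_component (A \<union> L) (mark n b q) (mark n (a + b) p)"
    using assms[OF K(2)] by blast
  have "K = connected_component_set (A \<union> L) (mark n b q)"
    using K(1,3) by (metis connected_component_eq componentsE)
  then have "mark n (a + b) p \<in> K" using p(2) by simp
  then show False using K(4) p(1) by blast
qed

lemma circle_count_dcomp_upper_identity:
  assumes "matching_of n (a, U) = id_matching n"
  shows "circle_count (dcomp (b, L) (a, U)) = circle_count (b, L) + circle_count (a, U)"
proof -
  have "\<exists>p\<in>{1..2*n}. connected_component (A \<union> L) (mark n b q) (mark n (a + b) p)" if q: "q \<in> {1..n}" for q
  proof -
    have "q \<in> {1..2*n}" using q by simp
    then show ?thesis using matching_of_dcomp_upper_identity(2)[OF assms] connected_component_sym by blast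
  qed
  then show ?thesis using circle_count_dcomp new_circles_empty by simp
qed

lemma circle_count_dcomp_lower_identity:
  assumes "matching_of n (b, L) = id_matching n"
  shows "circle_count (dcomp (b, L) (a, U)) = circle_count (b, L) + circle_count (a, U)"
proof -
  have "\<exists>p\<in>{1..2*n}. connected_component (A \<union> L) (mark n b q) (mark n (a + b) p)" if q: "q \<in> {1..n}" for q
  proof -
    have p: "2*n + 1 - q \<in> {1..2*n}" using q by auto
    have "connected_component (A \<union> L) (mark n (a + b) (2*n + 1 - q)) (mark n b q)"
      using matching_of_dcomp_lower_identity(2)[OF assms p] mark_middle[of q] q by simp
    then show ?thesis using p connected_component_sym by blast
  qed
  then show ?thesis using circle_count_dcomp new_circles_empty by simp
qed

text \<open>The threads of $H^i$ continue those of the lower diagram, except that its cap joins the ends at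
\<open>i\<close> and \<open>i + 1\<close>, and its cup joins the new points \<open>i\<close> and \<open>i + 1\<close>. A new circle has to pass through the cap, since any
other point of \<open>S\<close> is connected with the top. It closes up iff the cap joins the two ends of one thread.\<close>

lemma dcomp_act:
  assumes i: "1 \<le> i" "i < n" and mtU: "matching_of n (a, U) = act i (id_matching n)"
  shows "matching_of n (dcomp (b, L) (a, U)) = act i (matching_of n (b, L))"
    and "circle_count (dcomp (b, L) (a, U)) = circle_count (b, L) + circle_count (a, U) + loops i (matching_of n (b, L))"
proof -
  define f where "f = matching_of n (b, L)"
  let ?X = "A \<union> L"
  have f: "matching n f" unfolding f_def by (rule matching_of_is_matching[OF L])
  have ff: "f (f p) = p" for p using f by (simp add: matching_def)
  have fne: "f p \<noteq> p" if "p \<in> {1..2*n}" for p using f that by (simp add: matching_def)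
  have id_matching: "id_matching n i = 2*n + 1 - i" "id_matching n (Suc i) = 2*n - i" using i by (auto simp: id_matching_def)
  have h: "act i (id_matching n) i = Suc i" "act i (id_matching n) (2*n - i) = 2*n + 1 - i"
    using i id_matching by (auto simp: act_def)
  have hq: "act i (id_matching n) q = 2*n + 1 - q" if "q \<in> {1..n}" "q \<noteq> i" "q \<noteq> Suc i" for q
    using i id_matching that by (auto simp: act_def id_matching_def)
  have U3: "connected_component U (mark n a p) (mark n a (act i (id_matching n) p))" if "p \<in> {1..2*n}" for p
    using matching_of_props(3)[OF U that] mtU by simp
  have cup: "connected_component ?X (mark n (a + b) i) (mark n (a + b) (Suc i))"
    using conn_upper[OF U3[of i]] h(1) i mark_top[of i] mark_top[of "Suc i"] by simp
  have cap: "connected_component ?X (mark n b (Suc i)) (mark n b i)"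
    using conn_upper[OF U3[of "2*n - i"]] h(2) i mark_middle[of i] mark_middle[of "Suc i"] by simp
  have link: "connected_component ?X (mark n (a + b) q) (mark n b q)" if "q \<in> {1..2*n}" "q \<noteq> i" "q \<noteq> Suc i" for q
  proof (cases "q \<le> n")
    case True
    then show ?thesis using conn_upper[OF U3[of q]] hq[of q] that mark_top[of q] mark_middle[of q] by simp
  next
    case False
    then show ?thesis using mark_bottom[of q] mark_in[of q] that by simp
  qed
  have low: "connected_component ?X (mark n b p) (mark n b (f p))" if "p \<in> {1..2*n}" for p
    using conn_lower matching_of_props(3)[OF L that] f_def by simp
  note sym = connected_component_sym and tr = connected_component_trans
  have ir: "i \<in> {1..2*n}" "Suc i \<in> {1..2*n}" using i by auto
  have fr: "f p \<in> {1..2*n}" if "p \<in> {1..2*n}" for p using matching_range[OF f that] .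
  have main: "connected_component ?X (mark n (a + b) p) (mark n (a + b) (act i f p))" if p: "p \<in> {1..2*n}" for p
  proof -
    consider "p = i" | "p = Suc i" | "p \<noteq> i" "p \<noteq> Suc i" "f p = i" | "p \<noteq> i" "p \<noteq> Suc i" "f p = Suc i"
      | "p \<noteq> i" "p \<noteq> Suc i" "f p \<noteq> i" "f p \<noteq> Suc i" by blast
    then show ?thesis
    proof cases
      case 1
      have "f (Suc i) = i \<Longrightarrow> f i = Suc i" using ff by metis
      then have "act i f i = Suc i" using fne[OF ir(1)] fne[OF ir(2)] by (auto simp: act_def)
      then show ?thesis using 1 cup by simp
    next
      case 2
      have "f i = Suc i \<Longrightarrow> f (Suc i) = i" using ff by metis
      then have "act i f (Suc i) = i" using fne[OF ir(1)] fne[OF ir(2)] unfolding act_def fun_upd_apply by force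
      then show ?thesis using 2 cup sym by metis
    next
      case 3
      then have fi: "f i = p" using ff by metis
      have ne: "f (Suc i) \<noteq> i" "f (Suc i) \<noteq> Suc i" using 3 ff fi fne[OF ir(2)] by metis+
      have a: "act i f p = f (Suc i)" using 3 fi ne ff by (auto simp: act_def)
      have "connected_component ?X (mark n (a + b) p) (mark n b i)"
        using tr[OF link[OF p 3(1,2)] low[OF p]] 3 by simp
      then have "connected_component ?X (mark n (a + b) p) (mark n b (f (Suc i)))"
        using tr[OF tr[OF _ sym[OF cap]] low[OF ir(2)]] by blast
      then show ?thesis using tr sym[OF link[OF fr[OF ir(2)] ne]] a by metis
    next
      case 4
      then have fi: "f (Suc i) = p" using ff by metis
      have ne: "f i \<noteq> i" "f i \<noteq> Suc i" using 4 ff fi fne[OF ir(1)] by metis+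
      have a: "act i f p = f i" using 4 fi ne ff by (auto simp: act_def)
      have "connected_component ?X (mark n (a + b) p) (mark n b (Suc i))"
        using tr[OF link[OF p 4(1,2)] low[OF p]] 4 by simp
      then have "connected_component ?X (mark n (a + b) p) (mark n b (f i))"
        using tr[OF tr[OF _ cap] low[OF ir(1)]] by blast
      then show ?thesis using tr sym[OF link[OF fr[OF ir(1)] ne]] a by metis
    next
      case 5
      have "p \<noteq> f i" "p \<noteq> f (Suc i)" using 5 ff by metis+
      then have a: "act i f p = f p" using 5 by (auto simp: act_def)
      have "connected_component ?X (mark n (a + b) p) (mark n b (f p))"
        using tr[OF link[OF p 5(1,2)] low[OF p]] .
      then show ?thesis using tr sym[OF link[OF fr[OF p] 5(3,4)]] a by metis
    qed
  qed
  have M: "matching n (act i f)" using matching_act[OF f] i by simp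
  show "matching_of n (dcomp (b, L) (a, U)) = act i (matching_of n (b, L))"
  proof
    fix p
    show "matching_of n (dcomp (b, L) (a, U)) p = act i (matching_of n (b, L)) p"
    proof (cases "p \<in> {1..2*n}")
      case True
      have "act i f p \<noteq> p" using M True by (simp add: matching_def)
      then show ?thesis using matching_of_dcomp_I[OF True matching_range[OF M True] _ main[OF True]] f_def by simp
    next
      case False
      then have "act i f p = p" using M by (simp add: matching_def)
      then show ?thesis using False matching_of_outside f_def by metis
    qed
  qed
  have "card new_circles = loops i f"
  proof (cases "f i = Suc i")
    case False
    have fin: "f i \<noteq> i" "f i \<noteq> Suc i" using False fne[OF ir(1)] by auto
    have toi: "connected_component ?X (mark n b i) (mark n (a + b) (f i))"
      using tr[OF low[OF ir(1)] sym[OF link[OF fr[OF ir(1)] fin]]] .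
    have "new_circles = {}"
    proof (rule new_circles_empty)
      fix q assume q: "q \<in> {1..n}"
      then have q2: "q \<in> {1..2*n}" by simp
      consider "q = i" | "q = Suc i" | "q \<noteq> i" "q \<noteq> Suc i" by blast
      then show "\<exists>p\<in>{1..2*n}. connected_component ?X (mark n b q) (mark n (a + b) p)"
      proof cases
        case 1 then show ?thesis using toi fr[OF ir(1)] by blast
      next
        case 2 then show ?thesis using tr[OF cap toi] fr[OF ir(1)] by blast
      next
        case 3 then show ?thesis using sym[OF link[OF q2]] q2 by blast
      qed
    qed
    then show ?thesis using False by (simp add: loops_def)
  next
    case True
    \<comment> \<open>The new circle is made of the thread \<open>C2\<close> of the lower diagram and the cap \<open>C1\<close>.\<close>
    define C2 where "C2 = connected_component_set L (mark n b i)"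
    define c where "c = connected_component_set U (mark n a (2*n + 1 - i))"
    define C1 where "C1 = shift b ` c"
    have ir': "2*n + 1 - i \<in> {1..2*n}" using i by auto
    note u = diagramsD[OF U] and l = diagramsD[OF L] and hs = shift_homeomorphism[of U b]
    have fi: "act i (id_matching n) (2*n + 1 - i) = 2*n - i" using i id_matching by (auto simp: act_def)
    have b2: "boundary_points L \<inter> C2 = {mark n b i, mark n b (Suc i)}"
      using matching_of_arc[OF L ir(1)] True f_def unfolding C2_def by metis
    have bc: "boundary_points U \<inter> c = {mark n a (2*n + 1 - i), mark n a (2*n - i)}"
      using matching_of_arc[OF U ir'] mtU fi unfolding c_def by metis
    have cU: "c \<subseteq> U" by (simp add: c_def connected_component_subset)
    have "boundary_points A \<inter> C1 = shift b ` (boundary_points U \<inter> c)"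
      unfolding C1_def A_def homeomorphism_boundary(1)[OF hs]
      using inj_on_image_Int[of "shift b" U "boundary_points U" c] homeomorphism_inj_on[OF hs] boundary_subset cU by blast
    then have b1: "boundary_points A \<inter> C1 = {mark n b i, mark n b (Suc i)}"
      unfolding bc using i mark_middle[of i] mark_middle[of "Suc i"] by simp
    have iL: "mark n b i \<in> L" using l(8) boundary_subset ir(1) by blast
    have c2: "C2 \<in> components L" using iL by (simp add: C2_def componentsI)
    have "mark n a (2*n + 1 - i) \<in> U" using u(8) boundary_subset ir' by blast
    then have "c \<in> components U" by (simp add: c_def componentsI)
    then have c1: "C1 \<in> components A" using homeomorphism_components[OF hs] by (simp add: C1_def A_def)
    have sub: "C1 \<subseteq> A" "C2 \<subseteq> L" using c1 c2 in_components_subset by auto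
    have SA: "S \<subseteq> boundary_points A" "S \<subseteq> boundary_points L" using glue by auto
    have K: "C1 \<union> C2 \<in> components ?X"
    proof (rule component_Un[OF A_facts(1,3) l(3,5)])
      show "C1 \<inter> L \<subseteq> C2" "C2 \<inter> A \<subseteq> C1" using sub S_Int SA b1 b2 by blast+
      show "connected (C1 \<union> C2)"
        by (rule connected_Un) (use in_components_connected[OF c1] in_components_connected[OF c2] b1 b2 in blast)+
      show "C1 \<union> C2 \<noteq> {}" using b2 by blast
    qed (use c1 c2 in auto)
    have PS: "mark n (a + b) ` {1..2*n} \<inter> S = {}" using u(1) l(1) by (auto simp: S_def mark_def)
    have split: "{1..2*n} = {1..n} \<union> {n+1..2*n}" by auto
    have PB: "mark n (a + b) ` {1..2*n} \<subseteq> boundary_points A \<union> boundary_points L"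
      unfolding glue(3,4) split image_Un by blast
    have iS: "mark n b i \<in> S" "mark n b (Suc i) \<in> S" using i by (auto simp: S_def)
    have KP: "(C1 \<union> C2) \<inter> mark n (a + b) ` {1..2*n} = {}"
    proof (rule ccontr)
      assume "(C1 \<union> C2) \<inter> mark n (a + b) ` {1..2*n} \<noteq> {}"
      then obtain x where x: "x \<in> C1 \<union> C2" "x \<in> mark n (a + b) ` {1..2*n}" by blast
      then have xS: "x \<notin> S" using PS by blast
      have bs: "boundary_points A \<subseteq> A" "boundary_points L \<subseteq> L" by (rule boundary_subset)+
      have "x \<in> boundary_points A \<inter> C1 \<or> x \<in> boundary_points L \<inter> C2"
        using x PB sub bs S_Int xS by blast
      then have "x \<in> {mark n b i, mark n b (Suc i)}" unfolding b1 b2 by simp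
      then have "x \<in> S" using iS by auto
      then show False using xS by simp
    qed
    have "new_circles = {C1 \<union> C2}"
    proof
      show "{C1 \<union> C2} \<subseteq> new_circles" using K KP iS(1) b2 by (auto simp: new_circles_def)
      show "new_circles \<subseteq> {C1 \<union> C2}"
      proof
        fix M assume "M \<in> new_circles"
        then obtain q where q: "M \<in> components ?X" "q \<in> {1..n}" "mark n b q \<in> M" "M \<inter> mark n (a + b) ` {1..2*n} = {}"
          unfolding new_circles_def S_def by blast
        have Mq: "M = connected_component_set ?X (mark n b q)"
          using q(1,3) by (metis connected_component_eq componentsE)
        have q2: "q \<in> {1..2*n}" using q(2) by simp
        have "q = i \<or> q = Suc i"
        proof (rule ccontr)
          assume "\<not> (q = i \<or> q = Suc i)"
          then have "mark n (a + b) q \<in> M" using sym[OF link[OF q2]] Mq by simp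
          then show False using q(4) q2 by blast
        qed
        then have "mark n b q \<in> C1 \<union> C2" using b2 by auto
        then have "M = C1 \<union> C2" using components_nonoverlap[OF q(1) K] q(3) by blast
        then show "M \<in> {C1 \<union> C2}" by simp
      qed
    qed
    then show ?thesis using True by (simp add: loops_def)
  qed
  then show "circle_count (dcomp (b, L) (a, U)) = circle_count (b, L) + circle_count (a, U) + loops i (matching_of n (b, L))"
    using circle_count_dcomp f_def by simp
qed

end

lemma dcomp_in_diagrams: "X \<in> diagrams n \<Longrightarrow> Y \<in> diagrams n \<Longrightarrow> dcomp X Y \<in> diagrams n"
proof (cases X, cases Y)
  fix b L a U assume "X \<in> diagrams n" "Y \<in> diagrams n" "X = (b, L)" "Y = (a, U)"
  then interpret composition n a b U L by unfold_locales auto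
  show ?thesis using dcomp_diagram dcomp_eq \<open>X = (b, L)\<close> \<open>Y = (a, U)\<close> by simp
qed

lemma glue_homeomorphisms:
  fixes A B :: "'a::t2_space set" and A' B' :: "'b::t2_space set"
  assumes "compact A" "compact B" and f: "homeomorphism A A' f f'" and g: "homeomorphism B B' g g'"
    and eq: "\<And>x. x \<in> A \<inter> B \<Longrightarrow> f x = g x" and im: "A' \<inter> B' \<subseteq> f ` (A \<inter> B)"
  obtains h k where "homeomorphism (A \<union> B) (A' \<union> B') h k" "\<And>x. x \<in> A \<Longrightarrow> h x = f x" "\<And>x. x \<in> B \<Longrightarrow> h x = g x"
proof -
  define h where "h x = (if x \<in> A then f x else g x)" for x
  have hA: "h x = f x" if "x \<in> A" for x using that by (simp add: h_def)
  have hB: "h x = g x" if "x \<in> B" for x using that eq by (simp add: h_def)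
  have cl: "closed A" "closed B" using assms(1,2) compact_imp_closed by auto
  have "continuous_on A h" using f hA by (subst continuous_on_cong[OF HOL.refl, of _ _ f]) (auto simp: homeomorphism_def)
  moreover have "continuous_on B h" using g hB by (subst continuous_on_cong[OF HOL.refl, of _ _ g]) (auto simp: homeomorphism_def)
  ultimately have c: "continuous_on (A \<union> B) h" using cl by (simp add: continuous_on_closed_Un)
  have "h ` A = A'" "h ` B = B'" using f g hA hB by (auto simp: homeomorphism_def)
  then have i: "h ` (A \<union> B) = A' \<union> B'" by (simp add: image_Un)
  have injA: "x = y" if "x \<in> A" "y \<in> A" "h x = h y" for x y
    using homeomorphism_inj_on[OF f] that hA by (metis inj_onD)
  have injB: "x = y" if "x \<in> B" "y \<in> B" "h x = h y" for x y
    using homeomorphism_inj_on[OF g] that hB by (metis inj_onD)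
  have mix: "x = y" if "x \<in> A" "y \<in> B" "h x = h y" for x y
  proof -
    have "h x \<in> A' \<inter> B'" using that \<open>h ` A = A'\<close> \<open>h ` B = B'\<close> by (metis IntI imageI)
    then obtain z where z: "z \<in> A \<inter> B" "h x = f z" using im by blast
    then have "h x = h z" using hA by simp
    then show ?thesis using injA[of x z] injB[of z y] that z by auto
  qed
  have "inj_on h (A \<union> B)"
  proof (rule inj_onI)
    fix x y assume "x \<in> A \<union> B" "y \<in> A \<union> B" "h x = h y"
    then show "x = y" using injA injB mix[of x y] mix[of y x] by auto
  qed
  then obtain k where "homeomorphism (A \<union> B) (A' \<union> B') h k"
    using homeomorphism_compact[of "A \<union> B" h, OF _ c i] assms(1,2) by auto
  then show thesis using that hA hB by blast
qed

text \<open>The given homeomorphisms, the upper one shifted, agree on the finitely many points where the two diagrams meet.\<close>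

lemma dcomp_cong:
  assumes "(X, X') \<in> diagram_rel n" "(Y, Y') \<in> diagram_rel n"
  shows "(dcomp X Y, dcomp X' Y') \<in> diagram_rel n"
proof -
  obtain b L b' L' a U a' U' where e: "X = (b, L)" "X' = (b', L')" "Y = (a, U)" "Y' = (a', U')"
    by (metis prod.collapse)
  obtain g g' where L: "(b, L) \<in> diagrams n" "(b', L') \<in> diagrams n" and g: "homeomorphism L L' g g'"
    and gp: "\<And>p. p \<in> {1..2*n} \<Longrightarrow> g (mark n b p) = mark n b' p"
    using assms(1) unfolding e diagram_rel_iff_pt by blast
  obtain f f' where U: "(a, U) \<in> diagrams n" "(a', U') \<in> diagrams n" and f: "homeomorphism U U' f f'"
    and fp: "\<And>p. p \<in> {1..2*n} \<Longrightarrow> f (mark n a p) = mark n a' p"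
    using assms(2) unfolding e diagram_rel_iff_pt by blast
  interpret c: composition n a b U L using U L by unfold_locales
  interpret c': composition n a' b' U' L' using U L by unfold_locales
  define F where "F = shift b' \<circ> f \<circ> shift (- b)"
  have F: "homeomorphism c.A c'.A F (shift b \<circ> f' \<circ> shift (- b'))"
    unfolding c.A_def c'.A_def F_def
    using homeomorphism_compose[OF homeomorphism_compose[OF homeomorphism_symD[OF shift_homeomorphism] f] shift_homeomorphism]
    by (simp add: comp_assoc)
  have Fs: "F (shift b z) = shift b' (f z)" for z by (cases z) (simp add: F_def)
  have Fg: "F (mark n b q) = mark n b' q" "g (mark n b q) = mark n b' q" if "q \<in> {1..n}" for q
  proof -
    have r: "2*n + 1 - q \<in> {1..2*n}" "q \<in> {1..2*n}" using that by auto
    show "F (mark n b q) = mark n b' q"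
      using c.mark_middle[of q] c'.mark_middle[of q] Fs[of "mark n a (2*n + 1 - q)"] fp[OF r(1)] that by simp
    show "g (mark n b q) = mark n b' q" using gp r by blast
  qed
  have "F x = g x" if "x \<in> c.A \<inter> L" for x
    using that Fg unfolding c.S_Int c.S_def by auto
  moreover have "c'.A \<inter> L' \<subseteq> F ` (c.A \<inter> L)"
    unfolding c.S_Int c.S_def c'.S_Int c'.S_def using Fg(1) by (auto simp: image_image)
  ultimately obtain h k where h: "homeomorphism (c.A \<union> L) (c'.A \<union> L') h k"
    "\<And>x. x \<in> c.A \<Longrightarrow> h x = F x" "\<And>x. x \<in> L \<Longrightarrow> h x = g x"
    using glue_homeomorphisms[OF c.A_facts(1) diagramsD(3)[OF L(1)] F g] by metis
  have "h (mark n (a + b) p) = mark n (a' + b') p" if p: "p \<in> {1..2*n}" for p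
  proof (cases "p \<le> n")
    case True
    have "mark n a p \<in> U" using diagramsD(8)[OF U(1)] boundary_subset p by blast
    then have "mark n (a + b) p \<in> c.A" using c.mark_top[OF True] by (simp add: c.A_def)
    then show ?thesis using h(2) c.mark_top[OF True] c'.mark_top[OF True] Fs fp[OF p] by simp
  next
    case False
    have "mark n b p \<in> L" using diagramsD(8)[OF L(1)] boundary_subset p by blast
    then show ?thesis using h(3) c.mark_bottom[of p] c'.mark_bottom[of p] gp[OF p] False by simp
  qed
  then show ?thesis
    unfolding e c.dcomp_eq c'.dcomp_eq diagram_rel_iff_pt using c.dcomp_diagram c'.dcomp_diagram h(1) by blast
qed

lemma dcomp_assoc: "dcomp (dcomp X Y) Z = dcomp X (dcomp Y Z)"
proof -
  obtain a A b B c C where "X = (a, A)" "Y = (b, B)" "Z = (c, C)" by (metis prod.collapse)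
  moreover have "shift (b + a) ` C = shift a ` shift b ` C" by (force simp: image_image add.assoc)
  ultimately show ?thesis by (simp add: image_Un Un_assoc add.assoc add.commute)
qed


section \<open>Threads do not cross\<close>

text \<open>Outside the rectangle, marked points are joined to the line at height \<open>-1\<close>: bottom points straight down,
top points by nested hooks which go up, then to the right beyond the rectangle, and then down. The ends are
then at \<open>extension_x n k\<close>, in the reverse of the order of the numbers \<open>k\<close>, and all
marked points are on one line, which reduces the different positions of crossing threads to a single one.\<close>

definition extension_x :: "nat \<Rightarrow> nat \<Rightarrow> real" where
  "extension_x n k = (if k \<le> n then 2 * real n + 2 - real k else 2 * real n + 1 - real k)"

definition extension_h :: "nat \<Rightarrow> real \<Rightarrow> nat \<Rightarrow> real" where
  "extension_h n a k = a + real n + 1 - real k"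

definition extension :: "nat \<Rightarrow> real \<Rightarrow> nat \<Rightarrow> real \<Rightarrow> real \<times> real" where
  "extension n a k = (if k \<le> n
    then linepath (extension_x n k, -1) (extension_x n k, extension_h n a k) +++
      (linepath (extension_x n k, extension_h n a k) (real k, extension_h n a k) +++ linepath (real k, extension_h n a k) (real k, a))
    else linepath (extension_x n k, -1) (extension_x n k, 0))"

lemma extension_path:
  assumes "k \<in> {1..2*n}"
  shows "path (extension n a k)" "pathstart (extension n a k) = (extension_x n k, -1)" "pathfinish (extension n a k) = mark n a k"
  using assms by (auto simp: extension_def mark_def extension_x_def)

lemma extension_image:
  assumes "k \<in> {1..2*n}" "a > 0"
  shows "path_image (extension n a k) = (if k \<le> n
    then {extension_x n k} \<times> {-1..extension_h n a k} \<union> {real k..extension_x n k} \<times> {extension_h n a k} \<union> {real k} \<times> {a..extension_h n a k}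
    else {extension_x n k} \<times> {-1..0})"
proof (cases "k \<le> n")
  case True
  have "path_image (extension n a k) = closed_segment (extension_x n k, -1) (extension_x n k, extension_h n a k) \<union>
      (closed_segment (extension_x n k, extension_h n a k) (real k, extension_h n a k) \<union> closed_segment (real k, extension_h n a k) (real k, a))"
    using True by (simp add: extension_def path_image_join)
  also have "\<dots> = {extension_x n k} \<times> closed_segment (-1) (extension_h n a k) \<union>
      (closed_segment (extension_x n k) (real k) \<times> {extension_h n a k} \<union> {real k} \<times> closed_segment (extension_h n a k) a)"
    by (simp add: closed_segment_same_fst closed_segment_same_snd)
  also have "\<dots> = {extension_x n k} \<times> {-1..extension_h n a k} \<union> {real k..extension_x n k} \<times> {extension_h n a k} \<union> {real k} \<times> {a..extension_h n a k}"
    using True assms by (simp add: closed_segment_eq_real_ivl extension_x_def extension_h_def Un_assoc)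
  finally show ?thesis using True by simp
next
  case False
  then have "path_image (extension n a k) = closed_segment (extension_x n k, -1) (extension_x n k, 0)"
    by (simp add: extension_def)
  also have "\<dots> = {extension_x n k} \<times> {-1..0}"
    by (simp add: closed_segment_same_fst closed_segment_eq_real_ivl)
  finally show ?thesis using False by simp
qed

lemma extension_x_less: "k < l \<Longrightarrow> extension_x n l < extension_x n k"
  by (auto simp: extension_x_def)

lemma extension_disjoint_less:
  assumes "k \<in> {1..2*n}" "l \<in> {1..2*n}" "k < l" "a > 0"
  shows "path_image (extension n a k) \<inter> path_image (extension n a l) = {}"
proof -
  have "False" if z: "(x, y) \<in> path_image (extension n a k)" "(x, y) \<in> path_image (extension n a l)" for x y
  proof (cases "l \<le> n")
    case True
    then show False using z assms unfolding extension_image[OF assms(1,4)] extension_image[OF assms(2,4)]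
      by (auto simp: extension_x_def extension_h_def split: if_splits)
  next
    case False
    then show False using z assms unfolding extension_image[OF assms(1,4)] extension_image[OF assms(2,4)]
      by (auto simp: extension_x_def extension_h_def split: if_splits)
  qed
  then show ?thesis by auto
qed

lemma extension_disjoint:
  assumes "k \<in> {1..2*n}" "l \<in> {1..2*n}" "k \<noteq> l" "a > 0"
  shows "path_image (extension n a k) \<inter> path_image (extension n a l) = {}"
  using extension_disjoint_less assms by (metis Int_commute linorder_neqE_nat)

lemma extension_R:
  assumes "k \<in> {1..2*n}" "a > 0"
  shows "path_image (extension n a k) \<inter> R n a \<subseteq> {mark n a k}"
proof -
  have "z = mark n a k" if "z \<in> path_image (extension n a k)" "z \<in> R n a" for z
    using that assms unfolding extension_image[OF assms] R_def
    by (auto simp: extension_x_def extension_h_def mark_def split: if_splits)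
  then show ?thesis by blast
qed

lemma extension_box:
  assumes "k \<in> {1..2*n}" "a > 0"
  shows "path_image (extension n a k) \<subseteq> {0..2 * real n + 2} \<times> {-1..a + real n + 1}"
  unfolding extension_image[OF assms] using assms by (auto simp: extension_x_def extension_h_def split: if_splits)

definition vec2 :: "real \<times> real \<Rightarrow> real ^ 2" where
  "vec2 z = (\<chi> i. if i = 1 then fst z else snd z)"

lemma vec2_nth [simp]: "vec2 z $ 1 = fst z" "vec2 z $ 2 = snd z"
  by (auto simp: vec2_def)

lemma vec2_inj: "vec2 z = vec2 w \<longleftrightarrow> z = w"
  by (auto simp: vec_eq_iff forall_2 prod_eq_iff)

lemma vec2_continuous: "continuous_on A vec2"
proof -
  have "continuous_on A (\<lambda>z. if i = 1 then fst z else snd z :: real)" for i :: 2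
    by (cases "i = 1") (auto intro!: continuous_intros)
  then show ?thesis unfolding vec2_def by (rule continuous_on_vec_lambda)
qed

lemma vec2_box: "z \<in> {x1..x2} \<times> {y1..y2} \<Longrightarrow> vec2 z \<in> cbox (vec2 (x1, y1)) (vec2 (x2, y2))"
  by (auto simp: mem_box_cart forall_2)

text \<open>With their extensions, two such threads are paths in a box whose ends interleave on its
bottom edge, so they meet by the Fashoda theorem. But different threads are disjoint, extensions of
different marked points are disjoint, and an extension meets the rectangle only in its marked point.\<close>

lemma threads_not_interleaved:
  assumes D: "(a, D) \<in> diagrams n" and p: "1 \<le> p" and less: "p < q" "q < matching_of n (a, D) p" "matching_of n (a, D) p < matching_of n (a, D) q"
  shows False
proof -
  note d = diagramsD[OF D]
  define f where "f = matching_of n (a, D)"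
  have M: "matching n f" unfolding f_def by (rule matching_of_is_matching[OF D])
  have pin: "p \<in> {1..2*n}"
  proof (rule ccontr)
    assume "p \<notin> {1..2*n}"
    then have "f p = p" using matching_of_outside f_def by metis
    then show False using less f_def by simp
  qed
  have fp: "f p \<in> {1..2*n}" using matching_range[OF M pin] .
  then have qin: "q \<in> {1..2*n}" using less pin f_def by auto
  have fq: "f q \<in> {1..2*n}" using matching_range[OF M qin] .
  have lt: "p < q" "q < f p" "f p < f q" using less f_def by auto
  have closed_thread: "\<exists>F. path F \<and> pathstart F = (extension_x n (f k), -1) \<and> pathfinish F = (extension_x n k, -1) \<and>
      path_image F = path_image (extension n a (f k)) \<union> connected_component_set D (mark n a k) \<union> path_image (extension n a k)"
    if k: "k \<in> {1..2*n}" for k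
  proof -
    have fk: "f k \<in> {1..2*n}" using matching_range[OF M k] .
    obtain g where g: "arc g" "pathstart g = mark n a k" "pathfinish g = mark n a (f k)"
      "path_image g = connected_component_set D (mark n a k)"
      using matching_of_arc[OF D k] f_def by metis
    define F where "F = extension n a (f k) +++ (reversepath g +++ reversepath (extension n a k))"
    note ek = extension_path[OF k, of a] and efk = extension_path[OF fk, of a]
    have "path F" unfolding F_def using g(2,3) arc_imp_path[OF g(1)] ek efk by (simp add: path_join)
    moreover have "pathstart F = (extension_x n (f k), -1)" "pathfinish F = (extension_x n k, -1)"
      unfolding F_def using ek efk by simp_all
    moreover have "path_image F = path_image (extension n a (f k)) \<union> connected_component_set D (mark n a k) \<union> path_image (extension n a k)"
      unfolding F_def using g ek efk by (simp add: path_image_join Un_assoc)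
    ultimately show ?thesis by blast
  qed
  obtain F where F: "path F" "pathstart F = (extension_x n (f q), -1)" "pathfinish F = (extension_x n q, -1)"
    "path_image F = path_image (extension n a (f q)) \<union> connected_component_set D (mark n a q) \<union> path_image (extension n a q)"
    using closed_thread[OF qin] by blast
  obtain G where G: "path G" "pathstart G = (extension_x n (f p), -1)" "pathfinish G = (extension_x n p, -1)"
    "path_image G = path_image (extension n a (f p)) \<union> connected_component_set D (mark n a p) \<union> path_image (extension n a p)"
    using closed_thread[OF pin] by blast
  define B where "B = {0..2 * real n + 2} \<times> {-1..a + real n + 1}"
  have "R n a \<subseteq> B" using d(1) by (auto simp: R_def B_def)
  then have cB: "connected_component_set D x \<subseteq> B" for x
    using d(2) connected_component_subset[of D x] by blast
  have FB: "path_image F \<subseteq> B" "path_image G \<subseteq> B"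
    unfolding F(4) G(4) using cB extension_box[OF _ d(1)] pin qin fp fq unfolding B_def by blast+
  have paths: "path (vec2 \<circ> F)" "path (vec2 \<circ> G)"
    using F(1) G(1) vec2_continuous path_continuous_image by blast+
  have boxF: "path_image (vec2 \<circ> F) \<subseteq> cbox (vec2 (0, -1)) (vec2 (2 * real n + 2, a + real n + 1))"
    unfolding path_image_compose using FB(1) vec2_box unfolding B_def by blast
  have boxG: "path_image (vec2 \<circ> G) \<subseteq> cbox (vec2 (0, -1)) (vec2 (2 * real n + 2, a + real n + 1))"
    unfolding path_image_compose using FB(2) vec2_box unfolding B_def by blast
  obtain z where z: "z \<in> path_image (vec2 \<circ> F)" "z \<in> path_image (vec2 \<circ> G)"
    by (rule fashoda_interlace[OF paths boxF boxG])
      (use F(2,3) G(2,3) lt extension_x_less in \<open>simp_all add: pathstart_compose pathfinish_compose\<close>)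
  obtain x where x: "x \<in> path_image F" "z = vec2 x" using z(1) unfolding path_image_compose by blast
  obtain y where y: "y \<in> path_image G" "z = vec2 y" using z(2) unfolding path_image_compose by blast
  have "x = y" using x(2) y(2) vec2_inj by metis
  then have xG: "x \<in> path_image G" using y(1) by simp
  have comp_pts: "mark n a l \<notin> connected_component_set D (mark n a k)"
    if "k \<in> {1..2*n}" "l \<in> {1..2*n}" "l \<noteq> k" "l \<noteq> f k" for k l
    using matching_of_props(4)[OF D that(1,2,3)] that(4) f_def by auto
  have EC: "path_image (extension n a l) \<inter> connected_component_set D (mark n a k) = {}"
    if "k \<in> {1..2*n}" "l \<in> {1..2*n}" "l \<noteq> k" "l \<noteq> f k" for k l
    using extension_R[OF that(2) d(1)] comp_pts[OF that] connected_component_subset[of D "mark n a k"] d(2) by blast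
  have CC: "connected_component_set D (mark n a q) \<inter> connected_component_set D (mark n a p) = {}"
  proof (rule ccontr)
    assume "connected_component_set D (mark n a q) \<inter> connected_component_set D (mark n a p) \<noteq> {}"
    then have "connected_component D (mark n a p) (mark n a q)"
      using connected_component_trans connected_component_sym by fastforce
    then show False using matching_of_props(4)[OF D pin qin] lt f_def by simp
  qed
  have ffp: "f (f p) = p" "f (f q) = q" using M by (auto simp: matching_def)
  have "path_image (extension n a (f q)) \<inter> path_image G = {}"
    unfolding G(4) using extension_disjoint[OF fq fp _ d(1)] extension_disjoint[OF fq pin _ d(1)] EC[OF pin fq] lt by auto
  moreover have "path_image (extension n a q) \<inter> path_image G = {}"
    unfolding G(4) using extension_disjoint[OF qin fp _ d(1)] extension_disjoint[OF qin pin _ d(1)] EC[OF pin qin] lt by auto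
  moreover have "connected_component_set D (mark n a q) \<inter> path_image G = {}"
    unfolding G(4) using CC EC[OF qin fp] EC[OF qin pin] lt by auto
  ultimately show False using x(1) xG unfolding F(4) by blast
qed

lemma matching_of_noncrossing:
  assumes D: "(a, D) \<in> diagrams n"
  shows "noncrossing n (matching_of n (a, D))"
proof (rule noncrossingI)
  show M: "matching n (matching_of n (a, D))" by (rule matching_of_is_matching[OF D])
  fix p q assume pq: "1 \<le> p" "p < q" "q < matching_of n (a, D) p"
  define f where "f = matching_of n (a, D)"
  have ff: "f (f k) = k" for k using M by (simp add: matching_def f_def)
  have pin: "p \<in> {1..2*n}"
  proof (rule ccontr)
    assume "p \<notin> {1..2*n}"
    then have "f p = p" using matching_of_outside f_def by metis
    then show False using pq f_def by simp
  qed
  have fp: "f p \<in> {1..2*n}" using matching_range[OF M pin] f_def by simp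
  then have qin: "q \<in> {1..2*n}" using pq pin f_def by auto
  have fq1: "1 \<le> f q" using matching_range[OF M qin] f_def by simp
  have n1: "\<not> f p < f q" using threads_not_interleaved[OF D pq(1,2,3)] f_def by blast
  have n2: "\<not> f q < p"
  proof
    assume l: "f q < p"
    have "p < f (f q)" "f (f q) < f p" using ff pq f_def by simp_all
    then show False using threads_not_interleaved[OF D fq1[unfolded f_def], of p] l by (simp add: f_def)
  qed
  have "f q \<noteq> f p" "f q \<noteq> p" using ff pq f_def by (metis less_irrefl)+
  then show "matching_of n (a, D) q < matching_of n (a, D) p \<and> p < matching_of n (a, D) q" using n1 n2 f_def by simp
qed


section \<open>The unit, circular and diapsidal diagrams\<close>

lemma arc_family:
  fixes g :: "'i \<Rightarrow> real \<Rightarrow> 'a::euclidean_space"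
  assumes "finite I" "\<And>i. i \<in> I \<Longrightarrow> arc (g i)"
    and "\<And>i j. i \<in> I \<Longrightarrow> j \<in> I \<Longrightarrow> i \<noteq> j \<Longrightarrow> path_image (g i) \<inter> path_image (g j) = {}"
  defines "X \<equiv> (\<Union>i\<in>I. path_image (g i))"
  shows "compact X" "one_manifold_with_boundary X" "finite (components X)"
    "boundary_points X = (\<Union>i\<in>I. {pathstart (g i), pathfinish (g i)})" "circles X = {}"
proof -
  have "compact (\<Union>i\<in>I. path_image (g i)) \<and> one_manifold_with_boundary (\<Union>i\<in>I. path_image (g i)) \<and>
    finite (components (\<Union>i\<in>I. path_image (g i))) \<and>
    boundary_points (\<Union>i\<in>I. path_image (g i)) = (\<Union>i\<in>I. {pathstart (g i), pathfinish (g i)})"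
    using assms(1-3)
  proof (induction I rule: finite_induct)
    case empty
    then show ?case by (simp add: manifold_iff boundary_iff)
  next
    case (insert i I)
    let ?Y = "\<Union>i\<in>I. path_image (g i)"
    have IH: "compact ?Y" "one_manifold_with_boundary ?Y" "finite (components ?Y)"
      "boundary_points ?Y = (\<Union>i\<in>I. {pathstart (g i), pathfinish (g i)})"
      using insert by auto
    have gi: "arc (g i)" using insert by simp
    have dis: "path_image (g i) \<inter> ?Y = {}" using insert by blast
    have c: "compact (path_image (g i))" using gi compact_arc_image by blast
    have "components (path_image (g i)) = {path_image (g i)}"
      using connected_arc_image[OF gi] path_image_nonempty[of "g i"] components_eq_sing_iff by blast
    then have fin: "finite (components (path_image (g i) \<union> ?Y))"
      using finite_components_Un[OF _ IH(3), of "path_image (g i)"] by simp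
    have "closed (path_image (g i))" "closed ?Y" using c IH(1) compact_imp_closed by auto
    note G = glue_manifolds[OF this _ arc_manifold(1)[OF gi] IH(2), unfolded dis arc_manifold(2)[OF gi] IH(4)]
    show ?case using G c IH(1) fin by (simp add: insert_commute) blast
  qed
  then show X: "compact X" "one_manifold_with_boundary X" "finite (components X)"
    "boundary_points X = (\<Union>i\<in>I. {pathstart (g i), pathfinish (g i)})" by (auto simp: X_def)
  show "circles X = {}"
  proof (rule ccontr)
    assume "circles X \<noteq> {}"
    then obtain K where K: "K \<in> components X" "K \<inter> boundary_points X = {}" by (auto simp: circles_def)
    obtain x where x: "x \<in> K" using in_components_nonempty[OF K(1)] by blast
    then obtain i where i: "i \<in> I" "x \<in> path_image (g i)" using in_components_subset[OF K(1)] X_def by blast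
    have "path_image (g i) \<subseteq> K"
      by (rule components_maximal[OF K(1)]) (use i x assms(2) connected_arc_image X_def in blast)+
    then have "pathstart (g i) \<in> K" by auto
    then show False using K(2) X(4) i(1) by blast
  qed
qed

lemma vertical_image:
  assumes "a > 0" shows "path_image (linepath (x, 0) (x, a)) = {x} \<times> {0..a::real}"
  using assms by (simp add: closed_segment_same_fst closed_segment_eq_real_ivl)

text \<open>A parametrisation by the first coordinate; \<open>s = 1\<close> gives the upper and \<open>s = - 1\<close> the lower half of the circle.\<close>

definition semicircle :: "real \<Rightarrow> real \<Rightarrow> real \<Rightarrow> real \<Rightarrow> real \<Rightarrow> real \<times> real" where
  "semicircle x y r s t = (x - r + 2*r*t, y + s * (2*r * sqrt (t * (1 - t))))"

lemma semicircle_ends [simp]: "pathstart (semicircle x y r s) = (x - r, y)" "pathfinish (semicircle x y r s) = (x + r, y)"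
  by (simp_all add: pathstart_def pathfinish_def semicircle_def)

lemma semicircle_arc: "r > 0 \<Longrightarrow> arc (semicircle x y r s)"
  unfolding arc_def path_def semicircle_def by (auto intro!: continuous_intros inj_onI)

lemma sphere_pair:
  fixes r :: real
  assumes "r > 0"
  shows "(u, v) \<in> sphere (x, y) r \<longleftrightarrow> (x - u)\<^sup>2 + (y - v)\<^sup>2 = r\<^sup>2"
proof -
  have "(u, v) \<in> sphere (x, y) r \<longleftrightarrow> sqrt ((x - u)\<^sup>2 + (y - v)\<^sup>2) = sqrt (r\<^sup>2)"
    using assms by (simp add: dist_Pair_Pair dist_real_def)
  then show ?thesis by (simp only: real_sqrt_eq_iff)
qed

lemma semicircle_image:
  assumes r: "r > 0" and s: "s = 1 \<or> s = -1"
  shows "path_image (semicircle x y r s) = {p \<in> sphere (x, y) r. s * snd p \<ge> s * y}"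
proof
  have ss: "s * s = 1" using s by auto
  show "path_image (semicircle x y r s) \<subseteq> {p \<in> sphere (x, y) r. s * snd p \<ge> s * y}"
  proof
    fix p assume "p \<in> path_image (semicircle x y r s)"
    then obtain t where t: "t \<in> {0..1}" "p = semicircle x y r s t" by (auto simp: path_image_def)
    have nn: "t * (1 - t) \<ge> 0" using t by simp
    have "(x - (x - r + 2*r*t))\<^sup>2 + (y - (y + s * (2*r * sqrt (t * (1 - t)))))\<^sup>2
        = (r - 2*r*t)\<^sup>2 + (s * s) * (4 * r\<^sup>2 * (sqrt (t * (1 - t)))\<^sup>2)"
      by (simp add: power2_eq_square algebra_simps)
    also have "\<dots> = (r - 2*r*t)\<^sup>2 + 4 * r\<^sup>2 * (t * (1 - t))" using nn ss by simp
    also have "\<dots> = r\<^sup>2" by (simp add: power2_eq_square algebra_simps)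
    finally have "p \<in> sphere (x, y) r" unfolding t(2) semicircle_def using sphere_pair[OF r] by blast
    moreover have "s * snd p = s * y + (s * s) * (2*r * sqrt (t * (1 - t)))"
      unfolding t(2) semicircle_def by (simp add: algebra_simps)
    then have "s * snd p \<ge> s * y" using ss r nn by simp
    ultimately show "p \<in> {p \<in> sphere (x, y) r. s * snd p \<ge> s * y}" by simp
  qed
  show "{p \<in> sphere (x, y) r. s * snd p \<ge> s * y} \<subseteq> path_image (semicircle x y r s)"
  proof
    fix p assume p: "p \<in> {p \<in> sphere (x, y) r. s * snd p \<ge> s * y}"
    obtain u v where uv: "p = (u, v)" by fastforce
    have e: "(x - u)\<^sup>2 + (y - v)\<^sup>2 = r\<^sup>2" using p uv sphere_pair[OF r] by blast
    have sv: "s * (v - y) \<ge> 0" using p uv by (simp add: algebra_simps)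
    define t where "t = (u - x + r) / (2*r)"
    have "(x - u)\<^sup>2 \<le> r\<^sup>2" using e by (metis le_add_same_cancel1 zero_le_power2)
    then have "\<bar>x - u\<bar> \<le> r" using r by (simp add: abs_le_square_iff[of "x - u" r, symmetric])
    then have t: "t \<in> {0..1}" using r by (auto simp: t_def divide_simps)
    have u: "u = x - r + 2*r*t" using r by (simp add: t_def)
    have "(2*r)\<^sup>2 * (t * (1 - t)) = (y - v)\<^sup>2" using e unfolding u by (simp add: power2_eq_square algebra_simps)
    then have "2*r * sqrt (t * (1 - t)) = \<bar>y - v\<bar>"
      using r by (metis abs_of_pos mult_pos_pos real_sqrt_abs real_sqrt_mult zero_less_numeral)
    then have "v = y + s * (2*r * sqrt (t * (1 - t)))" using s sv by auto
    then show "p \<in> path_image (semicircle x y r s)" unfolding path_image_def uv using t u by (auto simp: semicircle_def)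
  qed
qed

text \<open>It is enough to connect each point with a later partner, because matchings are involutions.\<close>

lemma matching_of_eqI:
  assumes D: "(a, D) \<in> diagrams n" and f: "matching n f"
    and conn: "\<And>p. p \<in> {1..2*n} \<Longrightarrow> p < f p \<Longrightarrow> connected_component D (mark n a p) (mark n a (f p))"
  shows "matching_of n (a, D) = f"
proof
  fix p
  show "matching_of n (a, D) p = f p"
  proof (cases "p \<in> {1..2*n}")
    case True
    have r: "f p \<in> {1..2*n}" "f p \<noteq> p" "f (f p) = p"
      using matching_range[OF f True] f True by (auto simp: matching_def)
    have "connected_component D (mark n a p) (mark n a (f p))"
    proof (cases "p < f p")
      case False
      then have "connected_component D (mark n a (f p)) (mark n a (f (f p)))" using conn[OF r(1)] r by simp
      then show ?thesis using r(3) connected_component_sym by metis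
    qed (use conn True in blast)
    then show ?thesis using matching_of_props(4)[OF D True r(1,2)] by simp
  next
    case False
    then have "f p = p" using f by (simp add: matching_def)
    then show ?thesis using matching_of_outside False by metis
  qed
qed

lemma conn_pathI: "path g \<Longrightarrow> path_image g \<subseteq> D \<Longrightarrow> x \<in> path_image g \<Longrightarrow> y \<in> path_image g \<Longrightarrow> connected_component D x y"
  unfolding connected_component_def using connected_path_image by blast

definition strands :: "nat \<Rightarrow> (real \<times> real) set" where
  "strands n = (real ` {1..n}) \<times> {0..1}"

lemma strands_facts:
  "compact (strands n)" "one_manifold_with_boundary (strands n)" "finite (components (strands n))"
  "boundary_points (strands n) = top_points n 1 \<union> bottom_points n" "circles (strands n) = {}"
proof -
  define g where "g j = linepath (real j, 0) (real j, 1::real)" for j :: nat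
  have im: "path_image (g j) = {real j} \<times> {0..1}" for j using vertical_image[of 1 "real j"] by (simp add: g_def)
  have X: "(\<Union>j\<in>{1..n}. path_image (g j)) = strands n" by (auto simp: im strands_def)
  have arcs: "arc (g j)" for j by (simp add: g_def)
  note F = arc_family[of "{1..n}" g, OF finite_atLeastAtMost arcs, unfolded X]
  have dis: "path_image (g i) \<inter> path_image (g j) = {}" if "i \<noteq> j" for i j using that by (auto simp: im)
  have "(\<Union>j\<in>{1..n}. {pathstart (g j), pathfinish (g j)}) = top_points n 1 \<union> bottom_points n"
    by (auto simp: g_def top_points_def bottom_points_def)
  then show "compact (strands n)" "one_manifold_with_boundary (strands n)" "finite (components (strands n))"
    "boundary_points (strands n) = top_points n 1 \<union> bottom_points n" "circles (strands n) = {}"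
    using F dis by auto
qed

lemma strand_conn:
  assumes "p \<in> {1..n}" "strands n \<subseteq> D"
  shows "connected_component D (mark n 1 p) (mark n 1 (2*n + 1 - p))"
proof (rule conn_pathI)
  show "path (linepath (real p, 0) (real p, 1::real))" by simp
  show "path_image (linepath (real p, 0) (real p, 1)) \<subseteq> D"
    using assms unfolding vertical_image[OF zero_less_one] strands_def by blast
qed (use assms in \<open>auto simp: vertical_image mark_def simp del: path_image_linepath\<close>)

lemma unit_diagram_props: "unit_diagram n \<in> diagrams n" "matching_of n (unit_diagram n) = id_matching n" "circle_count (unit_diagram n) = 0"
proof -
  have e: "unit_diagram n = (1, strands n)" by (simp add: unit_diagram_def strands_def)
  have "strands n \<subseteq> R n 1" "strands n \<inter> R_top n 1 = top_points n 1" "strands n \<inter> R_bottom n = bottom_points n"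
    by (auto simp: strands_def R_def R_top_def R_bottom_def top_points_def bottom_points_def)
  then have D: "(1, strands n) \<in> diagrams n" unfolding diagrams_def using strands_facts by auto
  then show "unit_diagram n \<in> diagrams n" by (simp add: e)
  show "matching_of n (unit_diagram n) = id_matching n" unfolding e
  proof (rule matching_of_eqI[OF D noncrossing_matching[OF noncrossing_id_matching]])
    fix p assume "p \<in> {1..2*n}" "p < id_matching n p"
    then have "p \<in> {1..n}" "id_matching n p = 2*n + 1 - p" by (auto simp: id_matching_def)
    then show "connected_component (strands n) (mark n 1 p) (mark n 1 (id_matching n p))"
      using strand_conn by simp
  qed
  show "circle_count (unit_diagram n) = 0" by (simp add: e circle_count_def strands_facts(5))
qed

lemma circular_diagram_props:
  assumes "n \<ge> 1"
  shows "circular_diagram n \<in> diagrams n" "matching_of n (circular_diagram n) = id_matching n" "circle_count (circular_diagram n) = 1"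
proof -
  define K :: "(real \<times> real) set" where "K = sphere (1/2, 1/2) (1/4)"
  define u where "u = semicircle (1/2) (1/2) (1/4) 1"
  define l where "l = semicircle (1/2) (1/2) (1/4) (-1)"
  have im: "path_image u = {p \<in> K. snd p \<ge> 1/2}" "path_image l = {p \<in> K. snd p \<le> 1/2}"
    using semicircle_image[of "1/4" 1 "1/2" "1/2"] semicircle_image[of "1/4" "-1" "1/2" "1/2"] by (auto simp: u_def l_def K_def)
  have K: "K = path_image u \<union> path_image l" unfolding im by auto
  have arcs: "arc u" "arc l" by (auto simp: u_def l_def semicircle_arc)
  have ends: "pathstart u = pathstart l" "pathfinish u = pathfinish l" by (simp_all add: u_def l_def)
  have Kco: "1/4 \<le> x \<and> x \<le> 3/4 \<and> 1/4 \<le> y \<and> y \<le> 3/4" if "(x, y) \<in> K" for x y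
  proof -
    have e: "(1/2 - x)\<^sup>2 + (1/2 - y)\<^sup>2 = (1/4)\<^sup>2" using that sphere_pair[of "1/4" x y "1/2" "1/2"] by (simp add: K_def)
    have "(1/2 - x)\<^sup>2 \<le> (1/4)\<^sup>2" "(1/2 - y)\<^sup>2 \<le> (1/4)\<^sup>2"
      using e zero_le_power2[of "1/2 - x"] zero_le_power2[of "1/2 - y"] by linarith+
    then have "\<bar>1/2 - x\<bar> \<le> \<bar>1/4\<bar>" "\<bar>1/2 - y\<bar> \<le> \<bar>1/4\<bar>" using abs_le_square_iff by blast+
    then have "1/4 \<le> x" "x \<le> 3/4" "1/4 \<le> y" "y \<le> 3/4" by linarith+
    then show ?thesis by simp
  qed
  have "path_image u \<inter> path_image l \<subseteq> {pathstart u, pathfinish u}"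
  proof
    fix p assume p: "p \<in> path_image u \<inter> path_image l"
    obtain x y where xy: "p = (x, y)" by fastforce
    have xyK: "(x, y) \<in> K" and "y = 1/2" using p xy im by auto
    have "(1/2 - x)\<^sup>2 + (1/2 - y)\<^sup>2 = (1/4)\<^sup>2"
      using xyK sphere_pair[of "1/4" x y "1/2" "1/2"] by (simp add: K_def)
    then have "(1/2 - x)\<^sup>2 = (1/4)\<^sup>2" unfolding \<open>y = 1/2\<close> by simp
    then have "1/2 - x = 1/4 \<or> 1/2 - x = - (1/4)" using power2_eq_iff by blast
    then have "x = 1/4 \<or> x = 3/4" by linarith
    then show "p \<in> {pathstart u, pathfinish u}" using xy \<open>y = 1/2\<close> by (auto simp: u_def)
  qed
  note M = two_arcs_manifold[OF arcs ends this, folded K]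
  have Kc: "compact K" "connected K" "K \<noteq> {}"
    unfolding K using arcs compact_arc_image connected_arc_image pathstart_in_path_image[of u] pathstart_in_path_image[of l] ends
    by (auto intro!: connected_Un)
  have Kcomp: "components K = {K}" using Kc components_eq_sing_iff by blast
  have "(x, y) \<notin> K" if "(x, y) \<in> strands n" for x y
  proof
    assume "(x, y) \<in> K"
    obtain j where "x = real j" "1 \<le> j" using \<open>(x, y) \<in> strands n\<close> by (auto simp: strands_def)
    then have "1 \<le> x" by simp
    then show False using Kco[OF \<open>(x, y) \<in> K\<close>] by linarith
  qed
  then have dis: "strands n \<inter> K = {}" by auto
  define D where "D = strands n \<union> K"
  have e: "circular_diagram n = (1, D)" by (simp add: circular_diagram_def D_def strands_def K_def)
  note s = strands_facts[of n]
  have cl: "closed (strands n)" "closed K" using s(1) Kc(1) compact_imp_closed by auto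
  note G = glue_manifolds[OF cl _ s(2) M(1), unfolded dis M(2) s(4), folded D_def]
  have bd: "boundary_points D = top_points n 1 \<union> bottom_points n" using G(2) by simp
  have "K \<subseteq> R n 1" "K \<inter> R_top n 1 = {}" "K \<inter> R_bottom n = {}"
    using Kco by (fastforce simp: R_def R_top_def R_bottom_def)+
  moreover have "strands n \<subseteq> R n 1" "strands n \<inter> R_top n 1 = top_points n 1" "strands n \<inter> R_bottom n = bottom_points n"
    by (auto simp: strands_def R_def R_top_def R_bottom_def top_points_def bottom_points_def)
  ultimately have "D \<subseteq> R n 1" "D \<inter> R_top n 1 = top_points n 1" "D \<inter> R_bottom n = bottom_points n"
    unfolding D_def by blast+
  moreover have "finite (components D)" unfolding D_def using finite_components_Un[OF s(3), of K] Kcomp by simp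
  moreover have "compact D" unfolding D_def using s(1) Kc(1) by blast
  ultimately have D: "(1, D) \<in> diagrams n" unfolding diagrams_def using G(1) bd by simp
  then show "circular_diagram n \<in> diagrams n" by (simp add: e)
  show "matching_of n (circular_diagram n) = id_matching n" unfolding e
  proof (rule matching_of_eqI[OF D noncrossing_matching[OF noncrossing_id_matching]])
    fix p assume "p \<in> {1..2*n}" "p < id_matching n p"
    then have "p \<in> {1..n}" "id_matching n p = 2*n + 1 - p" by (auto simp: id_matching_def)
    then show "connected_component D (mark n 1 p) (mark n 1 (id_matching n p))"
      using strand_conn[of p n D] by (simp add: D_def)
  qed
  have comps: "components D = components (strands n) \<union> {K}"
    using components_Un_avoiding[OF s(1,3) Kc(1)] Kcomp unfolding dis D_def by simp
  have "K \<inter> boundary_points D = {}"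
  proof -
    have "boundary_points D \<subseteq> strands n" unfolding bd s(4)[symmetric] by (rule boundary_subset)
    then show ?thesis using dis by blast
  qed
  moreover have "C \<inter> boundary_points D \<noteq> {}" if "C \<in> components (strands n)" for C
    using that s(5) unfolding bd s(4)[symmetric] circles_def by blast
  ultimately have "circles D = {K}" unfolding circles_def comps by blast
  then show "circle_count (circular_diagram n) = 1" by (simp add: e circle_count_def)
qed

lemma act_id_matching:
  assumes "1 \<le> i" "i < n"
  shows "act i (id_matching n) = (\<lambda>p. if p = i then Suc i else if p = Suc i then i
    else if p = 2*n + 1 - i then 2*n - i else if p = 2*n - i then 2*n + 1 - i else id_matching n p)"
proof
  fix p
  define q where "q = 2*n - i"
  have q: "2*n - i = q" "2*n + 1 - i = Suc q" "Suc i < q" using assms by (auto simp: q_def)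
  have e: "id_matching n i = Suc q" "id_matching n (Suc i) = q" using assms by (auto simp: id_matching_def q_def)
  show "act i (id_matching n) p = (if p = i then Suc i else if p = Suc i then i
    else if p = 2*n + 1 - i then 2*n - i else if p = 2*n - i then 2*n + 1 - i else id_matching n p)"
    unfolding act_def fun_upd_apply Suc_eq_plus1[symmetric] e
    unfolding Suc_eq_plus1 q unfolding Suc_eq_plus1[symmetric] using q(3) by auto
qed

lemma diapsidal_diagram_props:
  assumes i: "1 \<le> i" "i < n"
  shows "diapsidal_diagram n i \<in> diagrams n" "matching_of n (diapsidal_diagram n i) = act i (id_matching n)"
    "circle_count (diapsidal_diagram n i) = 0"
proof -
  define a where "a = diapsidal_height n"
  have a: "a \<ge> 5" by (simp add: a_def diapsidal_height_def)
  define g where "g j = (if j = i then semicircle (real i + 1/2) a (1/2) (-1)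
    else if j = Suc i then semicircle (real i + 1/2) 0 (1/2) 1
    else linepath (real j, 0) (real j, a))" for j
  have im: "path_image (g i) = {p \<in> sphere (real i + 1/2, a) (1/2). snd p \<le> a}"
    "path_image (g (Suc i)) = {p \<in> sphere (real i + 1/2, 0) (1/2). snd p \<ge> 0}"
    using semicircle_image[of "1/2" "-1" "real i + 1/2" a] semicircle_image[of "1/2" 1 "real i + 1/2" 0] by (auto simp: g_def)
  have imj: "path_image (g j) = {real j} \<times> {0..a}" if "j \<noteq> i" "j \<noteq> Suc i" for j
    using vertical_image[of a "real j"] a that by (simp add: g_def)
  define D where "D = (\<Union>j\<in>{1..n}. path_image (g j))"
  have "{1..n} = insert i (insert (Suc i) ({1..n} - {i, i + 1}))" using i by auto
  then have sp: "(\<Union>j\<in>{1..n}. F j) = F i \<union> F (Suc i) \<union> (\<Union>j\<in>{1..n} - {i, i + 1}. F j)"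
    for F :: "nat \<Rightarrow> (real \<times> real) set" by (metis UN_insert Un_assoc)
  have D_eq: "D = path_image (g i) \<union> path_image (g (Suc i)) \<union> (real ` ({1..n} - {i, i + 1})) \<times> {0..a}"
  proof -
    have "(\<Union>j\<in>{1..n} - {i, i + 1}. path_image (g j)) = (real ` ({1..n} - {i, i + 1})) \<times> {0..a}"
      using imj by auto
    then show ?thesis unfolding D_def sp by simp
  qed
  have e: "diapsidal_diagram n i = (a, D)"
    unfolding diapsidal_diagram_def Let_def a_def[symmetric] D_eq im by simp
  have cup: "real i \<le> x \<and> x \<le> real i + 1 \<and> a - 1/2 \<le> y \<and> y \<le> a \<and> (y = a \<longrightarrow> x = real i \<or> x = real i + 1)"
    if xy: "(x, y) \<in> path_image (g i)" for x y
  proof -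
    obtain t where t0: "t \<in> {0..1}" "(x, y) = g i t" using xy unfolding path_image_def by blast
    have t: "t \<in> {0..1}" "x = real i + t" "y = a - sqrt (t * (1 - t))"
      using t0 by (simp_all add: g_def semicircle_def)
    have "t * (1 - t) \<le> (1/2)\<^sup>2" using zero_le_power2[of "t - 1/2"] by (simp add: power2_eq_square algebra_simps)
    then have "sqrt (t * (1 - t)) \<le> 1/2" by (metis real_sqrt_abs abs_of_pos half_gt_zero_iff real_sqrt_le_mono zero_less_one)
    moreover have "0 \<le> sqrt (t * (1 - t))" using t by simp
    moreover have "sqrt (t * (1 - t)) = 0 \<longrightarrow> t = 0 \<or> t = 1" by auto
    ultimately show ?thesis using t by auto
  qed
  have cap: "real i \<le> x \<and> x \<le> real i + 1 \<and> 0 \<le> y \<and> y \<le> 1/2 \<and> (y = 0 \<longrightarrow> x = real i \<or> x = real i + 1)"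
    if xy: "(x, y) \<in> path_image (g (Suc i))" for x y
  proof -
    obtain t where t0: "t \<in> {0..1}" "(x, y) = g (Suc i) t" using xy unfolding path_image_def by blast
    have t: "t \<in> {0..1}" "x = real i + t" "y = sqrt (t * (1 - t))"
      using t0 by (simp_all add: g_def semicircle_def)
    have "t * (1 - t) \<le> (1/2)\<^sup>2" using zero_le_power2[of "t - 1/2"] by (simp add: power2_eq_square algebra_simps)
    then have "sqrt (t * (1 - t)) \<le> 1/2" by (metis real_sqrt_abs abs_of_pos half_gt_zero_iff real_sqrt_le_mono zero_less_one)
    moreover have "0 \<le> sqrt (t * (1 - t))" using t by simp
    moreover have "sqrt (t * (1 - t)) = 0 \<longrightarrow> t = 0 \<or> t = 1" by auto
    ultimately show ?thesis using t by auto
  qed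
  have arcs: "arc (g j)" for j using a by (auto simp: g_def semicircle_arc)
  have ends: "{pathstart (g i), pathfinish (g i)} = {(real i, a), (real (Suc i), a)}"
    "{pathstart (g (Suc i)), pathfinish (g (Suc i))} = {(real i, 0), (real (Suc i), 0)}"
    by (simp_all add: g_def add.commute)
  have endsj: "{pathstart (g j), pathfinish (g j)} = {(real j, 0), (real j, a)}" if "j \<noteq> i" "j \<noteq> Suc i" for j
    using that by (simp add: g_def)
  have d1: "path_image (g i) \<inter> path_image (g (Suc i)) = {}" using cup cap a by fastforce
  have d2: "path_image (g i) \<inter> path_image (g j) = {} \<and> path_image (g (Suc i)) \<inter> path_image (g j) = {}"
    if "j \<noteq> i" "j \<noteq> Suc i" for j
  proof -
    have "\<not> (real i \<le> real j \<and> real j \<le> real i + 1)" using that by linarith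
    then show ?thesis unfolding imj[OF that] using cup cap by fastforce
  qed
  have d3: "path_image (g j) \<inter> path_image (g k) = {}" if "j \<noteq> i" "j \<noteq> Suc i" "k \<noteq> i" "k \<noteq> Suc i" "j \<noteq> k" for j k
    unfolding imj[OF that(1,2)] imj[OF that(3,4)] using that(5) by auto
  have dis: "path_image (g j) \<inter> path_image (g k) = {}" if "j \<noteq> k" for j k
    using d1 d2[of j] d2[of k] d3[of j k] that by (metis Int_commute)
  note F = arc_family[of "{1..n}" g, OF finite_atLeastAtMost arcs dis, folded D_def]
  have bd: "boundary_points D = top_points n a \<union> bottom_points n"
  proof -
    have "boundary_points D = {pathstart (g i), pathfinish (g i)} \<union> {pathstart (g (Suc i)), pathfinish (g (Suc i))} \<union>
       (\<Union>j\<in>{1..n} - {i, i + 1}. {pathstart (g j), pathfinish (g j)})"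
    proof -
      have "boundary_points D = (\<Union>j\<in>{1..n}. {pathstart (g j), pathfinish (g j)})" using F(4) by simp
      then show ?thesis unfolding sp .
    qed
    also have "(\<Union>j\<in>{1..n} - {i, i + 1}. {pathstart (g j), pathfinish (g j)}) = (\<Union>j\<in>{1..n} - {i, i + 1}. {(real j, 0), (real j, a)})"
      by (rule SUP_cong) (use endsj in auto)
    also have "{pathstart (g i), pathfinish (g i)} \<union> {pathstart (g (Suc i)), pathfinish (g (Suc i))} =
        {(real i, 0), (real i, a)} \<union> {(real (Suc i), 0), (real (Suc i), a)}"
      unfolding ends by blast
    also have "\<dots> \<union> (\<Union>j\<in>{1..n} - {i, i + 1}. {(real j, 0), (real j, a)}) = (\<Union>j\<in>{1..n}. {(real j, 0), (real j, a)})"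
      by (rule sp[symmetric])
    also have "\<dots> = top_points n a \<union> bottom_points n"
      by (auto simp: top_points_def bottom_points_def)
    finally show ?thesis .
  qed
  have inR: "D \<subseteq> R n a"
  proof -
    have "(x, y) \<in> R n a" if "(x, y) \<in> path_image (g i)" for x y
      using cup[OF that] a i by (auto simp: R_def)
    moreover have "(x, y) \<in> R n a" if "(x, y) \<in> path_image (g (Suc i))" for x y
      using cap[OF that] a i by (auto simp: R_def)
    moreover have "(real ` ({1..n} - {i, i + 1})) \<times> {0..a} \<subseteq> R n a" by (auto simp: R_def)
    ultimately show ?thesis unfolding D_eq by auto
  qed
  have bdD: "top_points n a \<subseteq> D" "bottom_points n \<subseteq> D" using bd boundary_subset[of D] by auto
  have "(x, y) \<in> top_points n a" if xy: "(x, y) \<in> D" "y = a" for x y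
  proof -
    have "\<exists>j\<in>{1..n}. x = real j"
    proof -
      consider "(x, y) \<in> path_image (g i)" | "(x, y) \<in> path_image (g (Suc i))" | "x \<in> real ` ({1..n} - {i, i + 1})"
        using xy(1) unfolding D_eq by blast
      then show ?thesis
      proof cases
        case 1
        then have "x = real i \<or> x = real (Suc i)" using cup[OF 1] xy(2) by auto
        then show ?thesis using i by (metis Suc_leI atLeastAtMost_iff le_SucI less_imp_le_nat)
      next
        case 2
        then show ?thesis using cap[OF 2] xy(2) a by auto
      qed blast
    qed
    then show ?thesis using xy(2) by (auto simp: top_points_def)
  qed
  then have top: "D \<inter> R_top n a = top_points n a"
    using bdD(1) inR by (auto simp: R_top_def top_points_def)
  have "(x, y) \<in> bottom_points n" if xy: "(x, y) \<in> D" "y = 0" for x y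
  proof -
    have "\<exists>j\<in>{1..n}. x = real j"
    proof -
      consider "(x, y) \<in> path_image (g i)" | "(x, y) \<in> path_image (g (Suc i))" | "x \<in> real ` ({1..n} - {i, i + 1})"
        using xy(1) unfolding D_eq by blast
      then show ?thesis
      proof cases
        case 2
        then have "x = real i \<or> x = real (Suc i)" using cap[OF 2] xy(2) by auto
        then show ?thesis using i by (metis Suc_leI atLeastAtMost_iff le_SucI less_imp_le_nat)
      next
        case 1
        then show ?thesis using cup[OF 1] xy(2) a by auto
      qed blast
    qed
    then show ?thesis using xy(2) by (auto simp: bottom_points_def)
  qed
  then have bot: "D \<inter> R_bottom n = bottom_points n"
    using bdD(2) inR by (auto simp: R_bottom_def bottom_points_def)
  have D: "(a, D) \<in> diagrams n" unfolding diagrams_def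
    using F(1-3) bd inR top bot a by simp
  then show "diapsidal_diagram n i \<in> diagrams n" by (simp add: e)
  have M: "matching n (act i (id_matching n))" using matching_act[OF noncrossing_matching[OF noncrossing_id_matching]] i by simp
  show "matching_of n (diapsidal_diagram n i) = act i (id_matching n)" unfolding e
  proof (rule matching_of_eqI[OF D M])
    fix p assume p: "p \<in> {1..2*n}" "p < act i (id_matching n) p"
    have conn: "connected_component D x y" if "j \<in> {1..n}" "x \<in> path_image (g j)" "y \<in> path_image (g j)" for j x y
      using conn_pathI[of "g j" D x y] arcs[of j] arc_imp_path that D_def by blast
    have gin: "{pathstart (g j), pathfinish (g j)} \<subseteq> path_image (g j)" for j
      using pathstart_in_path_image[of "g j"] pathfinish_in_path_image[of "g j"] by blast
    consider "p = i" | "p = 2*n - i" | "p \<in> {1..n}" "p \<noteq> i" "p \<noteq> Suc i"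
      using p i unfolding act_id_matching[OF i] by (auto simp: id_matching_def split: if_splits)
    then show "connected_component D (mark n a p) (mark n a (act i (id_matching n) p))"
    proof cases
      case 1
      then have "act i (id_matching n) p = Suc i" unfolding act_id_matching[OF i] by simp
      then show ?thesis using conn[of i] gin[of i] ends(1) i 1 by (simp add: mark_def)
    next
      case 2
      then have v: "act i (id_matching n) p = 2*n + 1 - i" unfolding act_id_matching[OF i] using i by auto
      have "mark n a p = (real (Suc i), 0)" "mark n a (2*n + 1 - i) = (real i, 0)"
        using 2 i by (auto simp: mark_def)
      then show ?thesis using conn[of "Suc i"] gin[of "Suc i"] ends(2) i v by simp
    next
      case 3
      have v: "act i (id_matching n) p = 2*n + 1 - p" unfolding act_id_matching[OF i] using 3 i by (auto simp: id_matching_def)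
      have "mark n a p = (real p, a)" "mark n a (2*n + 1 - p) = (real p, 0)" using 3 by (auto simp: mark_def)
      then show ?thesis using conn[of p] gin[of p] endsj[OF 3(2,3)] 3(1) v by simp
    qed
  qed
  show "circle_count (diapsidal_diagram n i) = 0" by (simp add: e circle_count_def F(5))
qed


section \<open>The isomorphism\<close>

primrec diagram_of :: "nat \<Rightarrow> kterm \<Rightarrow> diagram" where
  "diagram_of n (Diap i) = diapsidal_diagram n i"
| "diagram_of n Circ = circular_diagram n"
| "diagram_of n One = unit_diagram n"
| "diagram_of n (Comp t u) = dcomp (diagram_of n t) (diagram_of n u)"

definition invariants :: "nat \<Rightarrow> diagram \<Rightarrow> (nat \<Rightarrow> nat) \<times> nat" where
  "invariants n X = (matching_of n X, circle_count X)"

lemma diagram_rel_iff_inv: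
  "(X, Y) \<in> diagram_rel n \<longleftrightarrow> X \<in> diagrams n \<and> Y \<in> diagrams n \<and> invariants n X = invariants n Y"
  by (simp add: diagram_rel_iff invariants_def)

lemma diagram_of_in_diagrams: "n \<ge> 1 \<Longrightarrow> t \<in> kterms n \<Longrightarrow> diagram_of n t \<in> diagrams n"
  by (induction t)
    (auto simp: unit_diagram_props circular_diagram_props diapsidal_diagram_props intro: dcomp_in_diagrams)

lemma dcomp_upper_identity:
  assumes "X \<in> diagrams n" "Y \<in> diagrams n" "matching_of n Y = id_matching n"
  shows "invariants n (dcomp X Y) = (matching_of n X, circle_count X + circle_count Y)"
proof (cases X, cases Y)
  fix b L a U assume e: "X = (b, L)" "Y = (a, U)"
  interpret composition n a b U L using assms e by unfold_locales auto
  show ?thesis using matching_of_dcomp_upper_identity(1) circle_count_dcomp_upper_identity assms(3) e by (simp add: invariants_def)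
qed

lemma dcomp_lower_identity:
  assumes "X \<in> diagrams n" "Y \<in> diagrams n" "matching_of n X = id_matching n"
  shows "invariants n (dcomp X Y) = (matching_of n Y, circle_count X + circle_count Y)"
proof (cases X, cases Y)
  fix b L a U assume e: "X = (b, L)" "Y = (a, U)"
  interpret composition n a b U L using assms e by unfold_locales auto
  show ?thesis using matching_of_dcomp_lower_identity(1) circle_count_dcomp_lower_identity assms(3) e by (simp add: invariants_def)
qed

lemma dcomp_diapsidal:
  assumes "X \<in> diagrams n" "1 \<le> i" "i < n"
  shows "invariants n (dcomp X (diapsidal_diagram n i)) = act_inv i (invariants n X)"
proof (cases X, cases "diapsidal_diagram n i")
  fix b L a U assume e: "X = (b, L)" "diapsidal_diagram n i = (a, U)"
  note d = diapsidal_diagram_props[OF assms(2,3), unfolded e(2)]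
  interpret composition n a b U L using assms(1) e(1) d(1) by unfold_locales auto
  show ?thesis using dcomp_act[OF assms(2,3) d(2)] d(3) e by (simp add: invariants_def act_inv_def)
qed

text \<open>The next lemmas are the relations (hc2), (h2) and (h1) on the level of matchings.\<close>

lemma act_of_pair:
  assumes "g i = Suc i" "g (Suc i) = i"
  shows "act i g = g"
  using assms by (auto simp: act_def fun_eq_iff)

lemma act_pair:
  assumes "matching n f" "1 \<le> i" "i < 2*n"
  shows "act i f i = Suc i" "act i f (Suc i) = i"
proof -
  have ne: "f i \<noteq> i" "f (Suc i) \<noteq> Suc i" using assms by (auto simp: matching_def)
  have sw: "f (Suc i) = i \<longleftrightarrow> f i = Suc i" using assms(1) unfolding matching_def by metis
  have "act i f i = Suc i \<and> act i f (Suc i) = i"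
  proof (cases "f i = Suc i")
    case True
    then show ?thesis using sw by (simp add: act_def)
  next
    case False
    then have "i \<noteq> f (Suc i)" "Suc i \<noteq> f i" "i \<noteq> f i" "Suc i \<noteq> f (Suc i)" using sw ne by metis+
    then show ?thesis by (simp add: act_def)
  qed
  then show "act i f i = Suc i" "act i f (Suc i) = i" by simp_all
qed

lemma act_twice:
  assumes "matching n f" "1 \<le> i" "i < 2*n"
  shows "act i (act i f) = act i f" "loops i (act i f) = 1"
  using act_of_pair act_pair[OF assms] by (auto simp: loops_def)

lemma act_braid_pair:
  assumes f: "matching n g" and i: "1 \<le> i" "Suc i < 2*n"
  shows "g i = Suc i \<Longrightarrow> act i (act (Suc i) g) = g \<and> loops (Suc i) g = 0 \<and> loops i (act (Suc i) g) = 0"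
    and "g (Suc i) = Suc (Suc i) \<Longrightarrow> act (Suc i) (act i g) = g \<and> loops i g = 0 \<and> loops (Suc i) (act i g) = 0"
proof -
  have gg: "g (g p) = p" for p using f by (simp add: matching_def)
  have ne: "g i \<noteq> i" "g (Suc i) \<noteq> Suc i" "g (Suc (Suc i)) \<noteq> Suc (Suc i)" using f i by (auto simp: matching_def)
  {
    assume a: "g i = Suc i"
    then have b: "g (Suc i) = i" using gg by metis
    define r where "r = g (Suc (Suc i))"
    have gr: "g r = Suc (Suc i)" using gg by (simp add: r_def)
    then have r: "r \<noteq> i" "r \<noteq> Suc i" "r \<noteq> Suc (Suc i)" "g r = Suc (Suc i)"
      using a b ne(3) r_def by auto
    have e: "act (Suc i) g = g(Suc i := Suc (Suc i), Suc (Suc i) := Suc i, i := r, r := i)"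
      by (simp add: act_def b r_def)
    have "act i (act (Suc i) g) = g"
    proof
      fix p show "act i (act (Suc i) g) p = g p"
        unfolding act_def[of i] e using r a b r_def by auto
    qed
    then show "act i (act (Suc i) g) = g \<and> loops (Suc i) g = 0 \<and> loops i (act (Suc i) g) = 0"
      using e r b by (simp add: loops_def)
  }
  {
    assume a: "g (Suc i) = Suc (Suc i)"
    then have b: "g (Suc (Suc i)) = Suc i" using gg by metis
    define r where "r = g i"
    have gr: "g r = i" using gg by (simp add: r_def)
    then have r: "r \<noteq> i" "r \<noteq> Suc i" "r \<noteq> Suc (Suc i)" "g r = i"
      using a b ne(1) r_def by auto
    have e: "act i g = g(i := Suc i, Suc i := i, r := Suc (Suc i), Suc (Suc i) := r)"
      by (simp add: act_def a r_def)
    have "act (Suc i) (act i g) = g"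
    proof
      fix p show "act (Suc i) (act i g) p = g p"
        unfolding act_def[of "Suc i"] e using r a b r_def by auto
    qed
    then show "act (Suc i) (act i g) = g \<and> loops i g = 0 \<and> loops (Suc i) (act i g) = 0"
      using e r a by (simp add: loops_def r_def[symmetric])
  }
qed

text \<open>The identity matching suffices, since the two sides of (h1) are compared as composites of diagrams that start from the unit diagram.\<close>

lemma act_commute_id_matching:
  assumes i: "1 \<le> i" and j: "i + 2 \<le> j" "j < n"
  shows "act i (act j (id_matching n)) = act j (act i (id_matching n))"
    "loops i (act j (id_matching n)) = 0" "loops j (act i (id_matching n)) = 0"
proof -
  define q where "q = 2*n - i"
  define r where "r = 2*n - j"
  have e: "id_matching n i = Suc q" "id_matching n (Suc i) = q" "id_matching n j = Suc r" "id_matching n (Suc j) = r"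
    using assms by (auto simp: id_matching_def q_def r_def)
  have o: "Suc i < j" "Suc j \<le> r" "Suc r < q" "Suc i < r" "j < q" using assms by (auto simp: q_def r_def)
  have ei: "act i (id_matching n) = (id_matching n)(i := Suc i, Suc i := i, Suc q := q, q := Suc q)"
    unfolding act_def Suc_eq_plus1[symmetric] e ..
  have ej: "act j (id_matching n) = (id_matching n)(j := Suc j, Suc j := j, Suc r := r, r := Suc r)"
    unfolding act_def Suc_eq_plus1[symmetric] e ..
  have vi: "act i (id_matching n) j = Suc r" "act i (id_matching n) (Suc j) = r" using o e unfolding ei by auto
  have vj: "act j (id_matching n) i = Suc q" "act j (id_matching n) (Suc i) = q" using o e unfolding ej by auto
  have eij: "act i (act j (id_matching n)) = (act j (id_matching n))(i := Suc i, Suc i := i, Suc q := q, q := Suc q)"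
    unfolding act_def[of i] Suc_eq_plus1[symmetric] vj ..
  have eji: "act j (act i (id_matching n)) = (act i (id_matching n))(j := Suc j, Suc j := j, Suc r := r, r := Suc r)"
    unfolding act_def[of j] Suc_eq_plus1[symmetric] vi ..
  show "act i (act j (id_matching n)) = act j (act i (id_matching n))"
    unfolding eij eji unfolding ei ej
  proof
    fix p
    show "((id_matching n)(j := Suc j, Suc j := j, Suc r := r, r := Suc r, i := Suc i, Suc i := i, Suc q := q, q := Suc q)) p =
      ((id_matching n)(i := Suc i, Suc i := i, Suc q := q, q := Suc q, j := Suc j, Suc j := j, Suc r := r, r := Suc r)) p"
      using o by simp
  qed
  show "loops i (act j (id_matching n)) = 0" "loops j (act i (id_matching n)) = 0"
    using vi vj o by (auto simp: loops_def)
qed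

lemma loops_id_matching: "1 \<le> i \<Longrightarrow> i < n \<Longrightarrow> loops i (id_matching n) = 0"
  by (auto simp: loops_def id_matching_def)

lemma inv_diapsidal: "1 \<le> i \<Longrightarrow> i < n \<Longrightarrow> invariants n (diapsidal_diagram n i) = (act i (id_matching n), 0)"
  by (simp add: invariants_def diapsidal_diagram_props)

lemma diagram_rel_refl: "X \<in> diagrams n \<Longrightarrow> (X, X) \<in> diagram_rel n"
  by (simp add: diagram_rel_iff)

text \<open>Congruence and associativity are properties of the composition of diagrams; all other clauses are checked
on the matchings and on the numbers of circles.\<close>

lemma kauffman_eq_sound:
  assumes n: "n \<ge> 1" and "kauffman_eq n t u"
  shows "(diagram_of n t, diagram_of n u) \<in> diagram_rel n"
  using assms(2)
proof (induction rule: kauffman_eq.induct)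
  case (refl t)
  then show ?case using diagram_of_in_diagrams[OF n] diagram_rel_refl by blast
next
  case (sym t u)
  then show ?case by (simp add: diagram_rel_iff)
next
  case (trans t u v)
  then show ?case by (simp add: diagram_rel_iff)
next
  case (cong t t' u u')
  then show ?case using dcomp_cong by simp
next
  case (assoc t u v)
  then have "diagram_of n (Comp (Comp t u) v) \<in> diagrams n" using diagram_of_in_diagrams[OF n] by (simp add: dcomp_in_diagrams)
  then show ?case using diagram_rel_refl by (simp add: dcomp_assoc)
next
  case (left_unit t)
  have t: "diagram_of n t \<in> diagrams n" using left_unit diagram_of_in_diagrams[OF n] by blast
  show ?case
    using dcomp_lower_identity[OF unit_diagram_props(1) t unit_diagram_props(2)] t
      dcomp_in_diagrams[OF unit_diagram_props(1) t] unit_diagram_props(3)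
    by (simp add: diagram_rel_iff_inv invariants_def)
next
  case (right_unit t)
  have t: "diagram_of n t \<in> diagrams n" using right_unit diagram_of_in_diagrams[OF n] by blast
  show ?case
    using dcomp_upper_identity[OF t unit_diagram_props(1,2)] t
      dcomp_in_diagrams[OF t unit_diagram_props(1)] unit_diagram_props(3)
    by (simp add: diagram_rel_iff_inv invariants_def)
next
  case (h1 i j)
  have r: "1 \<le> i" "i < n" "1 \<le> j" "j < n" "i + 2 \<le> j \<or> j + 2 \<le> i" using h1 by auto
  have k: "diapsidal_diagram n i \<in> diagrams n" "diapsidal_diagram n j \<in> diagrams n"
    using r diapsidal_diagram_props(1) by auto
  have "act_inv j (act i (id_matching n), 0) = act_inv i (act j (id_matching n), 0)"
    using r act_commute_id_matching[of i j n] act_commute_id_matching[of j i n] by (auto simp: act_inv_def)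
  then show ?case
    using r k dcomp_in_diagrams dcomp_diapsidal inv_diapsidal by (simp add: diagram_rel_iff_inv)
next
  case (h2 i j)
  have r: "1 \<le> i" "i < n" "1 \<le> j" "j < n" "j = Suc i \<or> i = Suc j" using h2 by auto
  have k: "diapsidal_diagram n i \<in> diagrams n" "diapsidal_diagram n j \<in> diagrams n"
    using r diapsidal_diagram_props(1) by auto
  define g where "g = act i (id_matching n)"
  have g: "matching n g" "g i = Suc i"
    using matching_act[OF noncrossing_matching[OF noncrossing_id_matching]] act_pair[OF noncrossing_matching[OF noncrossing_id_matching], of i n] r by (auto simp: g_def)
  have "act i (act j g) = g \<and> loops j g = 0 \<and> loops i (act j g) = 0"
    using r(5)
  proof
    assume "j = Suc i"
    then show ?thesis using act_braid_pair(1)[OF g(1) r(1) _ g(2)] r by simp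
  next
    assume "i = Suc j"
    then show ?thesis using act_braid_pair(2)[OF g(1) r(3)] g(2) r by simp
  qed
  then have "act_inv i (act_inv j (g, 0)) = (g, 0)" by (simp add: act_inv_def)
  then show ?case
    using r k dcomp_in_diagrams dcomp_diapsidal inv_diapsidal by (simp add: diagram_rel_iff_inv g_def)
next
  case (hc1 i)
  have r: "1 \<le> i" "i < n" using hc1 by auto
  note c = circular_diagram_props[OF n]
  have k: "diapsidal_diagram n i \<in> diagrams n" using r diapsidal_diagram_props(1) by auto
  show ?case
    using dcomp_upper_identity[OF k c(1,2)] dcomp_diapsidal[OF c(1) r] c k dcomp_in_diagrams
      diapsidal_diagram_props[OF r] loops_id_matching[OF r]
    by (simp add: diagram_rel_iff_inv act_inv_def invariants_def)
next
  case (hc2 i)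
  have r: "1 \<le> i" "i < n" using hc2 by auto
  note c = circular_diagram_props[OF n]
  have k: "diapsidal_diagram n i \<in> diagrams n" using r diapsidal_diagram_props(1) by auto
  have "i < 2*n" using r by simp
  show ?case
    using dcomp_diapsidal[OF k r] dcomp_diapsidal[OF c(1) r] c k dcomp_in_diagrams
      diapsidal_diagram_props[OF r] loops_id_matching[OF r] act_twice[OF noncrossing_matching[OF noncrossing_id_matching[of n]] r(1) \<open>i < 2*n\<close>]
    by (simp add: diagram_rel_iff_inv act_inv_def invariants_def)
qed

lemma invariants_word:
  assumes n: "n \<ge> 1" and "w \<in> words n"
  shows "invariants n (diagram_of n (product (word k w))) = eval_word w (id_matching n, k)"
  using assms(2)
proof (induction w rule: rev_induct)
  case Nil
  have "invariants n (diagram_of n (product (replicate k Circ))) = (id_matching n, k)"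
  proof (induction k)
    case 0
    show ?case by (simp add: invariants_def unit_diagram_props)
  next
    case (Suc k)
    have "set (replicate k Circ) \<subseteq> gens n" by (auto simp: gens_def)
    then have d: "diagram_of n (product (replicate k Circ)) \<in> diagrams n" using diagram_of_in_diagrams[OF n] product_kterms by blast
    have "product (replicate (Suc k) Circ) = Comp (product (replicate k Circ)) Circ"
      by (metis replicate_Suc replicate_append_same product_simps(2))
    then show ?case
      using dcomp_upper_identity[OF d circular_diagram_props(1,2)[OF n]] circular_diagram_props(3)[OF n] Suc
      by (simp add: invariants_def)
  qed
  then show ?case by (simp add: word_def eval_word_def)
next
  case (snoc i w)
  have i: "1 \<le> i" "i < n" "w \<in> words n" using snoc.prems by auto
  have d: "diagram_of n (product (word k w)) \<in> diagrams n" using diagram_of_in_diagrams[OF n] product_kterms word_gens i(3) by blast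
  have "word k (w @ [i]) = word k w @ [Diap i]" by (simp add: word_def)
  then show ?case using dcomp_diapsidal[OF d i(1,2)] snoc.IH[OF i(3)] by (simp add: eval_word_def)
qed

lemma gen_list_word:
  assumes "set xs \<subseteq> gens n"
  shows "\<exists>k w. w \<in> words n \<and> list_eq n xs (word k w)"
  using assms
proof (induction xs rule: rev_induct)
  case Nil
  have "list_eq n [] (word 0 [])" using list_eq_refl[of "[]" n] by (simp add: word_def)
  then show ?case using words_simps(1) by blast
next
  case (snoc x xs)
  then obtain k w where w: "w \<in> words n" "list_eq n xs (word k w)" by auto
  have x: "x \<in> gens n" "set xs \<subseteq> gens n" using snoc by auto
  have wg: "set (word k w) \<subseteq> gens n" using word_gens[OF w(1)] .
  have 1: "list_eq n (xs @ [x]) (word k w @ [x])"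
    by (rule list_eq_append[OF w(2) list_eq_refl]) (use x wg in auto)
  show ?case
  proof (cases "x = Circ")
    case True
    have "list_eq n (word k w @ [Circ]) (Circ # word k w)" using Circ_central[OF wg] .
    moreover have "Circ # word k w = word (Suc k) w" by (simp add: word_def)
    ultimately show ?thesis using list_eq_trans[OF 1] w(1) True by metis
  next
    case False
    then obtain i where i: "x = Diap i" "i \<in> {1..n-1}" using x by (auto simp: gens_def)
    then have "word k w @ [x] = word k (w @ [i])" "w @ [i] \<in> words n" using w(1) by (auto simp: word_def)
    then show ?thesis using 1 by metis
  qed
qed

lemma term_gens:
  assumes "t \<in> kterms n"
  shows "\<exists>xs. set xs \<subseteq> gens n \<and> kauffman_eq n t (product xs)"
  using assms
proof (induction t)
  case (Diap i)
  then have "kauffman_eq n (Diap i) (product [Diap i])"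
    using kauffman_eq.sym[OF kauffman_eq.left_unit] by (simp add: product_def)
  then show ?case using Diap by (intro exI[of _ "[Diap i]"]) (simp add: gens_def)
next
  case Circ
  then have "kauffman_eq n Circ (product [Circ])"
    using kauffman_eq.sym[OF kauffman_eq.left_unit] by (simp add: product_def)
  then show ?case by (intro exI[of _ "[Circ]"]) (simp add: gens_def)
next
  case One
  then show ?case by (intro exI[of _ "[]"]) (simp add: kauffman_eq.refl)
next
  case (Comp t u)
  then obtain xs ys where xs: "set xs \<subseteq> gens n" "kauffman_eq n t (product xs)" and ys: "set ys \<subseteq> gens n" "kauffman_eq n u (product ys)"
    by auto
  have "kauffman_eq n (Comp t u) (product (xs @ ys))"
    using kauffman_eq.trans[OF kauffman_eq.cong[OF xs(2) ys(2)] kauffman_eq.sym[OF product_append[OF xs(1) ys(1)]]] .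
  then show ?case using xs(1) ys(1) by (intro exI[of _ "xs @ ys"]) simp
qed

lemma term_word:
  assumes "t \<in> kterms n"
  shows "\<exists>k w. w \<in> words n \<and> kauffman_eq n t (product (word k w))"
proof -
  obtain xs where xs: "set xs \<subseteq> gens n" "kauffman_eq n t (product xs)" using term_gens[OF assms] by blast
  obtain k w where "w \<in> words n" "list_eq n xs (word k w)" using gen_list_word[OF xs(1)] by blast
  then show ?thesis using kauffman_eq.trans[OF xs(2)] unfolding list_eq_def by blast
qed

text \<open>Both terms are equal to the normal form of the same matching, with the same number of circles in front.\<close>

lemma kauffman_eq_complete:
  assumes n: "n \<ge> 1" and t: "t \<in> kterms n" and u: "u \<in> kterms n"
    and eq: "(diagram_of n t, diagram_of n u) \<in> diagram_rel n"
  shows "kauffman_eq n t u"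
proof -
  obtain k w where w: "w \<in> words n" "kauffman_eq n t (product (word k w))" using term_word[OF t] by blast
  obtain l v where v: "v \<in> words n" "kauffman_eq n u (product (word l v))" using term_word[OF u] by blast
  have "invariants n (diagram_of n (product (word k w))) = invariants n (diagram_of n (product (word l v)))"
    using kauffman_eq_sound[OF n w(2)] kauffman_eq_sound[OF n v(2)] eq by (simp add: diagram_rel_iff_inv)
  then have e: "eval_word w (id_matching n, k) = eval_word v (id_matching n, l)"
    using invariants_word[OF n w(1)] invariants_word[OF n v(1)] by simp
  obtain f m where f: "eval_word w (id_matching n, k) = (f, m)" by fastforce
  have 1: "word_eq n k w m (normal_form n f)" using word_nf[OF w(1) f] by simp
  have 2: "word_eq n l v m (normal_form n f)" using word_nf[OF v(1)] f e by simp
  have "word_eq n k w l v" using word_eq_trans[OF 1 word_eq_sym[OF 2]] .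
  then have "kauffman_eq n (product (word k w)) (product (word l v))" by (simp add: word_eq_def list_eq_def)
  then show ?thesis
    using kauffman_eq.trans[OF w(2) kauffman_eq.trans[OF _ kauffman_eq.sym[OF v(2)]]] by blast
qed

text \<open>The normal form of the matching, preceded by as many circles as the diagram has, is a preimage.\<close>

lemma diagram_of_surj:
  assumes n: "n \<ge> 1" and X: "X \<in> diagrams n"
  shows "\<exists>t\<in>kterms n. (diagram_of n t, X) \<in> diagram_rel n"
proof -
  obtain a D where e: "X = (a, D)" by fastforce
  define f where "f = matching_of n X"
  have f: "noncrossing n f" using matching_of_noncrossing X unfolding f_def e by blast
  define t where "t = product (word (circle_count X) (normal_form n f))"
  have w: "normal_form n f \<in> words n" using nf_words[OF f] by simp
  have t: "t \<in> kterms n" unfolding t_def using product_kterms word_gens[OF w] by blast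
  have "invariants n (diagram_of n t) = (f, circle_count X)" unfolding t_def using invariants_word[OF n w] eval_nf[OF f] by simp
  then have "(diagram_of n t, X) \<in> diagram_rel n"
    using diagram_of_in_diagrams[OF n t] X by (simp add: diagram_rel_iff_inv invariants_def f_def)
  then show ?thesis using t by blast
qed


lemma dclass_eq_iff: "X \<in> diagrams n \<Longrightarrow> Y \<in> diagrams n \<Longrightarrow> dclass n X = dclass n Y \<longleftrightarrow> (X, Y) \<in> diagram_rel n"
  unfolding dclass_def using eq_equiv_class_iff[OF equiv_diagram_rel] .

lemma UN_UN_constant:
  assumes "x \<in> A" "y \<in> B" "\<And>x y. x \<in> A \<Longrightarrow> y \<in> B \<Longrightarrow> F x y = c"
  shows "(\<Union>x\<in>A. \<Union>y\<in>B. F x y) = c"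
proof -
  have "(\<Union>x\<in>A. \<Union>y\<in>B. F x y) = (\<Union>x\<in>A. \<Union>y\<in>B. c)" using assms(3) by simp
  then show ?thesis using assms(1,2) by auto
qed

lemma dclass_mult:
  assumes "X \<in> diagrams n" "Y \<in> diagrams n"
  shows "dclass n X \<otimes>\<^bsub>diagram_monoid n\<^esub> dclass n Y = dclass n (dcomp X Y)"
proof -
  have eq: "dclass n (dcomp X' Y') = dclass n (dcomp X Y)" if "X' \<in> dclass n X" "Y' \<in> dclass n Y" for X' Y'
  proof -
    have "(X, X') \<in> diagram_rel n" "(Y, Y') \<in> diagram_rel n" using that by (auto simp: dclass_def)
    then have "(dcomp X Y, dcomp X' Y') \<in> diagram_rel n" by (rule dcomp_cong)
    then show ?thesis unfolding dclass_def using equiv_class_eq[OF equiv_diagram_rel] by metis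
  qed
  have "X \<in> dclass n X" "Y \<in> dclass n Y" using assms by (auto simp: dclass_def diagram_rel_refl)
  then have "(\<Union>D\<in>dclass n X. \<Union>E\<in>dclass n Y. dclass n (dcomp D E)) = dclass n (dcomp X Y)"
    by (rule UN_UN_constant) (rule eq)
  then show ?thesis by (simp add: diagram_monoid_def)
qed

lemma dclass_carrier: "X \<in> diagrams n \<Longrightarrow> dclass n X \<in> carrier (diagram_monoid n)"
  by (auto simp: diagram_monoid_def dclass_def intro: quotientI)

lemma diagram_carrierE:
  assumes "x \<in> carrier (diagram_monoid n)"
  obtains X where "X \<in> diagrams n" "x = dclass n X"
  using assms by (auto simp: diagram_monoid_def dclass_def elim: quotientE)

lemma diagram_monoid: "monoid (diagram_monoid n)"
proof (rule monoidI)
  have one: "\<one>\<^bsub>diagram_monoid n\<^esub> = dclass n (unit_diagram n)" by (simp add: diagram_monoid_def)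
  show "\<one>\<^bsub>diagram_monoid n\<^esub> \<in> carrier (diagram_monoid n)"
    unfolding one by (rule dclass_carrier[OF unit_diagram_props(1)])
  fix x assume "x \<in> carrier (diagram_monoid n)"
  then obtain X where X: "X \<in> diagrams n" "x = dclass n X" using diagram_carrierE by metis
  have "(dcomp (unit_diagram n) X, X) \<in> diagram_rel n" "(dcomp X (unit_diagram n), X) \<in> diagram_rel n"
    using dcomp_lower_identity[OF unit_diagram_props(1) X(1) unit_diagram_props(2)]
      dcomp_upper_identity[OF X(1) unit_diagram_props(1,2)] X(1) dcomp_in_diagrams unit_diagram_props(1,3)
    by (simp_all add: diagram_rel_iff_inv invariants_def)
  then show "\<one>\<^bsub>diagram_monoid n\<^esub> \<otimes>\<^bsub>diagram_monoid n\<^esub> x = x" "x \<otimes>\<^bsub>diagram_monoid n\<^esub> \<one>\<^bsub>diagram_monoid n\<^esub> = x"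
    unfolding one X(2) using dclass_mult X(1) unit_diagram_props(1) dclass_eq_iff dcomp_in_diagrams by simp_all
  fix y assume "y \<in> carrier (diagram_monoid n)"
  then obtain Y where Y: "Y \<in> diagrams n" "y = dclass n Y" using diagram_carrierE by metis
  show "x \<otimes>\<^bsub>diagram_monoid n\<^esub> y \<in> carrier (diagram_monoid n)"
    unfolding X(2) Y(2) using dclass_mult X(1) Y(1) dclass_carrier dcomp_in_diagrams by simp
  fix z assume "z \<in> carrier (diagram_monoid n)"
  then obtain Z where Z: "Z \<in> diagrams n" "z = dclass n Z" using diagram_carrierE by metis
  show "x \<otimes>\<^bsub>diagram_monoid n\<^esub> y \<otimes>\<^bsub>diagram_monoid n\<^esub> z = x \<otimes>\<^bsub>diagram_monoid n\<^esub> (y \<otimes>\<^bsub>diagram_monoid n\<^esub> z)"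
    unfolding X(2) Y(2) Z(2) using dclass_mult X(1) Y(1) Z(1) dcomp_in_diagrams by (simp add: dcomp_assoc)
qed

lemma kauffman_rel_equiv: "equiv (kterms n) (kauffman_rel n)"
proof (rule equivI)
  show "kauffman_rel n \<subseteq> kterms n \<times> kterms n" using kauffman_eq_kterms by (auto simp: kauffman_rel_def)
  show "refl_on (kterms n) (kauffman_rel n)"
    using kauffman_eq_kterms by (auto simp: refl_on_def kauffman_rel_def intro: kauffman_eq.refl)
  show "sym (kauffman_rel n)" by (auto simp: sym_def kauffman_rel_def intro: kauffman_eq.sym)
  show "trans (kauffman_rel n)" by (auto simp: trans_def kauffman_rel_def intro: kauffman_eq.trans)
qed

lemma kclass_eq_iff: "t \<in> kterms n \<Longrightarrow> u \<in> kterms n \<Longrightarrow> kclass n t = kclass n u \<longleftrightarrow> kauffman_eq n t u"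
  unfolding kclass_def using eq_equiv_class_iff[OF kauffman_rel_equiv] by (simp add: kauffman_rel_def)

lemma kclass_mult:
  assumes "t \<in> kterms n" "u \<in> kterms n"
  shows "kclass n t \<otimes>\<^bsub>kauffman_monoid n\<^esub> kclass n u = kclass n (Comp t u)"
proof -
  have eq: "kclass n (Comp t' u') = kclass n (Comp t u)" if "t' \<in> kclass n t" "u' \<in> kclass n u" for t' u'
  proof -
    have "kauffman_eq n t t'" "kauffman_eq n u u'" using that by (auto simp: kclass_def kauffman_rel_def)
    then have "kauffman_eq n (Comp t u) (Comp t' u')" by (rule kauffman_eq.cong)
    then show ?thesis using kclass_eq_iff kauffman_eq_kterms by metis
  qed
  have "t \<in> kclass n t" "u \<in> kclass n u" using assms by (auto simp: kclass_def kauffman_rel_def kauffman_eq.refl)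
  then have "(\<Union>t'\<in>kclass n t. \<Union>u'\<in>kclass n u. kclass n (Comp t' u')) = kclass n (Comp t u)"
    by (rule UN_UN_constant) (rule eq)
  then show ?thesis by (simp add: kauffman_monoid_def)
qed

lemma kclass_carrier: "t \<in> kterms n \<Longrightarrow> kclass n t \<in> carrier (kauffman_monoid n)"
  by (auto simp: kauffman_monoid_def kclass_def intro: quotientI)

lemma kauffman_carrierE:
  assumes "x \<in> carrier (kauffman_monoid n)"
  obtains t where "t \<in> kterms n" "x = kclass n t"
  using assms by (auto simp: kauffman_monoid_def kclass_def elim: quotientE)

lemma kauffman_monoid: "monoid (kauffman_monoid n)"
proof (rule monoidI)
  have one: "\<one>\<^bsub>kauffman_monoid n\<^esub> = kclass n One" by (simp add: kauffman_monoid_def)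
  show "\<one>\<^bsub>kauffman_monoid n\<^esub> \<in> carrier (kauffman_monoid n)"
    unfolding one by (rule kclass_carrier) simp
  fix x assume "x \<in> carrier (kauffman_monoid n)"
  then obtain t where t: "t \<in> kterms n" "x = kclass n t" using kauffman_carrierE by metis
  show "\<one>\<^bsub>kauffman_monoid n\<^esub> \<otimes>\<^bsub>kauffman_monoid n\<^esub> x = x" "x \<otimes>\<^bsub>kauffman_monoid n\<^esub> \<one>\<^bsub>kauffman_monoid n\<^esub> = x"
    unfolding one t(2) using t(1) kauffman_eq.left_unit kauffman_eq.right_unit
    by (simp_all add: kclass_mult kclass_eq_iff)
  fix y assume "y \<in> carrier (kauffman_monoid n)"
  then obtain u where u: "u \<in> kterms n" "y = kclass n u" using kauffman_carrierE by metis
  show "x \<otimes>\<^bsub>kauffman_monoid n\<^esub> y \<in> carrier (kauffman_monoid n)"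
    unfolding t(2) u(2) using t(1) u(1) by (simp add: kclass_mult kclass_carrier)
  fix z assume "z \<in> carrier (kauffman_monoid n)"
  then obtain v where v: "v \<in> kterms n" "z = kclass n v" using kauffman_carrierE by metis
  show "x \<otimes>\<^bsub>kauffman_monoid n\<^esub> y \<otimes>\<^bsub>kauffman_monoid n\<^esub> z = x \<otimes>\<^bsub>kauffman_monoid n\<^esub> (y \<otimes>\<^bsub>kauffman_monoid n\<^esub> z)"
    unfolding t(2) u(2) v(2) using t(1) u(1) v(1) kauffman_eq.assoc
    by (simp add: kclass_mult kclass_eq_iff)
qed

lemma delta_diagram_of: "n \<ge> 1 \<Longrightarrow> t \<in> kterms n \<Longrightarrow> delta n t = dclass n (diagram_of n t)"
  by (induction t) (auto simp: dclass_mult diagram_of_in_diagrams)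

theorem mainTheorem1:
  fixes n :: nat
  assumes "n \<ge> 2"
  shows "monoid (kauffman_monoid n) \<and> monoid (diagram_monoid n) \<and>
    (\<forall>D1\<in>diagrams n. \<forall>D2\<in>diagrams n.
      dclass n D1 \<otimes>\<^bsub>diagram_monoid n\<^esub> dclass n D2 = dclass n (dcomp D1 D2)) \<and>
    (\<exists>\<delta>'. (\<forall>t\<in>kterms n. \<delta>' (kclass n t) = delta n t) \<and>
      \<delta>' \<in> iso (kauffman_monoid n) (diagram_monoid n) \<and>
      \<delta>' \<one>\<^bsub>kauffman_monoid n\<^esub> = \<one>\<^bsub>diagram_monoid n\<^esub>)"
proof -
  have n: "n \<ge> 1" using assms by simp
  have delta_eq: "delta n t = delta n u \<longleftrightarrow> kclass n t = kclass n u" if "t \<in> kterms n" "u \<in> kterms n" for t u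
    unfolding kclass_eq_iff[OF that] delta_diagram_of[OF n that(1)] delta_diagram_of[OF n that(2)]
      dclass_eq_iff[OF diagram_of_in_diagrams[OF n that(1)] diagram_of_in_diagrams[OF n that(2)]]
    using kauffman_eq_sound[OF n] kauffman_eq_complete[OF n that] by blast
  define \<delta>' where "\<delta>' x = delta n (SOME t. t \<in> kterms n \<and> x = kclass n t)" for x
  have val: "\<delta>' (kclass n t) = delta n t" if t: "t \<in> kterms n" for t
  proof -
    define u where "u = (SOME u. u \<in> kterms n \<and> kclass n t = kclass n u)"
    have "u \<in> kterms n \<and> kclass n t = kclass n u" unfolding u_def by (rule someI[of _ t]) (use t in simp)
    then show ?thesis unfolding \<delta>'_def u_def[symmetric] using delta_eq t by simp
  qed
  have hom: "\<delta>' \<in> hom (kauffman_monoid n) (diagram_monoid n)"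
  proof (rule homI)
    fix x assume "x \<in> carrier (kauffman_monoid n)"
    then obtain t where t: "t \<in> kterms n" "x = kclass n t" using kauffman_carrierE by metis
    then show "\<delta>' x \<in> carrier (diagram_monoid n)"
      using val delta_diagram_of[OF n] dclass_carrier diagram_of_in_diagrams[OF n] by simp
    fix y assume "y \<in> carrier (kauffman_monoid n)"
    then obtain u where u: "u \<in> kterms n" "y = kclass n u" using kauffman_carrierE by metis
    show "\<delta>' (x \<otimes>\<^bsub>kauffman_monoid n\<^esub> y) = \<delta>' x \<otimes>\<^bsub>diagram_monoid n\<^esub> \<delta>' y"
      unfolding t(2) u(2) kclass_mult[OF t(1) u(1)] val[OF t(1)] val[OF u(1)]
      using val[of "Comp t u"] t(1) u(1) by simp
  qed
  have "inj_on \<delta>' (carrier (kauffman_monoid n))"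
  proof (rule inj_onI)
    fix x y assume "x \<in> carrier (kauffman_monoid n)" "y \<in> carrier (kauffman_monoid n)" and xy: "\<delta>' x = \<delta>' y"
    then obtain t u where t: "t \<in> kterms n" "x = kclass n t" and u: "u \<in> kterms n" "y = kclass n u"
      using kauffman_carrierE by metis
    then show "x = y" using xy val delta_eq by simp
  qed
  moreover have "\<delta>' ` carrier (kauffman_monoid n) = carrier (diagram_monoid n)"
  proof
    show "\<delta>' ` carrier (kauffman_monoid n) \<subseteq> carrier (diagram_monoid n)"
      using hom by (auto simp: hom_def)
    show "carrier (diagram_monoid n) \<subseteq> \<delta>' ` carrier (kauffman_monoid n)"
    proof
      fix x assume "x \<in> carrier (diagram_monoid n)"
      then obtain X where X: "X \<in> diagrams n" "x = dclass n X" using diagram_carrierE by metis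
      obtain t where t: "t \<in> kterms n" "(diagram_of n t, X) \<in> diagram_rel n" using diagram_of_surj[OF n X(1)] by blast
      have "x = dclass n (diagram_of n t)"
        using dclass_eq_iff[OF diagram_of_in_diagrams[OF n t(1)] X(1)] t(2) X(2) by simp
      then have "x = \<delta>' (kclass n t)" using val[OF t(1)] delta_diagram_of[OF n t(1)] by simp
      then show "x \<in> \<delta>' ` carrier (kauffman_monoid n)" using kclass_carrier[OF t(1)] by blast
    qed
  qed
  ultimately have "\<delta>' \<in> iso (kauffman_monoid n) (diagram_monoid n)"
    using hom by (simp add: iso_def bij_betw_def)
  moreover have "\<delta>' \<one>\<^bsub>kauffman_monoid n\<^esub> = \<one>\<^bsub>diagram_monoid n\<^esub>"
    using val[of One] by (simp add: kauffman_monoid_def diagram_monoid_def)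
  ultimately have "\<exists>\<delta>'. (\<forall>t\<in>kterms n. \<delta>' (kclass n t) = delta n t) \<and>
      \<delta>' \<in> iso (kauffman_monoid n) (diagram_monoid n) \<and>
      \<delta>' \<one>\<^bsub>kauffman_monoid n\<^esub> = \<one>\<^bsub>diagram_monoid n\<^esub>"
    using val by (intro exI[of _ \<delta>']) simp
  then show ?thesis
    using kauffman_monoid[of n] diagram_monoid[of n] dclass_mult by simp
qed

end
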